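(* Let $\sigma$ be an almost periodic dynamics on a C$^*$-algebra $A$, with crystal $A_c=A_0/I$. Then the map $$\vartheta\colon A\to A_c=A_0/I,\qquad \vartheta(a)=E(a)+I,$$ is a completely positive contraction onto $A_c$. If $A_c\neq 0$, then the map $\psi\mapsto\psi\circ\vartheta$ defines a bijection between the state space of $A_c$ and the set of $\sigma$-ground states on $A$. If $A_c=0$, then there are no $\sigma$-ground states on $A$.
   Context: $A$ is a C$^*$-algebra and $\sigma=(\sigma_t)_{t\in\mathbb R}$ is a one-parameter group of automorphisms of $A$. For $\lambda\in\mathbb R$ put $A_\lambda=\{a\in A:\sigma_t(a)=e^{it\lambda}a\text{ for all }t\in\mathbb R\}$. The dynamics $\sigma$ is almost periodic if the linear span $\mathcal A$ of the spaces $A_\lambda$, $\lambda\in\mathbb R$ (a $*$-subalgebra), is dense in $A$. Let $I_\lambda=\overline{A_\lambda A_\lambda^*}$ (closed linear span of products), an ideal in $A_0$, and $I=\overline{\sum_{\lambda>0}I_\lambda}$. The crystal of $(A,\sigma)$ is $A_c=A_0/I$. Let $\Gamma\subset\mathbb R$ be the additive subgroup generated by the $\lambda$ with $A_\lambda\ne0$, viewed as a discrete group. The embedding $\Gamma\to\mathbb R$ gives a dual homomorphism $\mathbb R\to\hat\Gamma$ with dense image (using the pairing $(x,y)\mapsto e^{ixy}$ to identify $\hat{\mathbb R}$ with $\mathbb R$), and $\sigma$ extends by continuity to an action of the compact group $\hat\Gamma$ on $A$, still denoted $\sigma$. The conditional expectation $E\colon A\to A_0$ is $E(a)=\int_{\hat\Gamma}\sigma_\chi(a)\,d\chi$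 (normalized Haar measure); it satisfies $E(A_\lambda)=0$ for $\lambda\neq0$. A $\sigma$-ground state is a state $\phi$ on $A$ such that for every $a\in A$ and every $\sigma$-analytic element $b\in A$ the function $z\mapsto\phi(a\sigma_z(b))$ is bounded in the region $\operatorname{Im}z\ge0$. *)

theory Defs
  imports
    "HOL-Analysis.Analysis"
    "HOL-Library.Set_Algebras"
    "HOL-Computational_Algebra.Group_Closure"
begin

section \<open>C*-algebras\<close>

class scaleC = scaleR +
  fixes scaleC :: "complex \<Rightarrow> 'a \<Rightarrow> 'a"  (infixr \<open>*\<^sub>C\<close> 75)
  assumes scaleR_scaleC: "scaleR r = scaleC (complex_of_real r)"

text \<open>
  Neither a unit nor non-triviality is required; the zero algebra is included.
\<close>

class cstar_algebra = scaleC + real_normed_algebra + banach +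
  fixes star :: "'a \<Rightarrow> 'a"
  assumes scaleC_add_right: "c *\<^sub>C (x + y) = c *\<^sub>C x + c *\<^sub>C y"
    and scaleC_add_left: "(c + d) *\<^sub>C x = c *\<^sub>C x + d *\<^sub>C x"
    and scaleC_scaleC: "c *\<^sub>C (d *\<^sub>C x) = (c * d) *\<^sub>C x"
    and scaleC_mult_left: "(c *\<^sub>C x) * y = c *\<^sub>C (x * y)"
    and scaleC_mult_right: "x * (c *\<^sub>C y) = c *\<^sub>C (x * y)"
    and norm_scaleC: "norm (c *\<^sub>C x) = cmod c * norm x"
    and star_add: "star (x + y) = star x + star y"
    and star_scaleC: "star (c *\<^sub>C x) = cnj c *\<^sub>C star x"
    and star_mult: "star (x * y) = star y * star x"
    and star_star: "star (star x) = x"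
    and norm_star_mult: "norm (star x * x) = (norm x)\<^sup>2"

lemma scaleC_one: "1 *\<^sub>C x = (x :: 'a::cstar_algebra)"
  using scaleR_scaleC[of 1, THEN fun_cong, of x] by simp

global_interpretation cstar: vector_space "scaleC :: complex \<Rightarrow> 'a \<Rightarrow> 'a::cstar_algebra"
  defines cspan = cstar.span
  by unfold_locales (simp_all add: scaleC_add_right scaleC_add_left scaleC_scaleC scaleC_one)

text \<open>
  The crystal is a quotient depending on the dynamics, so it lives on a set of cosets rather
  than on a type of class \<^class>\<open>cstar_algebra\<close>. States and (completely) positive maps are
  therefore defined for operations given explicitly on a carrier; \<open>whole\<close> views a
  C*-algebra type in this way.
\<close>

record 'x star_alg =
  carr :: "'x set"
  zeroA :: 'x
  addA :: "'x \<Rightarrow> 'x \<Rightarrow> 'x"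
  scaleA :: "complex \<Rightarrow> 'x \<Rightarrow> 'x"
  multA :: "'x \<Rightarrow> 'x \<Rightarrow> 'x"
  starA :: "'x \<Rightarrow> 'x"
  normA :: "'x \<Rightarrow> real"

definition whole :: "'a::cstar_algebra star_alg" where
  "whole = \<lparr>carr = UNIV, zeroA = 0, addA = (+), scaleA = scaleC, multA = (*), starA = star,
    normA = norm\<rparr>"

definition linear_between :: "'x star_alg \<Rightarrow> 'y star_alg \<Rightarrow> ('x \<Rightarrow> 'y) \<Rightarrow> bool" where
  "linear_between S T f \<longleftrightarrow>
    (\<forall>x\<in>carr S. f x \<in> carr T) \<and>
    (\<forall>x\<in>carr S. \<forall>y\<in>carr S. f (addA S x y) = addA T (f x) (f y)) \<and>
    (\<forall>c. \<forall>x\<in>carr S. f (scaleA S c x) = scaleA T c (f x))"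

definition contraction :: "'x star_alg \<Rightarrow> 'y star_alg \<Rightarrow> ('x \<Rightarrow> 'y) \<Rightarrow> bool" where
  "contraction S T f \<longleftrightarrow> (\<forall>x\<in>carr S. normA T (f x) \<le> normA S x)"

primrec sumA :: "'x star_alg \<Rightarrow> (nat \<Rightarrow> 'x) \<Rightarrow> nat \<Rightarrow> 'x" where
  "sumA S f 0 = zeroA S"
| "sumA S f (Suc n) = addA S (sumA S f n) (f n)"

text \<open>
  An \<open>n \<times> n\<close> matrix over \<open>S\<close> is a function of two indices below \<open>n\<close>; it is
  positive in \<open>M\<^sub>n(S)\<close> if it is of the form \<open>Y\<^sup>* Y\<close>.
\<close>

definition positive_matrix :: "'x star_alg \<Rightarrow> nat \<Rightarrow> (nat \<Rightarrow> nat \<Rightarrow> 'x) \<Rightarrow> bool" where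
  "positive_matrix S n X \<longleftrightarrow>
    (\<exists>Y. (\<forall>i<n. \<forall>j<n. Y i j \<in> carr S) \<and>
      (\<forall>i<n. \<forall>j<n. X i j = sumA S (\<lambda>k. multA S (starA S (Y k i)) (Y k j)) n))"

definition completely_positive :: "'x star_alg \<Rightarrow> 'y star_alg \<Rightarrow> ('x \<Rightarrow> 'y) \<Rightarrow> bool" where
  "completely_positive S T f \<longleftrightarrow>
    linear_between S T f \<and>
    (\<forall>n X. positive_matrix S n X \<longrightarrow> positive_matrix T n (\<lambda>i j. f (X i j)))"

text \<open>
  States are taken in \<^const>\<open>extensional\<close>, so that functionals agreeing on the carrier are equal.
\<close>

definition state_space :: "'x star_alg \<Rightarrow> ('x \<Rightarrow> complex) set" where
  "state_space S = {\<phi> \<in> extensional (carr S).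
    (\<forall>x\<in>carr S. \<forall>y\<in>carr S. \<phi> (addA S x y) = \<phi> x + \<phi> y) \<and>
    (\<forall>c. \<forall>x\<in>carr S. \<phi> (scaleA S c x) = c * \<phi> x) \<and>
    (\<forall>x\<in>carr S. \<phi> (multA S (starA S x) x) \<in> \<real>\<^sub>\<ge>\<^sub>0) \<and>
    bdd_above ((\<lambda>x. cmod (\<phi> x)) ` {x \<in> carr S. normA S x \<le> 1}) \<and>
    (SUP x\<in>{x \<in> carr S. normA S x \<le> 1}. cmod (\<phi> x)) = 1}"


section \<open>Almost periodic dynamics and the crystal\<close>

definition star_automorphism :: "('a::cstar_algebra \<Rightarrow> 'a) \<Rightarrow> bool" where
  "star_automorphism f \<longleftrightarrow>
    bij f \<and> (\<forall>x y. f (x + y) = f x + f y) \<and> (\<forall>c x. f (c *\<^sub>C x) = c *\<^sub>C f x) \<and>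
    (\<forall>x y. f (x * y) = f x * f y) \<and> (\<forall>x. f (star x) = star (f x))"

definition dynamics :: "(real \<Rightarrow> 'a::cstar_algebra \<Rightarrow> 'a) \<Rightarrow> bool" where
  "dynamics \<sigma> \<longleftrightarrow>
    (\<forall>t. star_automorphism (\<sigma> t)) \<and> \<sigma> 0 = id \<and> (\<forall>s t. \<sigma> (s + t) = \<sigma> s \<circ> \<sigma> t)"

definition spectral_space :: "(real \<Rightarrow> 'a::cstar_algebra \<Rightarrow> 'a) \<Rightarrow> real \<Rightarrow> 'a set" where
  "spectral_space \<sigma> \<omega> = {a. \<forall>t. \<sigma> t a = exp (\<i> * of_real (t * \<omega>)) *\<^sub>C a}"

text \<open>
  Strong continuity of \<open>\<sigma>\<close> is not imposed: it follows from the density below, automorphisms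
  being isometric.
\<close>

definition almost_periodic :: "(real \<Rightarrow> 'a::cstar_algebra \<Rightarrow> 'a) \<Rightarrow> bool" where
  "almost_periodic \<sigma> \<longleftrightarrow>
    dynamics \<sigma> \<and> closure (cspan (\<Union>\<omega>. spectral_space \<sigma> \<omega>)) = UNIV"

definition spectral_ideal :: "(real \<Rightarrow> 'a::cstar_algebra \<Rightarrow> 'a) \<Rightarrow> real \<Rightarrow> 'a set" where
  "spectral_ideal \<sigma> \<omega> =
    closure (cspan {x * star y |x y. x \<in> spectral_space \<sigma> \<omega> \<and> y \<in> spectral_space \<sigma> \<omega>})"

definition crystal_ideal :: "(real \<Rightarrow> 'a::cstar_algebra \<Rightarrow> 'a) \<Rightarrow> 'a set" where
  "crystal_ideal \<sigma> = closure (cspan (\<Union>\<omega>\<in>{0<..}. spectral_ideal \<sigma> \<omega>))"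

text \<open>
  The quotient \<open>B/J\<close>: elements are the cosets \<open>b +o J\<close>, \<open>X + Y\<close> is the elementwise sum of
  sets, and the norm is the quotient norm. Scalar multiples and products of representatives
  need not exhaust a coset, so \<open>J\<close> is added to them.
\<close>

definition quotient_alg :: "'a::cstar_algebra set \<Rightarrow> 'a set \<Rightarrow> 'a set star_alg" where
  "quotient_alg B J = \<lparr>carr = (\<lambda>b. b +o J) ` B, zeroA = J, addA = (+),
    scaleA = (\<lambda>c X. \<Union>x\<in>X. (c *\<^sub>C x) +o J),
    multA = (\<lambda>X Y. \<Union>x\<in>X. \<Union>y\<in>Y. (x * y) +o J),
    starA = (\<lambda>X. star ` X),
    normA = (\<lambda>X. Inf (norm ` X))\<rparr>"

definition crystal :: "(real \<Rightarrow> 'a::cstar_algebra \<Rightarrow> 'a) \<Rightarrow> 'a set star_alg" where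
  "crystal \<sigma> = quotient_alg (spectral_space \<sigma> 0) (crystal_ideal \<sigma>)"


section \<open>The action of the compact dual group and the conditional expectation\<close>

definition frequency_group :: "(real \<Rightarrow> 'a::cstar_algebra \<Rightarrow> 'a) \<Rightarrow> real set" where
  "frequency_group \<sigma> = group_closure {\<omega>. spectral_space \<sigma> \<omega> \<noteq> {0}}"

text \<open>
  The dual of a discrete group \<open>\<Gamma>\<close> of reals. Characters are set to 0 outside \<open>\<Gamma>\<close>; with this
  convention the topology of the function type (pointwise convergence) induces the compact
  topology of the dual group, and the group operation is pointwise multiplication.
\<close>

definition dual_group :: "real set \<Rightarrow> (real \<Rightarrow> complex) set" where
  "dual_group \<Gamma> = {\<gamma>. (\<forall>x\<in>\<Gamma>. cmod (\<gamma> x) = 1) \<and>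
    (\<forall>x\<in>\<Gamma>. \<forall>y\<in>\<Gamma>. \<gamma> (x + y) = \<gamma> x * \<gamma> y) \<and> (\<forall>x. x \<notin> \<Gamma> \<longrightarrow> \<gamma> x = 0)}"

definition dual_embedding :: "real set \<Rightarrow> real \<Rightarrow> real \<Rightarrow> complex" where
  "dual_embedding \<Gamma> t = (\<lambda>x. if x \<in> \<Gamma> then exp (\<i> * of_real (t * x)) else 0)"

text \<open>
  Extension by continuity: the limit of \<open>\<sigma>\<^sub>t(a)\<close> as the image of \<open>t\<close> in the dual group tends
  to \<open>\<gamma>\<close>.
\<close>

definition dual_action ::
    "(real \<Rightarrow> 'a::cstar_algebra \<Rightarrow> 'a) \<Rightarrow> (real \<Rightarrow> complex) \<Rightarrow> 'a \<Rightarrow> 'a" where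
  "dual_action \<sigma> \<gamma> a =
    Lim (filtercomap (dual_embedding (frequency_group \<sigma>)) (nhds \<gamma>)) (\<lambda>t. \<sigma> t a)"

definition normalized_haar_measure ::
    "(real \<Rightarrow> complex) set \<Rightarrow> (real \<Rightarrow> complex) measure \<Rightarrow> bool" where
  "normalized_haar_measure G \<mu> \<longleftrightarrow>
    sets \<mu> = sets (restrict_space borel G) \<and> emeasure \<mu> G = 1 \<and>
    (\<forall>\<gamma>\<in>G. \<forall>B\<in>sets \<mu>. emeasure \<mu> ((\<lambda>\<eta> x. \<gamma> x * \<eta> x) ` B) = emeasure \<mu> B) \<and>
    (\<forall>B\<in>sets \<mu>. emeasure \<mu> B = (SUP K\<in>{K. compact K \<and> K \<subseteq> B}. emeasure \<mu> K))"

text \<open>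
  The Bochner integral. This repeats the definition of \<^const>\<open>has_bochner_integral\<close>, whose
  target type is restricted to second countable spaces; a C*-algebra need not be separable.
\<close>

definition has_vector_integral :: "'m measure \<Rightarrow> ('m \<Rightarrow> 'a::banach) \<Rightarrow> 'a \<Rightarrow> bool" where
  "has_vector_integral M f v \<longleftrightarrow> f \<in> borel_measurable M \<and>
    (\<exists>s. (\<forall>i::nat. Bochner_Integration.simple_bochner_integrable M (s i)) \<and>
      (\<lambda>i. \<integral>\<^sup>+x. norm (f x - s i x) \<partial>M) \<longlonglongrightarrow> 0 \<and>
      (\<lambda>i. Bochner_Integration.simple_bochner_integral M (s i)) \<longlonglongrightarrow> v)"

definition cond_expectation ::
    "(real \<Rightarrow> 'a::cstar_algebra \<Rightarrow> 'a) \<Rightarrow> (real \<Rightarrow> complex) measure \<Rightarrow> 'a \<Rightarrow> 'a" where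
  "cond_expectation \<sigma> \<mu> a = (THE v. has_vector_integral \<mu> (\<lambda>\<gamma>. dual_action \<sigma> \<gamma> a) v)"

definition crystal_map ::
    "(real \<Rightarrow> 'a::cstar_algebra \<Rightarrow> 'a) \<Rightarrow> (real \<Rightarrow> complex) measure \<Rightarrow> 'a \<Rightarrow> 'a set" where
  "crystal_map \<sigma> \<mu> a = cond_expectation \<sigma> \<mu> a +o crystal_ideal \<sigma>"


section \<open>Ground states\<close>

text \<open>
  An element \<open>b\<close> is analytic if \<open>t \<mapsto> \<sigma>\<^sub>t(b)\<close> has an entire extension \<open>F\<close>; then
  \<open>\<sigma>\<^sub>z(b)\<close> denotes \<open>F(z)\<close>, which is unique by the identity theorem.
\<close>

definition entire_extension ::
    "(real \<Rightarrow> 'a::cstar_algebra \<Rightarrow> 'a) \<Rightarrow> 'a \<Rightarrow> (complex \<Rightarrow> 'a) \<Rightarrow> bool" where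
  "entire_extension \<sigma> b F \<longleftrightarrow>
    (\<forall>t. F (complex_of_real t) = \<sigma> t b) \<and>
    (\<forall>z. \<exists>D. ((\<lambda>h. inverse h *\<^sub>C (F (z + h) - F z)) \<longlongrightarrow> D) (at 0))"

definition ground_states :: "(real \<Rightarrow> 'a::cstar_algebra \<Rightarrow> 'a) \<Rightarrow> ('a \<Rightarrow> complex) set" where
  "ground_states \<sigma> = {\<phi> \<in> state_space whole.
    \<forall>a b F. entire_extension \<sigma> b F \<longrightarrow> bounded ((\<lambda>z. \<phi> (a * F z)) ` {z. 0 \<le> Im z})}"

end

(*
  Square roots of positive elements are limits of the iteration y := (x + y^2) / 2, dominated by
  the same iteration for the number 1, and x* x >= 0 because an element is positive once its
  positive shifts are invertible. The quadratic forms of matrices over the unitization inherit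
  this, so E, a limit of averages of automorphisms, maps Y* Y to a matrix of the form Z* Z over A_0.

  The averages over k/m, k < m^2, converge to E(a). They agree with the Haar integral because the
  real line is dense in the dual group (Kronecker's theorem, with Bohr's proof) and nontrivial
  characters have integral zero.

  If phi = psi o theta, elements of negative frequency are null vectors for phi, and those of
  nonnegative frequency are damped in the upper half-plane; pairing with trigonometric polynomials
  gives |phi(c* sigma_z(b))| <= ||c|| ||b||. Conversely, for a ground state phi and b of negative
  frequency lambda, boundedness of e^(iz lambda) phi(a b) gives phi(a b) = 0; hence phi vanishes on
  I and on all spectral spaces of nonzero frequency, and factors through theta.
*)

theory Submission
  imports Defs "HOL-Complex_Analysis.Complex_Analysis"
begin

section \<open>Elementary properties of the involution\<close>

text \<open>Two obstacles shape the development. The algebra may lack a unit and the matrices over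
  it form no type of class \<open>cstar_algebra\<close>, yet \<open>positive_matrix\<close> asks for
  an exact factorization with entries in the right algebra. Positivity is therefore built without
  spectra, from the one inequality in \<open>cpos\<close>, so that the same square root iteration
  can be repeated for matrices with \<open>mat_bound\<close> in place of a norm. As the iterates are
  polynomials in the given entries, the factors stay in \<open>A 0\<close> and pass to the quotient.
  Finite averages of automorphisms keep positivity visible, while the Haar integral has to be
  evaluated on spectral spaces only, where it is scalar, and then passes to limits even if the
  algebra is not separable. For ground states, an arbitrary entire \<open>F z\<close> comes with no
  Fourier series to truncate. The left factor is approximated instead, which works because the
  estimate does not depend on \<open>z\<close>. In the converse there is no unit to insert for
  \<open>a\<close> in \<open>\<phi> (a * b) = 0\<close>; elements \<open>e m\<close> with
  \<open>e m * b\<close> tending to \<open>b\<close> take its place.\<close>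

lemma star_zero [simp]: "star (0 :: 'a::cstar_algebra) = 0"
  using star_add[of "0::'a" 0] by simp

lemma star_minus: "star (- x) = - star (x :: 'a::cstar_algebra)"
  using star_add[of x "- x"] by (simp add: eq_neg_iff_add_eq_0 add.commute)

lemma star_diff: "star (x - y) = star x - star (y :: 'a::cstar_algebra)"
  using star_add[of x "- y"] by (simp add: star_minus)

lemma star_sum: "star (\<Sum>i\<in>I. f i) = (\<Sum>i\<in>I. star (f i :: 'a::cstar_algebra))"
  by (induction I rule: infinite_finite_induct) (auto simp: star_add)

lemma scaleR_eq_scaleC: "r *\<^sub>R x = complex_of_real r *\<^sub>C (x :: 'a::cstar_algebra)"
  by (simp add: scaleR_scaleC)

lemma star_scaleR: "star (r *\<^sub>R x) = r *\<^sub>R star (x :: 'a::cstar_algebra)"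
  by (simp add: scaleR_eq_scaleC star_scaleC)

lemma norm_star [simp]: "norm (star x) = norm (x :: 'a::cstar_algebra)"
proof -
  have le: "norm y \<le> norm (star y)" for y :: 'a
  proof (cases "y = 0")
    case False
    have "norm y * norm y \<le> norm (star y) * norm y"
      using norm_mult_ineq[of "star y" y] by (simp add: norm_star_mult power2_eq_square)
    with False show ?thesis by simp
  qed simp
  from le[of x] le[of "star x"] show ?thesis by (simp add: star_star)
qed

lemma norm_mult_star: "norm (x * star x) = (norm (x :: 'a::cstar_algebra))\<^sup>2"
  using norm_star_mult[of "star x"] by (simp add: star_star)

lemma bounded_linear_star: "bounded_linear (star :: 'a::cstar_algebra \<Rightarrow> 'a)"
  by (rule bounded_linear_intro[where K = 1]) (auto simp: star_add star_scaleR)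

lemmas tendsto_star [tendsto_intros] = bounded_linear.tendsto[OF bounded_linear_star]

lemma bounded_bilinear_scaleC: "bounded_bilinear (scaleC :: complex \<Rightarrow> 'a::cstar_algebra \<Rightarrow> 'a)"
proof
  show "\<exists>K. \<forall>a (b::'a). norm (a *\<^sub>C b) \<le> norm a * norm b * K"
    by (rule exI[of _ 1]) (auto simp: norm_scaleC)
qed (auto simp: scaleC_add_left scaleC_add_right scaleR_eq_scaleC scaleC_scaleC mult.commute
       scaleR_conv_of_real)

lemmas tendsto_scaleC [tendsto_intros] = bounded_bilinear.tendsto[OF bounded_bilinear_scaleC]
lemmas scaleC_diff_left = bounded_bilinear.diff_left[OF bounded_bilinear_scaleC]
lemmas scaleC_diff_right = bounded_bilinear.diff_right[OF bounded_bilinear_scaleC]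
lemmas scaleC_sum_left = bounded_bilinear.sum_left[OF bounded_bilinear_scaleC]
lemmas scaleC_sum_right = bounded_bilinear.sum_right[OF bounded_bilinear_scaleC]
lemmas continuous_on_scaleC [continuous_intros] =
  bounded_bilinear.continuous_on[OF bounded_bilinear_scaleC]

lemma star_self_mult_eq_0_iff: "star x * x = 0 \<longleftrightarrow> (x :: 'a::cstar_algebra) = 0"
  by (metis norm_eq_zero norm_star_mult power_eq_0_iff mult_zero_right)


section \<open>Positivity in unital C*-algebras\<close>

text \<open>Since \<open>norm 1 = 1\<close> here, the zero algebra is excluded. The results are
  applied to the unitization of the given algebra, where a unit is adjoined even if one exists
  already.\<close>

class cstar_algebra_1 = cstar_algebra + real_normed_algebra_1

lemma star_one [simp]: "star (1 :: 'a::cstar_algebra_1) = 1"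
  by (metis mult.left_neutral mult.right_neutral star_mult star_star)

text \<open>
  For \<open>x\<close> of norm at most one the iteration converges to \<open>1 - sqrt (1 - x)\<close>; it is dominated
  by the same iteration for the number 1, so no spectral theory is needed.
\<close>

primrec sqrt_iter :: "'a::real_algebra \<Rightarrow> nat \<Rightarrow> 'a" where
  "sqrt_iter x 0 = 0"
| "sqrt_iter x (Suc m) = (1/2) *\<^sub>R (x + sqrt_iter x m * sqrt_iter x m)"

lemma sqrt_iter_real: "0 \<le> sqrt_iter (1::real) m" "sqrt_iter (1::real) m \<le> 1"
proof (induction m)
  case (Suc m)
  { case 1 show ?case using Suc by simp
  next
    case 2 show ?case using Suc mult_le_one[of "sqrt_iter (1::real) m" "sqrt_iter (1::real) m"] by simp }
qed auto

text \<open>The difference of squares exhibits each increment as the previous one times a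
  nonnegative number. That gives monotonicity by induction, and it is the pattern with which the
  increments for a general \<open>x\<close> are compared; there the factorization needs the iterates
  to commute.\<close>

lemma sqrt_iter_real_Suc_diff:
  "sqrt_iter (1::real) (Suc (Suc m)) - sqrt_iter 1 (Suc m) =
    (1/2) * ((sqrt_iter 1 (Suc m) - sqrt_iter 1 m) * (sqrt_iter 1 (Suc m) + sqrt_iter 1 m))"
  by (simp only: sqrt_iter.simps(2)[of _ "Suc m"], subst (2) sqrt_iter.simps(2))
     (simp add: algebra_simps del: sqrt_iter.simps)

lemma sqrt_iter_real_mono: "sqrt_iter (1::real) m \<le> sqrt_iter 1 (Suc m)"
proof (induction m)
  case (Suc m)
  have "0 \<le> sqrt_iter (1::real) (Suc (Suc m)) - sqrt_iter 1 (Suc m)"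
    unfolding sqrt_iter_real_Suc_diff
    using Suc sqrt_iter_real[of m] sqrt_iter_real[of "Suc m"]
    by (intro mult_nonneg_nonneg) (auto simp del: sqrt_iter.simps)
  then show ?case by simp
qed simp

lemma sqrt_iter_real_Cauchy: "Cauchy (sqrt_iter (1::real))"
proof (rule convergent_Cauchy, rule Bseq_monoseq_convergent)
  show "Bseq (sqrt_iter (1::real))"
    by (rule BseqI'[of _ 1]) (use sqrt_iter_real in \<open>auto simp: abs_le_iff intro: order_trans[of _ 0]\<close>)
  show "monoseq (sqrt_iter (1::real))"
    using sqrt_iter_real_mono by (auto simp: monoseq_Suc)
qed

text \<open>Summing the hypothesis telescopes to \<open>norm (y n - y m) \<le> s n - s m\<close>, so
  the Cauchy property is inherited from a real sequence, in the applications
  \<open>sqrt_iter 1\<close>.\<close>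

lemma Cauchy_dominated:
  fixes y :: "nat \<Rightarrow> 'a::real_normed_vector" and s :: "nat \<Rightarrow> real"
  assumes "Cauchy s" "\<And>m. norm (y (Suc m) - y m) \<le> s (Suc m) - s m"
  shows "Cauchy y"
proof -
  have le: "norm (y n - y m) \<le> s n - s m" if "m \<le> n" for m n
    using that
  proof (induction n rule: dec_induct)
    case (step n)
    have "norm (y (Suc n) - y m) \<le> norm (y (Suc n) - y n) + norm (y n - y m)"
      using norm_triangle_ineq[of "y (Suc n) - y n" "y n - y m"] by simp
    with step assms(2)[of n] show ?case by simp
  qed simp
  show ?thesis
  proof (rule CauchyI')
    fix e :: real assume "e > 0"
    with assms(1) obtain M where M: "\<And>m n. m \<ge> M \<Longrightarrow> n \<ge> M \<Longrightarrow> norm (s m - s n) < e"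
      by (meson CauchyD)
    show "\<exists>M. \<forall>m\<ge>M. \<forall>n>m. dist (y m) (y n) < e"
    proof (intro exI[of _ M] allI impI)
      fix m n assume "M \<le> m" "m < n"
      then show "dist (y m) (y n) < e"
        using le[of m n] M[of m n] by (simp add: dist_norm norm_minus_commute)
    qed
  qed
qed

text \<open>Every iterate is a polynomial in \<open>x\<close>, so it commutes with whatever commutes
  with \<open>x\<close>.\<close>

lemma sqrt_iter_commute: "z * x = x * z \<Longrightarrow> z * sqrt_iter x m = sqrt_iter x m * (z :: 'a::real_algebra)"
proof (induction m)
  case (Suc m)
  then show ?case
    by (simp add: algebra_simps) (metis mult.assoc)
qed simp

lemma sqrt_iter_commute': "sqrt_iter x m * sqrt_iter x k = sqrt_iter x k * sqrt_iter (x :: 'a::real_algebra) m"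
  by (intro sqrt_iter_commute sqrt_iter_commute[symmetric] refl)

lemma norm_sqrt_iter:
  fixes x :: "'a::real_normed_algebra"
  assumes "norm x \<le> 1"
  shows "norm (sqrt_iter x m) \<le> sqrt_iter 1 m"
proof (induction m)
  case (Suc m)
  have "norm (sqrt_iter x m * sqrt_iter x m) \<le> sqrt_iter 1 m * sqrt_iter 1 m"
    using Suc by (intro order_trans[OF norm_mult_ineq] mult_mono) (auto simp: sqrt_iter_real)
  with assms have "norm (x + sqrt_iter x m * sqrt_iter x m) \<le> 1 + sqrt_iter 1 m * sqrt_iter 1 m"
    by (intro order_trans[OF norm_triangle_ineq] add_mono) auto
  then show ?case by simp
qed simp

lemma norm_sqrt_iter_diff:
  fixes x :: "'a::real_normed_algebra"
  assumes "norm x \<le> 1"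
  shows "norm (sqrt_iter x (Suc m) - sqrt_iter x m) \<le> sqrt_iter 1 (Suc m) - sqrt_iter 1 m"
proof (induction m)
  case 0
  then show ?case using assms by simp
next
  case (Suc m)
  let ?y = "sqrt_iter x" and ?s = "sqrt_iter (1::real)"
  have "?y (Suc (Suc m)) - ?y (Suc m) = (1/2) *\<^sub>R ((?y (Suc m) - ?y m) * (?y (Suc m) + ?y m))"
    using sqrt_iter_commute'[of x m "Suc m"]
    by (simp only: sqrt_iter.simps(2)[of _ "Suc m"], subst (2) sqrt_iter.simps(2))
       (simp add: algebra_simps del: sqrt_iter.simps)
  also have "norm \<dots> \<le> (1/2) * ((?s (Suc m) - ?s m) * (?s (Suc m) + ?s m))"
    unfolding norm_scaleR
    by (intro mult_mono order_trans[OF norm_mult_ineq] order_trans[OF norm_triangle_ineq]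
        add_mono norm_sqrt_iter assms Suc) (use sqrt_iter_real_mono[of m] in auto)
  finally show ?case unfolding sqrt_iter_real_Suc_diff .
qed

text \<open>At the limit \<open>y = (x + y * y) / 2\<close>, which rearranges to the equation for
  \<open>1 - y\<close>. The bound \<open>norm y \<le> 1\<close> is recorded because it makes the
  root \<open>1 - y\<close> positive, the commutation property because later arguments need roots of
  commuting elements to commute.\<close>

lemma ex_sqrt_one_minus:
  fixes x :: "'a::cstar_algebra_1"
  assumes "norm x \<le> 1" "star x = x"
  obtains y where "star y = y" "norm y \<le> 1" "(1 - y) * (1 - y) = 1 - x"
    "\<And>z. z * x = x * z \<Longrightarrow> z * y = y * z"
proof -
  have "Cauchy (sqrt_iter x)"
    by (rule Cauchy_dominated[OF sqrt_iter_real_Cauchy norm_sqrt_iter_diff[OF assms(1)]])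
  then obtain y where y: "sqrt_iter x \<longlonglongrightarrow> y"
    using Cauchy_convergent_iff convergent_def by blast
  have "(\<lambda>m. sqrt_iter x (Suc m)) \<longlonglongrightarrow> (1/2) *\<^sub>R (x + y * y)"
    unfolding sqrt_iter.simps by (intro tendsto_intros y)
  then have eq: "y = (1/2) *\<^sub>R (x + y * y)"
    using LIMSEQ_Suc[OF y] LIMSEQ_unique by blast
  then have "2 *\<^sub>R y = x + y * y"
    by (metis scaleR_scaleR scaleR_one nonzero_mult_div_cancel_left zero_neq_numeral times_divide_eq_right mult_1_right)
  then have sq: "(1 - y) * (1 - y) = 1 - x"
    by (simp add: algebra_simps scaleR_2)
  have si: "star (sqrt_iter x m) = sqrt_iter x m" for m
    by (induction m) (auto simp: star_scaleR star_add star_mult assms)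
  have "sqrt_iter x \<longlonglongrightarrow> star y"
    using tendsto_star[OF y] by (simp add: si)
  then have st: "star y = y" using y by (rule LIMSEQ_unique)
  have nrm: "norm y \<le> 1"
    using norm_sqrt_iter[OF assms(1)] sqrt_iter_real(2)
    by (intro LIMSEQ_le_const2[OF tendsto_norm[OF y]]) (meson order_trans)
  have "z * y = y * z" if "z * x = x * z" for z
  proof -
    have "(\<lambda>m. z * sqrt_iter x m) \<longlonglongrightarrow> z * y"
      by (intro tendsto_intros y)
    moreover have "(\<lambda>m. z * sqrt_iter x m) \<longlonglongrightarrow> y * z"
      unfolding sqrt_iter_commute[OF that] by (intro tendsto_intros y)
    ultimately show ?thesis by (rule LIMSEQ_unique)
  qed
  with that st nrm sq show ?thesis by blast
qed

text \<open>For a self-adjoint element the inequality says that the spectrum lies in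
  \<open>[0, 2 t]\<close>. In this form sums are immediate, and after division by \<open>t\<close>
  the square root iteration applies at once.\<close>

definition cpos :: "'a::cstar_algebra_1 \<Rightarrow> bool" where
  "cpos a \<longleftrightarrow> star a = a \<and> (\<exists>t\<ge>0. norm (t *\<^sub>R 1 - a) \<le> t)"

lemma cpos_star: "cpos a \<Longrightarrow> star a = a"
  by (simp add: cpos_def)

lemma cpos_scaleR: "0 \<le> r \<Longrightarrow> cpos a \<Longrightarrow> cpos (r *\<^sub>R a)"
proof -
  assume r: "0 \<le> r" and "cpos a"
  then obtain t where t: "t \<ge> 0" "norm (t *\<^sub>R 1 - a) \<le> t" "star a = a"
    by (auto simp: cpos_def)
  have "norm ((r * t) *\<^sub>R 1 - r *\<^sub>R a) = r * norm (t *\<^sub>R 1 - a)"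
    using r by (simp flip: scaleR_scaleR scaleR_diff_right)
  also have "\<dots> \<le> r * t" using r t by (simp add: mult_left_mono)
  finally show ?thesis
    using r t by (auto simp: cpos_def star_scaleR intro!: exI[of _ "r * t"])
qed

lemma cpos_add: "cpos a \<Longrightarrow> cpos b \<Longrightarrow> cpos (a + b)"
proof -
  assume "cpos a" "cpos b"
  then obtain s t where *: "s \<ge> 0" "norm (s *\<^sub>R 1 - a) \<le> s" "star a = a"
    "t \<ge> 0" "norm (t *\<^sub>R 1 - b) \<le> t" "star b = b"
    by (auto simp: cpos_def)
  have "norm ((s + t) *\<^sub>R 1 - (a + b)) \<le> norm (s *\<^sub>R 1 - a) + norm (t *\<^sub>R 1 - b)"
    using norm_triangle_ineq[of "s *\<^sub>R 1 - a" "t *\<^sub>R 1 - b"] by (simp add: algebra_simps)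
  with * show ?thesis
    by (auto simp: cpos_def star_add intro!: exI[of _ "s + t"])
qed

lemma cpos_zero [simp]: "cpos 0"
  by (auto simp: cpos_def intro!: exI[of _ 0])

lemma cpos_one [simp]: "cpos 1"
  by (auto simp: cpos_def intro!: exI[of _ 1])

lemma cpos_sum: "(\<And>i. i \<in> I \<Longrightarrow> cpos (f i)) \<Longrightarrow> cpos (\<Sum>i\<in>I. f i)"
  by (induction I rule: infinite_finite_induct) (auto intro: cpos_add)

lemma cpos_sqrt:
  assumes "cpos a"
  obtains h where "cpos h" "h * h = a" "\<And>z. z * a = a * z \<Longrightarrow> z * h = h * z"
proof -
  from assms obtain t where t: "t \<ge> 0" "norm (t *\<^sub>R 1 - a) \<le> t" "star a = a"
    by (auto simp: cpos_def)
  show ?thesis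
  proof (cases "t = 0")
    case True
    with t have "a = 0" by simp
    then show ?thesis by (intro that[of 0]) auto
  next
    case False
    with t have t0: "t > 0" by simp
    \<comment> \<open>\<open>a / t = 1 - x\<close> with \<open>norm x \<le> 1\<close>, the form that
      the iteration can handle.\<close>
    define x where "x = 1 - (1/t) *\<^sub>R a"
    have "x = (1/t) *\<^sub>R (t *\<^sub>R 1 - a)"
      using t0 by (simp add: x_def algebra_simps)
    then have "norm x \<le> 1" using t t0 by simp
    moreover have "star x = x" by (simp add: x_def star_diff star_scaleR t)
    ultimately obtain y where y: "star y = y" "norm y \<le> 1" "(1 - y) * (1 - y) = 1 - x"
      "\<And>z. z * x = x * z \<Longrightarrow> z * y = y * z"
      using ex_sqrt_one_minus by blast
    define h where "h = sqrt t *\<^sub>R (1 - y)"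
    have "cpos (1 - y)"
      using y by (auto simp: cpos_def star_diff intro!: exI[of _ 1])
    then have "cpos h" unfolding h_def using t by (intro cpos_scaleR) auto
    moreover have "h * h = a"
    proof -
      have "h * h = (sqrt t * sqrt t) *\<^sub>R ((1 - y) * (1 - y))"
        by (simp add: h_def)
      then show ?thesis using t0 y(3) by (simp add: x_def)
    qed
    moreover have "z * h = h * z" if "z * a = a * z" for z
    proof -
      have "z * x = x * z" using that by (simp add: x_def algebra_simps)
      from y(4)[OF this] show ?thesis by (simp add: h_def algebra_simps)
    qed
    ultimately show ?thesis using that by blast
  qed
qed

lemma norm_unitary: "star u * u = c *\<^sub>R (1::'a::cstar_algebra_1) \<Longrightarrow> 0 \<le> c \<Longrightarrow> norm u = sqrt c"
  using norm_star_mult[of u] by (simp add: real_sqrt_unique)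

text \<open>If \<open>h\<^sup>2 + k\<^sup>2 = c\<close> with commuting self-adjoint \<open>h, k\<close>, then \<open>h + ik\<close> is
  \<open>sqrt c\<close> times a unitary and \<open>h\<close> is its real part.\<close>

lemma norm_le_if_squares_eq:
  fixes h k :: "'a::cstar_algebra_1"
  assumes "star h = h" "star k = k" "h * k = k * h" "h * h + k * k = c *\<^sub>R 1" "0 \<le> c"
  shows "norm h \<le> sqrt c"
proof -
  define u where "u = h + \<i> *\<^sub>C k"
  have su: "star u = h - \<i> *\<^sub>C k"
    by (simp add: u_def star_add star_scaleC assms)
  have "star u * u = h * h + k * k"
    unfolding su by (simp add: u_def algebra_simps scaleC_mult_left scaleC_mult_right scaleC_scaleC
        assms(3) scaleC_one)
  then have "norm u = sqrt c" using assms norm_unitary by metis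
  have "2 *\<^sub>R h = u + star u" unfolding su by (simp add: u_def scaleR_2)
  then have "2 * norm h \<le> norm u + norm (star u)"
    by (metis norm_triangle_ineq norm_scaleR abs_numeral)
  then show ?thesis using \<open>norm u = sqrt c\<close> by simp
qed

text \<open>With \<open>k\<close> a square root of \<open>t - h * h\<close>, the commuting pair has
  squares with sum \<open>t\<close>, so \<open>norm k \<le> sqrt t\<close> by the preceding argument
  with unitaries. This places the squares of self-adjoint elements in the cone.\<close>

lemma norm_minus_square_le:
  fixes h :: "'a::cstar_algebra_1"
  assumes "star h = h" "norm (h * h) \<le> t"
  shows "norm (t *\<^sub>R 1 - h * h) \<le> t"
proof (cases "t = 0")
  case True
  with assms show ?thesis by simp
next
  case False
  moreover have "0 \<le> t" using assms(2) norm_ge_zero order_trans by blast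
  ultimately have t0: "t > 0" by simp
  have "norm ((1/t) *\<^sub>R (h * h)) \<le> 1" "star ((1/t) *\<^sub>R (h * h)) = (1/t) *\<^sub>R (h * h)"
    using assms t0 by (auto simp: star_scaleR star_mult)
  then obtain y where y: "star y = y" "(1 - y) * (1 - y) = 1 - (1/t) *\<^sub>R (h * h)"
      "\<And>z. z * ((1/t) *\<^sub>R (h * h)) = ((1/t) *\<^sub>R (h * h)) * z \<Longrightarrow> z * y = y * z"
    using ex_sqrt_one_minus by metis
  define k where "k = sqrt t *\<^sub>R (1 - y)"
  have "k * k = (sqrt t * sqrt t) *\<^sub>R ((1 - y) * (1 - y))"
    by (simp add: k_def)
  then have kk: "k * k = t *\<^sub>R 1 - h * h" unfolding y(2) using t0 by (simp add: scaleR_diff_right)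
  have "h * y = y * h" by (intro y(3)) (simp add: mult.assoc)
  then have "k * h = h * k" by (simp add: k_def algebra_simps)
  moreover have "star k = k" by (simp add: k_def star_scaleR star_diff y)
  moreover have "k * k + h * h = t *\<^sub>R 1" using kk by simp
  ultimately have "norm k \<le> sqrt t"
    using norm_le_if_squares_eq[of k h t] assms(1) t0 by simp
  have "norm (k * k) \<le> sqrt t * sqrt t"
    using \<open>norm k \<le> sqrt t\<close> t0 by (intro order_trans[OF norm_mult_ineq] mult_mono) auto
  then show ?thesis using t0 kk by simp
qed

lemma cpos_square: "star h = h \<Longrightarrow> cpos (h * h)"
  unfolding cpos_def by (metis norm_minus_square_le norm_ge_zero order_refl star_mult)

text \<open>Writing \<open>a\<close> as a square shows that the radius in \<open>cpos\<close> may be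
  any bound of the norm. The choice \<open>norm a\<close> depends continuously on \<open>a\<close>,
  which is what makes the cone closed.\<close>

lemma cpos_norm_diff: "cpos a \<Longrightarrow> norm a \<le> t \<Longrightarrow> norm (t *\<^sub>R 1 - a) \<le> t"
  by (metis cpos_sqrt norm_minus_square_le cpos_star)

lemma cpos_limit:
  assumes "f \<longlonglongrightarrow> a" "\<And>m. cpos (f m)"
  shows "cpos a"
proof -
  have "star a = a"
    using tendsto_star[OF assms(1)] unfolding assms(2)[THEN cpos_star]
    by (rule LIMSEQ_unique) (rule assms(1))
  moreover have "norm (norm a *\<^sub>R 1 - a) \<le> norm a"
  proof (rule LIMSEQ_le)
    show "(\<lambda>m. norm (norm (f m) *\<^sub>R 1 - f m)) \<longlonglongrightarrow> norm (norm a *\<^sub>R 1 - a)" "(\<lambda>m. norm (f m)) \<longlonglongrightarrow> norm a"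
      by (intro tendsto_intros assms)+
  qed (use cpos_norm_diff assms(2) in blast)
  ultimately show ?thesis unfolding cpos_def by (metis norm_ge_zero)
qed

text \<open>The commutation property of square roots, used twice, turns \<open>a * b = b * a\<close>
  into \<open>h * k = k * h\<close>; then \<open>a * b\<close> is the square of the self-adjoint
  element \<open>h * k\<close>.\<close>

lemma cpos_mult:
  assumes "cpos a" "cpos b" "a * b = b * a"
  shows "cpos (a * b)"
proof -
  obtain h where h: "cpos h" "h * h = a" "\<And>z. z * a = a * z \<Longrightarrow> z * h = h * z"
    using cpos_sqrt[OF assms(1)] by blast
  obtain k where k: "cpos k" "k * k = b" "\<And>z. z * b = b * z \<Longrightarrow> z * k = k * z"
    using cpos_sqrt[OF assms(2)] by blast
  have "b * h = h * b" using h(3) assms(3) by simp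
  then have "h * k = k * h" using k(3) by simp
  then have "star (h * k) = h * k" by (simp add: star_mult h(1) k(1) cpos_star)
  then have "cpos ((h * k) * (h * k))" by (rule cpos_square)
  moreover have "(h * k) * (h * k) = h * (k * h) * k" by (simp add: mult.assoc)
  then have "(h * k) * (h * k) = a * b"
    unfolding \<open>h * k = k * h\<close>[symmetric] h(2)[symmetric] k(2)[symmetric] by (simp add: mult.assoc)
  ultimately show ?thesis by simp
qed

text \<open>Commuting square roots \<open>h\<close>, \<open>k\<close> of \<open>a\<close> and
  \<open>c - a\<close> have squares with sum \<open>c\<close>, so
  \<open>norm h \<le> sqrt c\<close>.\<close>

lemma norm_le_if_cpos_diff:
  assumes "cpos a" "cpos (c *\<^sub>R 1 - a)" "0 \<le> c"
  shows "norm a \<le> c"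
proof -
  obtain h where h: "cpos h" "h * h = a" "\<And>z. z * a = a * z \<Longrightarrow> z * h = h * z"
    using cpos_sqrt[OF assms(1)] by blast
  obtain k where k: "cpos k" "k * k = c *\<^sub>R 1 - a" "\<And>z. z * (c *\<^sub>R 1 - a) = (c *\<^sub>R 1 - a) * z \<Longrightarrow> z * k = k * z"
    using cpos_sqrt[OF assms(2)] by blast
  have "h * a = a * h" by (simp flip: h(2) add: mult.assoc)
  then have "h * k = k * h" by (intro k(3)) (simp add: algebra_simps)
  then have "norm h \<le> sqrt c"
    using norm_le_if_squares_eq[OF cpos_star[OF h(1)] cpos_star[OF k(1)], of c] h(2) k(2) assms(3)
    by simp
  then have "norm (h * h) \<le> sqrt c * sqrt c"
    using assms(3) by (intro order_trans[OF norm_mult_ineq] mult_mono) auto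
  then show ?thesis using h(2) assms(3) by simp
qed

lemma cpos_antisym: "cpos a \<Longrightarrow> cpos (- a) \<Longrightarrow> a = 0"
  using norm_le_if_cpos_diff[of a 0] by simp

section \<open>Invertible shifts and the positivity of \<open>star x * x\<close>\<close>

lemma neumann_inverse:
  fixes x :: "'a::{real_normed_algebra_1,banach}"
  assumes "norm x < 1"
  obtains r where "(1 - x) * r = 1" "r * (1 - x) = 1"
proof
  let ?r = "\<Sum>n. x ^ n"
  have s: "summable (\<lambda>n. x ^ n)" by (rule complete_algebra_summable_geometric[OF assms])
  then have x: "(\<lambda>n. x ^ Suc n) sums (?r - 1)"
    using summable_sums sums_Suc_iff by fastforce
  have "(\<lambda>n. x * x ^ n) sums (x * ?r)" "(\<lambda>n. x ^ n * x) sums (?r * x)"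
    using s by (auto intro: sums_mult sums_mult2 summable_sums)
  then have "x * ?r = ?r - 1" "?r * x = ?r - 1"
    using x sums_unique2 by (auto simp: power_commutes)
  then show "(1 - x) * ?r = 1" "?r * (1 - x) = 1" by (auto simp: algebra_simps)
qed

lemma left_right_inverse_eq: "b * a = 1 \<Longrightarrow> a * c = 1 \<Longrightarrow> b = (c :: 'a::monoid_mult)"
  by (metis mult.assoc mult_1_left mult_1_right)

lemma cpos_add_scaleR_inverse:
  assumes "cpos a" "0 < l"
  obtains r where "(a + l *\<^sub>R 1) * r = 1" "r * (a + l *\<^sub>R 1) = 1"
proof -
  from assms obtain t where t: "t \<ge> 0" "norm (t *\<^sub>R 1 - a) \<le> t"
    by (auto simp: cpos_def)
  \<comment> \<open>\<open>a + l = (l + t) (1 - x)\<close> and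
    \<open>norm x \<le> t / (l + t) < 1\<close>, so a Neumann series inverts it.\<close>
  define x where "x = (1 / (l + t)) *\<^sub>R (t *\<^sub>R 1 - a)"
  have "norm x < 1" using t assms by (simp add: x_def)
  then obtain r where r: "(1 - x) * r = 1" "r * (1 - x) = 1"
    using neumann_inverse by blast
  have "(l + t) *\<^sub>R (1 - x) = (l + t) *\<^sub>R 1 - ((l + t) * (1 / (l + t))) *\<^sub>R (t *\<^sub>R 1 - a)"
    by (simp add: x_def scaleR_diff_right)
  also have "\<dots> = a + l *\<^sub>R 1" using t assms by (simp add: algebra_simps)
  finally have eq: "a + l *\<^sub>R 1 = (l + t) *\<^sub>R (1 - x)" ..
  show ?thesis
    by (rule that[of "(1 / (l + t)) *\<^sub>R r"]) (use t assms r in \<open>auto simp: eq\<close>)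
qed

text \<open>If \<open>a\<close> were not positive, the infimum \<open>l > 0\<close> of all shifts making it positive would be
  attained, and then \<open>a + l\<close>, being positive and invertible, could be shifted further down.\<close>

lemma cpos_if_invertible:
  fixes a :: "'a::cstar_algebra_1"
  assumes "star a = a" and inv: "\<And>l. 0 < l \<Longrightarrow> \<exists>r. (a + l *\<^sub>R 1) * r = 1 \<and> r * (a + l *\<^sub>R 1) = 1"
  shows "cpos a"
proof -
  define L where "L = {l. 0 \<le> l \<and> cpos (a + l *\<^sub>R 1)}"
  have "norm a \<in> L"
  proof -
    have "norm (norm a *\<^sub>R 1 - (a + norm a *\<^sub>R 1)) \<le> norm a" by simp
    moreover have "star (a + norm a *\<^sub>R 1) = a + norm a *\<^sub>R 1"
      by (simp add: star_add star_scaleR assms)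
    ultimately show ?thesis unfolding L_def cpos_def by (auto intro!: exI[of _ "norm a"])
  qed
  define l where "l = Inf L"
  have bdd: "bdd_below L" by (auto simp: L_def intro: bdd_belowI)
  have "closed L"
    unfolding closed_sequential_limits
  proof (intro allI impI, elim conjE)
    fix f b assume f: "\<forall>n. f n \<in> L" "f \<longlonglongrightarrow> b"
    then have "0 \<le> b" by (intro LIMSEQ_le_const[OF f(2)]) (auto simp: L_def)
    moreover have "cpos (a + b *\<^sub>R 1)"
      by (rule cpos_limit[of "\<lambda>n. a + f n *\<^sub>R 1"]) (use f in \<open>auto simp: L_def intro!: tendsto_intros\<close>)
    ultimately show "b \<in> L" by (simp add: L_def)
  qed
  then have lL: "l \<in> L"
    unfolding l_def using closed_contains_Inf \<open>norm a \<in> L\<close> bdd by blast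
  show ?thesis
  proof (cases "l = 0")
    case True
    with lL show ?thesis by (simp add: L_def)
  next
    case False
    with lL have l0: "0 < l" and pos: "cpos (a + l *\<^sub>R 1)" by (auto simp: L_def)
    define b where "b = a + l *\<^sub>R 1"
    obtain r where r: "b * r = 1" "r * b = 1" using inv[OF l0] b_def by auto
    have "cpos b" using pos by (simp add: b_def)
    have "star r * b = 1"
      using arg_cong[OF r(1), of star] by (simp add: star_mult cpos_star[OF \<open>cpos b\<close>])
    then have "star r = r" using r left_right_inverse_eq by blast
    have "r \<noteq> 0" using r by auto
    \<comment> \<open>\<open>d * norm r \<le> 1\<close> makes \<open>1 - d r\<close> positive, and
      \<open>d \<le> l\<close> keeps the new shift \<open>l - d\<close> nonnegative, as membership
      in \<open>L\<close> requires.\<close>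
    define d where "d = min l (1 / norm r)"
    have d: "0 < d" "d \<le> l" "d * norm r \<le> 1"
      using \<open>r \<noteq> 0\<close> l0 by (auto simp: d_def min_def field_simps)
    have "star (1 - d *\<^sub>R r) = 1 - d *\<^sub>R r"
      by (simp add: star_diff star_scaleR \<open>star r = r\<close>)
    then have "cpos (1 - d *\<^sub>R r)"
      unfolding cpos_def using d by (intro conjI exI[of _ 1]) auto
    moreover have "b * (1 - d *\<^sub>R r) = (1 - d *\<^sub>R r) * b"
      by (simp add: right_diff_distrib left_diff_distrib r)
    ultimately have "cpos (b * (1 - d *\<^sub>R r))"
      using \<open>cpos b\<close> by (intro cpos_mult)
    moreover have "b * (1 - d *\<^sub>R r) = a + (l - d) *\<^sub>R 1"
      using r(1) by (simp add: right_diff_distrib) (simp add: b_def scaleR_diff_left)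
    ultimately have "cpos (a + (l - d) *\<^sub>R 1)" by simp
    with d have "l - d \<in> L" by (simp add: L_def)
    then have "l \<le> l - d" unfolding l_def using cInf_lower bdd by blast
    with d show ?thesis by simp
  qed
qed

text \<open>For \<open>y = h + i k\<close> the sum of \<open>star y * y\<close> and
  \<open>y * star y\<close> is \<open>2 h^2 + 2 k^2\<close>, so \<open>y * star y\<close> is
  positive together with \<open>- (star y * y)\<close>. The two products share their nonzero
  spectrum, whence \<open>- (y * star y)\<close> is positive too, and antisymmetry leaves
  zero.\<close>

lemma star_mult_self_neg_cpos:
  fixes y :: "'a::cstar_algebra_1"
  assumes "cpos (- (star y * y))"
  shows "y = 0"
proof -
  define h where "h = (1/2) *\<^sub>R (y + star y)"
  define k where "k = (\<i>/2) *\<^sub>C (star y - y)"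
  have h: "star h = h" by (simp add: h_def star_scaleR star_add star_star add.commute)
  have k: "star k = k"
    by (simp add: k_def star_scaleC star_diff star_star scaleC_diff_right)
  have "2 *\<^sub>R (h * h) = (1/2) *\<^sub>R ((y + star y) * (y + star y))" by (simp add: h_def)
  moreover have "2 *\<^sub>R (k * k) = - (1/2) *\<^sub>R ((star y - y) * (star y - y))"
    by (simp add: k_def scaleC_mult_left scaleC_mult_right scaleC_scaleC scaleR_eq_scaleC)
  moreover have "(y + star y) * (y + star y) - (star y - y) * (star y - y)
      = 2 *\<^sub>R (y * star y + star y * y)"
    by (simp add: algebra_simps scaleR_2)
  ultimately have "2 *\<^sub>R (h * h) + 2 *\<^sub>R (k * k) = (1/2) *\<^sub>R 2 *\<^sub>R (y * star y + star y * y)"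
    by (metis add_uminus_conv_diff scaleR_minus_left scaleR_right_diff_distrib)
  then have "2 *\<^sub>R (h * h) + 2 *\<^sub>R (k * k) = y * star y + star y * y"
    by simp
  then have q: "y * star y = 2 *\<^sub>R (h * h) + 2 *\<^sub>R (k * k) + (- (star y * y))"
    by (simp add: algebra_simps)
  have "cpos (y * star y)"
    unfolding q by (intro cpos_add cpos_scaleR cpos_square assms h k) auto
  moreover have "cpos (- (y * star y))"
  proof (rule cpos_if_invertible)
    show "star (- (y * star y)) = - (y * star y)"
      by (simp add: star_minus star_mult star_star)
  next
    fix l :: real assume l: "0 < l"
    obtain r where r: "(- (star y * y) + l *\<^sub>R 1) * r = 1" "r * (- (star y * y) + l *\<^sub>R 1) = 1"
      using cpos_add_scaleR_inverse[OF assms l] by blast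
    \<comment> \<open>The usual transfer of invertibility from \<open>l - star y * y\<close> to
      \<open>l - y * star y\<close>.\<close>
    define s where "s = (1/l) *\<^sub>R (1 + y * r * star y)"
    have "(- (y * star y) + l *\<^sub>R 1) * (1 + y * r * star y) =
        - (y * star y) + l *\<^sub>R 1 + y * ((- (star y * y) + l *\<^sub>R 1) * r) * star y"
      by (simp add: algebra_simps)
    then have 1: "(- (y * star y) + l *\<^sub>R 1) * s = 1"
      using r l by (simp add: s_def)
    have "(1 + y * r * star y) * (- (y * star y) + l *\<^sub>R 1) =
        - (y * star y) + l *\<^sub>R 1 + y * (r * (- (star y * y) + l *\<^sub>R 1)) * star y"
      by (simp add: algebra_simps)
    then have "s * (- (y * star y) + l *\<^sub>R 1) = 1"
      using r l by (simp add: s_def)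
    with 1 show "\<exists>r. (- (y * star y) + l *\<^sub>R 1) * r = 1 \<and> r * (- (y * star y) + l *\<^sub>R 1) = 1"
      by blast
  qed
  ultimately have "y * star y = 0" by (rule cpos_antisym)
  then have "norm (y * star y) = 0" by simp
  then show ?thesis by (simp add: norm_mult_star)
qed

text \<open>The theorem of Kelley and Vaught. With \<open>c = |a| - a\<close>, twice the negative part of
  \<open>a = x\<^sup>* x\<close>, one has \<open>(x c)\<^sup>* (x c) = - c\<^sup>3 / 2\<close>.\<close>

theorem cpos_star_mult_self:
  fixes x :: "'a::cstar_algebra_1"
  shows "cpos (star x * x)"
proof -
  define a where "a = star x * x"
  have sa: "star a = a" by (simp add: a_def star_mult star_star)
  obtain m where m: "cpos m" "m * m = a * a" "\<And>z. z * (a * a) = (a * a) * z \<Longrightarrow> z * m = m * z"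
    using cpos_sqrt[OF cpos_square[OF sa]] by blast
  have am: "a * m = m * a" by (rule m(3)) (simp add: mult.assoc)
  define c where "c = m - a"
  have sc: "star c = c" by (simp add: c_def star_diff sa cpos_star[OF m(1)])
  have cc: "c * c = 2 *\<^sub>R (c * m)"
    by (simp add: c_def algebra_simps m(2) am scaleR_2)
  have cm: "c * m = m * c" by (simp add: c_def algebra_simps am)
  have "cpos c"
  proof (rule cpos_if_invertible[OF sc])
    fix l :: real assume l: "0 < l"
    have "cpos (2 *\<^sub>R m)" using m(1) by (simp add: cpos_scaleR)
    then obtain r where r: "(2 *\<^sub>R m + l *\<^sub>R 1) * r = 1" "r * (2 *\<^sub>R m + l *\<^sub>R 1) = 1"
      using cpos_add_scaleR_inverse[OF _ l] by blast
    \<comment> \<open>Because \<open>c * c = 2 c m\<close>, the product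
      \<open>(c + l) (1 - c r)\<close> collapses to \<open>c + l - c (2 m + l) r = l\<close>. The
      left inverse \<open>s'\<close> is built symmetrically and has to agree with
      \<open>s\<close>.\<close>
    define s where "s = (1/l) *\<^sub>R (1 - c * r)"
    define s' where "s' = (1/l) *\<^sub>R (1 - r * c)"
    have "(c + l *\<^sub>R 1) * (1 - c * r) = c + l *\<^sub>R 1 - (c * c) * r - l *\<^sub>R (c * r)"
      by (simp add: algebra_simps)
    also have "\<dots> = c + l *\<^sub>R 1 - c * ((2 *\<^sub>R m + l *\<^sub>R 1) * r)"
      unfolding cc by (simp add: algebra_simps)
    finally have 1: "(c + l *\<^sub>R 1) * s = 1" using r l by (simp add: s_def)
    have "(1 - r * c) * (c + l *\<^sub>R 1) = c + l *\<^sub>R 1 - r * (c * c) - l *\<^sub>R (r * c)"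
      by (simp add: algebra_simps)
    also have "\<dots> = c + l *\<^sub>R 1 - (r * (2 *\<^sub>R m + l *\<^sub>R 1)) * c"
      unfolding cc cm by (simp add: algebra_simps)
    finally have 2: "s' * (c + l *\<^sub>R 1) = 1" using r l by (simp add: s'_def)
    from 1 2 have "s' = s" using left_right_inverse_eq by blast
    with 1 2 show "\<exists>r. (c + l *\<^sub>R 1) * r = 1 \<and> r * (c + l *\<^sub>R 1) = 1" by blast
  qed
  have "cpos (c * c * c)"
    by (intro cpos_mult cpos_square sc \<open>cpos c\<close>) (simp add: mult.assoc)
  \<comment> \<open>\<open>c\<close> annihilates \<open>m + a\<close> because
    \<open>m * m = a * a\<close>; hence \<open>c * a\<close> equals
    \<open>- c * c / 2\<close>.\<close>
  have "c * (m + a) = 0" by (simp add: c_def algebra_simps m(2) am)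
  moreover have "2 *\<^sub>R a = (m + a) - c" by (simp add: c_def scaleR_2)
  then have "c * (2 *\<^sub>R a) = c * (m + a) - c * c" by (simp add: right_diff_distrib)
  ultimately have "c * (2 *\<^sub>R a) = - (c * c)" by simp
  then have "c * (2 *\<^sub>R a) * c = - (c * c) * c" by simp
  then have "2 *\<^sub>R (c * a * c) = - (c * c * c)" by simp
  from arg_cong[OF this, of "\<lambda>v. (1/2) *\<^sub>R v"] have "c * a * c = - (1/2) *\<^sub>R (c * c * c)"
    by simp
  moreover have "star (x * c) * (x * c) = c * a * c"
    by (simp add: star_mult sc a_def mult.assoc)
  ultimately have "- (star (x * c) * (x * c)) = (1/2) *\<^sub>R (c * c * c)" by simp
  then have "cpos (- (star (x * c) * (x * c)))"
    using \<open>cpos (c * c * c)\<close> by (simp add: cpos_scaleR)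
  then have "x * c = 0" by (rule star_mult_self_neg_cpos)
  then have "c * c * c = 0"
    using \<open>- (star (x * c) * (x * c)) = (1/2) *\<^sub>R (c * c * c)\<close> by simp
  then have "star (c * c) * (c * c) = 0" by (simp add: star_mult sc mult.assoc)
  then have "c * c = 0" by (simp add: star_self_mult_eq_0_iff)
  then have "c = 0" using star_self_mult_eq_0_iff[of c] sc by simp
  with m(1) show ?thesis by (simp add: c_def a_def)
qed


section \<open>The C*-algebra unitization\<close>

datatype 'a unitization = Unitization (upart: 'a) (uscal: complex)

lemma unitization_eqI: "upart u = upart v \<Longrightarrow> uscal u = uscal v \<Longrightarrow> u = v"
  by (cases u; cases v) simp

text \<open>The unitization acts on its ideal \<open>'a\<close> by left multiplication; the operator
  norm of this action is the main part of its norm.\<close>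

definition ulmult :: "'a::cstar_algebra unitization \<Rightarrow> 'a \<Rightarrow> 'a" where
  "ulmult u b = upart u * b + uscal u *\<^sub>C b"

lemma bounded_linear_scaleC_right: "bounded_linear (scaleC c :: 'a::cstar_algebra \<Rightarrow> 'a)"
  by (rule bounded_bilinear.bounded_linear_right[OF bounded_bilinear_scaleC])

lemma bounded_linear_ulmult: "bounded_linear (ulmult u)"
  unfolding ulmult_def
  by (intro bounded_linear_add bounded_linear_mult_right bounded_linear_scaleC_right)

text \<open>
  The operator norm of left multiplication is only a seminorm if the algebra has a unit
  already; the maximum with the scalar part repairs this and covers the zero algebra.
\<close>

instantiation unitization :: (cstar_algebra) real_normed_algebra_1
begin

definition "0 = Unitization 0 0"
definition "1 = Unitization 0 1"
definition "u + v = Unitization (upart u + upart v) (uscal u + uscal v)"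
definition "u - v = Unitization (upart u - upart v) (uscal u - uscal v)"
definition "- u = Unitization (- upart u) (- uscal u)"
definition "u * v =
  Unitization (upart u * upart v + uscal u *\<^sub>C upart v + uscal v *\<^sub>C upart u) (uscal u * uscal v)"
definition "r *\<^sub>R u = Unitization (r *\<^sub>R upart u) (r *\<^sub>R uscal u)"
definition "norm u = max (cmod (uscal u)) (onorm (ulmult u))"
definition "sgn u = inverse (norm u) *\<^sub>R (u :: 'a unitization)"
definition "dist u v = norm (u - v :: 'a unitization)"
definition "(uniformity :: ('a unitization \<times> 'a unitization) filter) =
  (INF e\<in>{0<..}. principal {(x, y). dist x y < e})"
definition "open (S :: 'a unitization set) =
  (\<forall>x\<in>S. \<forall>\<^sub>F (x', y) in uniformity. x' = x \<longrightarrow> y \<in> S)"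

lemma unitization_simps [simp]:
  fixes u v :: "'a unitization"
  shows "upart (0 :: 'a unitization) = 0" "uscal (0 :: 'a unitization) = 0"
    "upart (1 :: 'a unitization) = 0" "uscal (1 :: 'a unitization) = 1"
    "upart (u + v) = upart u + upart v" "uscal (u + v) = uscal u + uscal v"
    "upart (u - v) = upart u - upart v" "uscal (u - v) = uscal u - uscal v"
    "upart (- u) = - upart u" "uscal (- u) = - uscal u"
    "upart (u * v) = upart u * upart v + uscal u *\<^sub>C upart v + uscal v *\<^sub>C upart u"
    "uscal (u * v) = uscal u * uscal v"
    "upart (r *\<^sub>R u) = r *\<^sub>R upart u" "uscal (r *\<^sub>R u) = r *\<^sub>R uscal u"
  by (simp_all add: zero_unitization_def one_unitization_def plus_unitization_def
      minus_unitization_def uminus_unitization_def times_unitization_def scaleR_unitization_def)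

lemma ulmult_one: "ulmult (1 :: 'a unitization) = id"
  by (auto simp: ulmult_def scaleC_one)

lemma ulmult_add: "ulmult (u + v :: 'a unitization) = (\<lambda>b. ulmult u b + ulmult v b)"
  by (auto simp: ulmult_def algebra_simps scaleC_add_left)

lemma ulmult_scaleR: "ulmult (r *\<^sub>R u :: 'a unitization) = (\<lambda>b. r *\<^sub>R ulmult u b)"
  by (auto simp: ulmult_def algebra_simps scaleR_eq_scaleC scaleC_mult_left scaleC_scaleC scaleC_add_right
      scaleR_conv_of_real)

lemma ulmult_mult: "ulmult (u * v :: 'a unitization) = ulmult u \<circ> ulmult v"
  by (auto simp: ulmult_def algebra_simps scaleC_mult_left scaleC_mult_right scaleC_scaleC
      scaleC_add_right)

lemma norm_ulmult_le: "norm (ulmult u b) \<le> norm u * norm b" for u :: "'a unitization"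
proof -
  have "norm (ulmult u b) \<le> onorm (ulmult u) * norm b"
    by (rule onorm[OF bounded_linear_ulmult])
  also have "\<dots> \<le> norm u * norm b"
    by (intro mult_right_mono) (auto simp: norm_unitization_def)
  finally show ?thesis .
qed

lemma norm_unitization_le:
  fixes u :: "'a unitization"
  assumes "cmod (uscal u) \<le> c" "\<And>b. norm (ulmult u b) \<le> c * norm b"
  shows "norm u \<le> c"
proof -
  have "0 \<le> c" using assms(1) norm_ge_zero order_trans by blast
  then show ?thesis using assms by (auto simp: norm_unitization_def intro: onorm_bound)
qed

lemma norm_uscal_le: "cmod (uscal u) \<le> norm u" for u :: "'a unitization"
  by (simp add: norm_unitization_def)

lemma norm_unitization_nonneg: "0 \<le> norm u" for u :: "'a unitization"
  using norm_uscal_le norm_ge_zero order_trans by blast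

text \<open>Let \<open>u\<close> act on \<open>star (upart u)\<close>: the product
  \<open>upart u * star (upart u)\<close> is the resulting value minus a scalar multiple, and each
  of the two terms costs one \<open>norm u\<close>. The bound makes the norm definite and
  \<open>upart\<close> continuous.\<close>

lemma norm_upart_le: "norm (upart u) \<le> 2 * norm u" for u :: "'a unitization"
proof (cases "upart u = 0")
  case False
  have "upart u * star (upart u) = ulmult u (star (upart u)) - uscal u *\<^sub>C star (upart u)"
    by (simp add: ulmult_def)
  then have "(norm (upart u))\<^sup>2 \<le> norm (ulmult u (star (upart u))) + norm (uscal u *\<^sub>C star (upart u))"
    by (metis norm_mult_star norm_triangle_ineq4)
  also have "\<dots> \<le> norm u * norm (upart u) + norm u * norm (upart u)"
    using norm_ulmult_le[of u "star (upart u)"] norm_uscal_le[of u]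
    by (intro add_mono) (auto simp: norm_scaleC mult_right_mono)
  finally have "norm (upart u) * norm (upart u) \<le> (2 * norm u) * norm (upart u)"
    by (simp add: power2_eq_square)
  with False show ?thesis by simp
qed (simp add: norm_unitization_nonneg)

lemma norm_unitization_triangle: "norm (u + v) \<le> norm u + norm v" for u v :: "'a unitization"
proof (rule norm_unitization_le)
  show "cmod (uscal (u + v)) \<le> norm u + norm v"
    using norm_triangle_ineq[of "uscal u" "uscal v"] norm_uscal_le[of u] norm_uscal_le[of v] by simp
  show "norm (ulmult (u + v) b) \<le> (norm u + norm v) * norm b" for b
    using norm_triangle_ineq[of "ulmult u b" "ulmult v b"] norm_ulmult_le[of u b] norm_ulmult_le[of v b]
    by (simp add: ulmult_add distrib_right)
qed

lemma norm_unitization_mult: "norm (u * v) \<le> norm u * norm v" for u v :: "'a unitization"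
proof (rule norm_unitization_le)
  show "cmod (uscal (u * v)) \<le> norm u * norm v"
    by (simp add: norm_mult mult_mono norm_uscal_le norm_unitization_nonneg)
  show "norm (ulmult (u * v) b) \<le> norm u * norm v * norm b" for b
  proof -
    have "norm (ulmult (u * v) b) \<le> norm u * norm (ulmult v b)"
      by (simp add: ulmult_mult norm_ulmult_le)
    also have "\<dots> \<le> norm u * (norm v * norm b)"
      by (intro mult_left_mono norm_ulmult_le norm_unitization_nonneg)
    finally show ?thesis by (simp add: mult.assoc)
  qed
qed

lemma norm_unitization_eq_0: "norm u = 0 \<longleftrightarrow> u = 0" for u :: "'a unitization"
proof
  assume u: "norm u = 0"
  have "upart u = 0" "uscal u = 0"
    using norm_upart_le[of u] norm_uscal_le[of u] u by auto
  then show "u = 0" by (simp add: unitization_eqI)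
next
  assume "u = 0"
  then have "norm u \<le> 0"
    by (intro norm_unitization_le) (auto simp: ulmult_def)
  then show "norm u = 0" using norm_unitization_nonneg[of u] by simp
qed

lemma norm_unitization_scaleR_le: "norm (r *\<^sub>R u) \<le> \<bar>r\<bar> * norm u" for u :: "'a unitization"
proof (rule norm_unitization_le)
  show "cmod (uscal (r *\<^sub>R u)) \<le> \<bar>r\<bar> * norm u"
    by (simp add: mult_left_mono norm_uscal_le)
  show "norm (ulmult (r *\<^sub>R u) b) \<le> \<bar>r\<bar> * norm u * norm b" for b
    by (simp add: ulmult_scaleR mult.assoc mult_left_mono norm_ulmult_le)
qed

lemma norm_unitization_scaleR: "norm (r *\<^sub>R u) = \<bar>r\<bar> * norm u" for u :: "'a unitization"
proof (cases "r = 0")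
  case True
  then have "r *\<^sub>R u = 0" by (auto intro: unitization_eqI)
  then have "norm (r *\<^sub>R u) = 0" by (simp only: norm_unitization_eq_0)
  with True show ?thesis by simp
next
  case False
  have "inverse r *\<^sub>R (r *\<^sub>R u) = u"
    using False by (auto intro!: unitization_eqI)
  then have "norm u \<le> \<bar>inverse r\<bar> * norm (r *\<^sub>R u)"
    using norm_unitization_scaleR_le[of "inverse r" "r *\<^sub>R u"] by simp
  then have "\<bar>r\<bar> * norm u \<le> \<bar>r\<bar> * (\<bar>inverse r\<bar> * norm (r *\<^sub>R u))"
    by (intro mult_left_mono) auto
  then have "\<bar>r\<bar> * norm u \<le> norm (r *\<^sub>R u)"
    using False by (simp add: abs_mult[symmetric] flip: mult.assoc)
  then show ?thesis using norm_unitization_scaleR_le[of r u] by simp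
qed

lemma norm_unitization_le_sum: "norm u \<le> norm (upart u) + cmod (uscal u)" for u :: "'a unitization"
proof (rule norm_unitization_le)
  show "norm (ulmult u b) \<le> (norm (upart u) + cmod (uscal u)) * norm b" for b
    unfolding ulmult_def
    by (rule order_trans[OF norm_triangle_ineq])
       (simp add: distrib_right norm_scaleC norm_mult_ineq)
qed simp

instance
proof
  fix u v w :: "'a unitization" and r s :: real
  show "u + v + w = u + (v + w)" "u + v = v + u" "0 + u = u" "- u + u = 0" "u - v = u + - v"
    "r *\<^sub>R (u + v) = r *\<^sub>R u + r *\<^sub>R v" "(r + s) *\<^sub>R u = r *\<^sub>R u + s *\<^sub>R u"
    "r *\<^sub>R s *\<^sub>R u = (r * s) *\<^sub>R u" "1 *\<^sub>R u = u"
    by (auto intro!: unitization_eqI simp: algebra_simps)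
  show "u * v * w = u * (v * w)" "(u + v) * w = u * w + v * w" "u * (v + w) = u * v + u * w"
    "1 * u = u" "u * 1 = u" "r *\<^sub>R u * v = r *\<^sub>R (u * v)" "u * r *\<^sub>R v = r *\<^sub>R (u * v)"
    by (auto intro!: unitization_eqI simp: algebra_simps scaleC_mult_left scaleC_mult_right
        scaleC_scaleC scaleC_add_right scaleC_add_left scaleC_one scaleR_eq_scaleC scaleR_conv_of_real)
  show "(0 :: 'a unitization) \<noteq> 1"
    by (metis unitization_simps(2,4) zero_neq_one)
  show "norm (r *\<^sub>R u) = \<bar>r\<bar> * norm u" by (rule norm_unitization_scaleR)
  show "norm u = 0 \<longleftrightarrow> u = 0" by (rule norm_unitization_eq_0)
  show "norm (u + v) \<le> norm u + norm v" by (rule norm_unitization_triangle)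
  show "norm (u * v) \<le> norm u * norm v" by (rule norm_unitization_mult)
  show "norm (1 :: 'a unitization) = 1"
  proof (rule antisym)
    show "norm (1 :: 'a unitization) \<le> 1"
      by (rule norm_unitization_le) (auto simp: ulmult_one)
    show "1 \<le> norm (1 :: 'a unitization)" using norm_uscal_le[of 1] by simp
  qed
  show "sgn u = inverse (norm u) *\<^sub>R u" by (rule sgn_unitization_def)
  show "dist u v = norm (u - v)" by (rule dist_unitization_def)
  show "(uniformity :: ('a unitization \<times> 'a unitization) filter) =
      (INF e\<in>{0<..}. principal {(x, y). dist x y < e})"
    by (rule uniformity_unitization_def)
  show "open S = (\<forall>x\<in>S. \<forall>\<^sub>F (x', y) in uniformity. x' = x \<longrightarrow> y \<in> S)" for S :: "'a unitization set"
    by (rule open_unitization_def)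
qed

end

lemma bounded_linear_upart: "bounded_linear (upart :: 'a::cstar_algebra unitization \<Rightarrow> 'a)"
  by (rule bounded_linear_intro[where K = 2]) (use norm_upart_le in \<open>auto simp: mult.commute\<close>)

lemma bounded_linear_uscal: "bounded_linear (uscal :: 'a::cstar_algebra unitization \<Rightarrow> complex)"
  by (rule bounded_linear_intro[where K = 1]) (use norm_uscal_le in auto)

instantiation unitization :: (cstar_algebra) cstar_algebra_1
begin

definition "c *\<^sub>C u = Unitization (c *\<^sub>C upart u) (c * uscal u)"
definition "star u = Unitization (star (upart u)) (cnj (uscal u))"

lemma unitization_star_simps [simp]:
  fixes u :: "'a unitization"
  shows "upart (c *\<^sub>C u) = c *\<^sub>C upart u" "uscal (c *\<^sub>C u) = c * uscal u"
    "upart (star u) = star (upart u)" "uscal (star u) = cnj (uscal u)"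
  by (simp_all add: scaleC_unitization_def star_unitization_def)

lemma ulmult_scaleC: "ulmult (c *\<^sub>C u :: 'a unitization) b = c *\<^sub>C ulmult u b"
  by (simp add: ulmult_def scaleC_mult_left scaleC_scaleC scaleC_add_right)

lemma norm_unitization_scaleC_le: "norm (c *\<^sub>C u) \<le> cmod c * norm u" for u :: "'a unitization"
proof (rule norm_unitization_le)
  show "cmod (uscal (c *\<^sub>C u)) \<le> cmod c * norm u"
    by (simp add: norm_mult mult_left_mono norm_uscal_le)
  show "norm (ulmult (c *\<^sub>C u) b) \<le> cmod c * norm u * norm b" for b
    by (simp add: ulmult_scaleC norm_scaleC mult.assoc mult_left_mono norm_ulmult_le)
qed

lemma norm_unitization_scaleC: "norm (c *\<^sub>C u) = cmod c * norm u" for u :: "'a unitization"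
proof (cases "c = 0")
  case True
  then have "c *\<^sub>C u = 0" by (auto intro: unitization_eqI)
  with True show ?thesis by simp
next
  case False
  have "inverse c *\<^sub>C (c *\<^sub>C u) = u"
    using False by (auto intro!: unitization_eqI simp: scaleC_scaleC scaleC_one)
  then have "norm u \<le> cmod (inverse c) * norm (c *\<^sub>C u)"
    using norm_unitization_scaleC_le[of "inverse c" "c *\<^sub>C u"] by simp
  then have "cmod c * norm u \<le> cmod c * (cmod (inverse c) * norm (c *\<^sub>C u))"
    by (intro mult_left_mono) auto
  then have "cmod c * norm u \<le> norm (c *\<^sub>C u)"
    using False by (simp add: norm_mult[symmetric] flip: mult.assoc)
  then show ?thesis using norm_unitization_scaleC_le[of c u] by simp
qed

text \<open>The C*-identity of the algebra, applied to \<open>ulmult u b\<close> for every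
  \<open>b\<close>, bounds the operator norm; the scalar part is checked separately. The reverse
  inequality is submultiplicativity, once \<open>star\<close> is known to be isometric.\<close>

lemma norm_unitization_star_mult_ge: "(norm u)\<^sup>2 \<le> norm (star u * u)" for u :: "'a unitization"
proof -
  have "norm u \<le> sqrt (norm (star u * u))"
  proof (rule norm_unitization_le)
    have "(cmod (uscal u))\<^sup>2 = cmod (uscal (star u * u))"
      by (simp add: norm_mult power2_eq_square)
    then show "cmod (uscal u) \<le> sqrt (norm (star u * u))"
      using norm_uscal_le[of "star u * u"] by (intro real_le_rsqrt) simp
    show "norm (ulmult u b) \<le> sqrt (norm (star u * u)) * norm b" for b
    proof -
      have "star (ulmult u b) * ulmult u b = star b * ulmult (star u * u) b"
        by (simp add: ulmult_def algebra_simps star_add star_mult star_scaleC scaleC_mult_left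
            scaleC_mult_right scaleC_scaleC scaleC_add_right)
      then have "(norm (ulmult u b))\<^sup>2 = norm (star b * ulmult (star u * u) b)"
        by (metis norm_star_mult)
      also have "\<dots> \<le> norm b * (norm (star u * u) * norm b)"
        by (intro order_trans[OF norm_mult_ineq] mult_mono norm_ulmult_le) auto
      also have "\<dots> = (sqrt (norm (star u * u)) * norm b)\<^sup>2"
        by (simp add: power2_eq_square norm_unitization_nonneg)
      finally show ?thesis
        by (rule power2_le_imp_le) (simp add: norm_unitization_nonneg)
    qed
  qed
  then show ?thesis
    by (metis norm_unitization_nonneg power_mono real_sqrt_pow2)
qed

instance
proof
  fix u v w :: "'a unitization" and r :: real and c d :: complex
  show "(\<lambda>u. r *\<^sub>R u :: 'a unitization) = scaleC (complex_of_real r)"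
    by (intro ext unitization_eqI) (simp_all add: scaleR_eq_scaleC scaleR_conv_of_real[where 'a = complex])
  show "c *\<^sub>C (u + v) = c *\<^sub>C u + c *\<^sub>C v" "(c + d) *\<^sub>C u = c *\<^sub>C u + d *\<^sub>C u"
    "c *\<^sub>C d *\<^sub>C u = (c * d) *\<^sub>C u" "(c *\<^sub>C u) * v = c *\<^sub>C (u * v)" "u * (c *\<^sub>C v) = c *\<^sub>C (u * v)"
    by (auto intro!: unitization_eqI simp: algebra_simps scaleC_mult_left scaleC_mult_right
        scaleC_scaleC scaleC_add_right scaleC_add_left)
  show "star (u + v) = star u + star v" "star (c *\<^sub>C u) = cnj c *\<^sub>C star u"
    "star (u * v) = star v * star u" "star (star u) = u"
    by (auto intro!: unitization_eqI simp: star_add star_scaleC star_mult star_star algebra_simps)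
  show "norm (c *\<^sub>C u) = cmod c * norm u" by (rule norm_unitization_scaleC)
  have le: "norm w \<le> norm (star w)" for w :: "'a unitization"
  proof (cases "w = 0")
    case False
    have "norm w * norm w \<le> norm (star w) * norm w"
      using norm_unitization_star_mult_ge[of w] norm_mult_ineq[of "star w" w]
      by (simp add: power2_eq_square)
    with False show ?thesis by simp
  qed simp
  have "star (star u) = u" by (auto intro!: unitization_eqI simp: star_star)
  then have "norm (star u) = norm u" using le[of u] le[of "star u"] by simp
  then show "norm (star u * u) = (norm u)\<^sup>2"
    using norm_unitization_star_mult_ge[of u] norm_mult_ineq[of "star u" u]
    by (simp add: power2_eq_square)
  \<comment> \<open>Completeness is componentwise: up to constants the norm is equivalent to
    \<open>norm (upart u) + cmod (uscal u)\<close>.\<close>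
  show "convergent X" if "Cauchy X" for X :: "nat \<Rightarrow> 'a unitization"
  proof -
    have "convergent (\<lambda>n. upart (X n))" "convergent (\<lambda>n. uscal (X n))"
      using bounded_linear.Cauchy[OF bounded_linear_upart that]
        bounded_linear.Cauchy[OF bounded_linear_uscal that] Cauchy_convergent_iff by auto
    then obtain a l where al: "(\<lambda>n. upart (X n)) \<longlonglongrightarrow> a" "(\<lambda>n. uscal (X n)) \<longlonglongrightarrow> l"
      by (auto simp: convergent_def)
    have lim: "(\<lambda>n. norm (upart (X n) - a) + cmod (uscal (X n) - l)) \<longlonglongrightarrow> 0"
      using tendsto_add[OF tendsto_norm_zero[OF LIM_zero[OF al(1)]]
          tendsto_norm_zero[OF LIM_zero[OF al(2)]]] by simp
    have bnd: "norm (X n - Unitization a l) \<le> norm (upart (X n) - a) + cmod (uscal (X n) - l)" for n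
      using norm_unitization_le_sum[of "X n - Unitization a l"] by simp
    have "(\<lambda>n. X n - Unitization a l) \<longlonglongrightarrow> 0"
      by (rule Lim_null_comparison[OF always_eventually[OF allI[OF bnd]] lim])
    then show ?thesis using LIM_zero_cancel convergent_def by blast
  qed
qed

end

section \<open>The isometric embedding, and contractivity of homomorphisms\<close>

definition unitize :: "'a::cstar_algebra \<Rightarrow> 'a unitization" where
  "unitize a = Unitization a 0"

lemma unitize_simps [simp]: "upart (unitize a) = a" "uscal (unitize a) = 0"
  by (simp_all add: unitize_def)

lemma unitize_add: "unitize (a + b) = unitize a + unitize b"
  and unitize_diff: "unitize (a - b) = unitize a - unitize b"
  and unitize_mult: "unitize (a * b) = unitize a * unitize b"
  and unitize_star: "unitize (star a) = star (unitize a)"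
  and unitize_scaleR: "unitize (r *\<^sub>R a) = r *\<^sub>R unitize a"
  and unitize_zero [simp]: "unitize 0 = 0"
  by (auto intro!: unitization_eqI)

lemma unitize_sum: "unitize (\<Sum>i\<in>I. f i) = (\<Sum>i\<in>I. unitize (f i))"
  by (induction I rule: infinite_finite_induct) (auto simp: unitize_add)

lemma norm_unitize [simp]: "norm (unitize a) = norm a"
proof (rule antisym)
  show "norm (unitize a) \<le> norm a"
    using norm_unitization_le_sum[of "unitize a"] by simp
  show "norm a \<le> norm (unitize a)"
  proof (cases "a = 0")
    case False
    have "norm a * norm a \<le> norm (unitize a) * norm a"
      using norm_ulmult_le[of "unitize a" "star a"]
      by (simp add: ulmult_def norm_mult_star power2_eq_square)
    with False show ?thesis by simp
  qed simp
qed

lemma tendsto_unitize [tendsto_intros]: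
  "(f \<longlongrightarrow> a) F \<Longrightarrow> ((\<lambda>x. unitize (f x)) \<longlongrightarrow> unitize a) F"
  unfolding tendsto_iff dist_norm by (simp flip: unitize_diff)

lemma cpos_diff_if_norm_le: "cpos a \<Longrightarrow> norm a \<le> t \<Longrightarrow> cpos (t *\<^sub>R 1 - a)"
  unfolding cpos_def
  by (intro conjI exI[of _ t]) (auto simp: star_diff star_scaleR intro: order_trans[OF norm_ge_zero])

text \<open>Positivity is an algebraic notion, being a square of a self-adjoint element, and it
  determines the norm.\<close>

lemma norm_unital_star_hom_le:
  fixes g :: "'a::cstar_algebra_1 \<Rightarrow> 'b::cstar_algebra_1"
  assumes add: "\<And>u v. g (u + v) = g u + g v" and mult: "\<And>u v. g (u * v) = g u * g v"
    and star: "\<And>u. g (star u) = star (g u)" and scale: "\<And>r. g (r *\<^sub>R 1) = r *\<^sub>R 1"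
  shows "norm (g u) \<le> norm u"
proof -
  define t where "t = (norm u)\<^sup>2"
  have "cpos (t *\<^sub>R 1 - star u * u)"
    by (intro cpos_diff_if_norm_le cpos_star_mult_self) (simp add: t_def norm_star_mult)
  then obtain h where h: "cpos h" "h * h = t *\<^sub>R 1 - star u * u"
    using cpos_sqrt by blast
  have "star (g h) = g h" using star[of h] cpos_star[OF h(1)] by simp
  then have "cpos (g h * g h)" by (rule cpos_square)
  moreover have "g h * g h + star (g u) * g u = t *\<^sub>R 1"
  proof -
    have "h * h + star u * u = t *\<^sub>R 1" using h(2) by simp
    from arg_cong[OF this, of g] show ?thesis by (simp add: add mult star scale)
  qed
  ultimately have "cpos (t *\<^sub>R 1 - star (g u) * g u)"
    by (metis add_diff_cancel_right')
  then have "norm (star (g u) * g u) \<le> t"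
    by (intro norm_le_if_cpos_diff cpos_star_mult_self) (auto simp: t_def)
  then show ?thesis by (simp add: t_def norm_star_mult)
qed

text \<open>Extending \<open>f\<close> by the identity on scalars makes it unital, and
  \<open>unitize\<close> is isometric on both sides.\<close>

lemma norm_star_hom_le:
  fixes f :: "'a::cstar_algebra \<Rightarrow> 'b::cstar_algebra"
  assumes "\<And>x y. f (x + y) = f x + f y" "\<And>c x. f (c *\<^sub>C x) = c *\<^sub>C f x"
    "\<And>x y. f (x * y) = f x * f y" "\<And>x. f (star x) = star (f x)"
  shows "norm (f x) \<le> norm x"
proof -
  let ?g = "\<lambda>u. Unitization (f (upart u)) (uscal u)"
  have "f 0 = 0" using assms(1)[of 0 0] by simp
  then have "norm (?g (unitize x)) \<le> norm (unitize x)"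
    by (intro norm_unital_star_hom_le unitization_eqI) (auto simp: assms)
  then show ?thesis by (simp flip: unitize_def)
qed

text \<open>The inverse of a bijective homomorphism is again one, so contractivity holds in both
  directions. The continuity of each \<open>\<sigma> t\<close> comes from here.\<close>

lemma norm_star_automorphism:
  fixes f :: "'a::cstar_algebra \<Rightarrow> 'a"
  assumes "star_automorphism f"
  shows "norm (f x) = norm x"
proof (rule antisym)
  have f: "bij f" "\<And>x y. f (x + y) = f x + f y" "\<And>c x. f (c *\<^sub>C x) = c *\<^sub>C f x"
    "\<And>x y. f (x * y) = f x * f y" "\<And>x. f (star x) = star (f x)"
    using assms by (auto simp: star_automorphism_def)
  show "norm (f x) \<le> norm x" by (rule norm_star_hom_le) (use f in auto)
  have inv_f: "inv f (f x) = x" for x using f(1) by (simp add: bij_is_inj)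
  have f_inv: "f (inv f x) = x" for x using f(1) by (simp add: bij_is_surj surj_f_inv_f)
  have "norm (inv f y) \<le> norm y" for y
  proof (rule norm_star_hom_le)
    fix x y c
    show "inv f (x + y) = inv f x + inv f y" using inv_f[of "inv f x + inv f y"] by (simp add: f f_inv)
    show "inv f (c *\<^sub>C x) = c *\<^sub>C inv f x" using inv_f[of "c *\<^sub>C inv f x"] by (simp add: f f_inv)
    show "inv f (x * y) = inv f x * inv f y" using inv_f[of "inv f x * inv f y"] by (simp add: f f_inv)
    show "inv f (star x) = star (inv f x)" using inv_f[of "star (inv f x)"] by (simp add: f f_inv)
  qed
  from this[of "f x"] show "norm x \<le> norm (f x)"
    using f(1) by (simp add: bij_is_inj)
qed


section \<open>Square roots of positive matrices\<close>

text \<open>The algebra-valued inner product of the Hilbert module of columns of length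
  \<open>n\<close>. Matrices are studied through their action on it.\<close>

definition vec_inner :: "nat \<Rightarrow> (nat \<Rightarrow> 'a::cstar_algebra) \<Rightarrow> (nat \<Rightarrow> 'a) \<Rightarrow> 'a" where
  "vec_inner n u v = (\<Sum>i<n. star (u i) * v i)"

definition mat_vec :: "nat \<Rightarrow> (nat \<Rightarrow> nat \<Rightarrow> 'a::ring) \<Rightarrow> (nat \<Rightarrow> 'a) \<Rightarrow> nat \<Rightarrow> 'a" where
  "mat_vec n X v = (\<lambda>i. \<Sum>j<n. X i j * v j)"

definition mat_mult :: "nat \<Rightarrow> (nat \<Rightarrow> nat \<Rightarrow> 'a::ring) \<Rightarrow> (nat \<Rightarrow> nat \<Rightarrow> 'a) \<Rightarrow> nat \<Rightarrow> nat \<Rightarrow> 'a" where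
  "mat_mult n X Y = (\<lambda>i j. \<Sum>k<n. X i k * Y k j)"

lemma vec_inner_cong: "(\<And>i. i < n \<Longrightarrow> u i = u' i) \<Longrightarrow> (\<And>i. i < n \<Longrightarrow> v i = v' i) \<Longrightarrow>
    vec_inner n u v = vec_inner n u' v'"
  by (simp add: vec_inner_def)

lemma cpos_vec_inner_self: "cpos (vec_inner n v (v :: nat \<Rightarrow> 'a::cstar_algebra_1))"
  unfolding vec_inner_def by (intro cpos_sum cpos_star_mult_self)

lemma vec_inner_diff:
  "vec_inner n (\<lambda>i. u i - v i) w = vec_inner n u w - vec_inner n v w"
  "vec_inner n w (\<lambda>i. u i - v i) = vec_inner n w u - vec_inner n w v"
  by (simp_all add: vec_inner_def star_diff left_diff_distrib right_diff_distrib sum_subtractf)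

lemma vec_inner_scaleR:
  "vec_inner n (\<lambda>i. r *\<^sub>R u i) w = r *\<^sub>R vec_inner n u w"
  "vec_inner n w (\<lambda>i. r *\<^sub>R u i) = r *\<^sub>R vec_inner n w u"
  by (simp_all add: vec_inner_def star_scaleR scaleR_sum_right)

lemma vec_inner_add_self:
  "vec_inner n (\<lambda>i. u i + v i) (\<lambda>i. u i + v i) =
    vec_inner n u u + vec_inner n v v + (vec_inner n u v + vec_inner n v u)"
  by (simp add: vec_inner_def star_add algebra_simps sum.distrib)

lemma mat_vec_add: "mat_vec n (\<lambda>i j. X i j + Y i j) v = (\<lambda>i. mat_vec n X v i + mat_vec n Y v i)"
  by (simp add: mat_vec_def distrib_right sum.distrib)

lemma mat_vec_diff: "mat_vec n X (\<lambda>i. u i - v i) = (\<lambda>i. mat_vec n X u i - mat_vec n X v i)"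
  by (simp add: mat_vec_def right_diff_distrib sum_subtractf)

lemma mat_vec_scaleR:
  fixes X :: "nat \<Rightarrow> nat \<Rightarrow> 'a::real_algebra"
  shows "mat_vec n (\<lambda>i j. r *\<^sub>R X i j) v = (\<lambda>i. r *\<^sub>R mat_vec n X v i)"
  by (simp add: mat_vec_def scaleR_sum_right)

lemma mat_vec_mult: "mat_vec n (mat_mult n X Y) v = mat_vec n X (mat_vec n Y v)"
  unfolding mat_vec_def mat_mult_def sum_distrib_left sum_distrib_right
  by (subst sum.swap) (simp add: mult.assoc)

lemma mat_mult_assoc: "mat_mult n (mat_mult n X Y) Z = mat_mult n X (mat_mult n Y Z)"
  unfolding mat_mult_def sum_distrib_left sum_distrib_right
  by (subst sum.swap) (simp add: mult.assoc)

lemma mat_mult_left_iter: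
  fixes X :: "nat \<Rightarrow> nat \<Rightarrow> 'a::real_algebra"
  shows "mat_mult n Z (\<lambda>i j. r *\<^sub>R (X i j + Y i j)) =
    (\<lambda>i j. r *\<^sub>R (mat_mult n Z X i j + mat_mult n Z Y i j))"
  by (simp add: mat_mult_def distrib_left sum.distrib flip: scaleR_sum_right)

lemma mat_mult_right_iter:
  fixes X :: "nat \<Rightarrow> nat \<Rightarrow> 'a::real_algebra"
  shows "mat_mult n (\<lambda>i j. r *\<^sub>R (X i j + Y i j)) Z =
    (\<lambda>i j. r *\<^sub>R (mat_mult n X Z i j + mat_mult n Y Z i j))"
  by (simp add: mat_mult_def distrib_right sum.distrib flip: scaleR_sum_right)

text \<open>A substitute for the C*-norm of the matrix algebra.\<close>

definition mat_bound :: "nat \<Rightarrow> real \<Rightarrow> (nat \<Rightarrow> nat \<Rightarrow> 'a::cstar_algebra_1) \<Rightarrow> bool" where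
  "mat_bound n c X \<longleftrightarrow>
    (\<forall>v. cpos (c\<^sup>2 *\<^sub>R vec_inner n v v - vec_inner n (mat_vec n X v) (mat_vec n X v)))"

lemma mat_bound_mult:
  assumes "mat_bound n c X" "mat_bound n d Y"
  shows "mat_bound n (c * d) (mat_mult n X Y)"
  unfolding mat_bound_def
proof
  fix v
  let ?y = "mat_vec n Y v"
  have "(c * d)\<^sup>2 *\<^sub>R vec_inner n v v - vec_inner n (mat_vec n X ?y) (mat_vec n X ?y) =
      c\<^sup>2 *\<^sub>R (d\<^sup>2 *\<^sub>R vec_inner n v v - vec_inner n ?y ?y) +
      (c\<^sup>2 *\<^sub>R vec_inner n ?y ?y - vec_inner n (mat_vec n X ?y) (mat_vec n X ?y))"
    by (simp add: scaleR_diff_right power_mult_distrib)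
  also have "cpos \<dots>"
    using assms by (intro cpos_add cpos_scaleR) (auto simp: mat_bound_def)
  finally show "cpos ((c * d)\<^sup>2 *\<^sub>R vec_inner n v v -
      vec_inner n (mat_vec n (mat_mult n X Y) v) (mat_vec n (mat_mult n X Y) v))"
    by (simp add: mat_vec_mult)
qed

lemma mat_bound_mono:
  assumes "mat_bound n c X" "0 \<le> c" "c \<le> d"
  shows "mat_bound n d X"
  unfolding mat_bound_def
proof
  fix v
  have "c\<^sup>2 \<le> d\<^sup>2" using assms by (simp add: power_mono)
  then have "cpos ((d\<^sup>2 - c\<^sup>2) *\<^sub>R vec_inner n v v +
      (c\<^sup>2 *\<^sub>R vec_inner n v v - vec_inner n (mat_vec n X v) (mat_vec n X v)))"
    using assms by (intro cpos_add cpos_scaleR cpos_vec_inner_self) (auto simp: mat_bound_def)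
  then show "cpos (d\<^sup>2 *\<^sub>R vec_inner n v v - vec_inner n (mat_vec n X v) (mat_vec n X v))"
    by (simp add: scaleR_diff_left)
qed

text \<open>With \<open>p = X v\<close> and \<open>q = Y v\<close>, the positive square of
  \<open>a p - q / a\<close> bounds the mixed terms of the square of \<open>p + q\<close> by
  \<open>d / c\<close> times the square of \<open>p\<close> plus \<open>c / d\<close> times that of
  \<open>q\<close>. The weight \<open>a^2 = d / c\<close> is the one for which the total is
  \<open>(c + d)^2\<close>.\<close>

lemma mat_bound_add_pos:
  assumes "mat_bound n c X" "mat_bound n d Y" "0 < c" "0 < d"
  shows "mat_bound n (c + d) (\<lambda>i j. X i j + Y i j)"
  unfolding mat_bound_def
proof
  fix v
  let ?p = "mat_vec n X v" and ?q = "mat_vec n Y v" and ?v = "vec_inner n v v"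
  define a where "a = sqrt (d / c)"
  have a: "a > 0" "a\<^sup>2 = d / c" using assms by (auto simp: a_def)
  define r where "r = (\<lambda>i. a *\<^sub>R ?p i - (1 / a) *\<^sub>R ?q i)"
  have "vec_inner n r r = a\<^sup>2 *\<^sub>R vec_inner n ?p ?p + (1 / a\<^sup>2) *\<^sub>R vec_inner n ?q ?q
      - (vec_inner n ?p ?q + vec_inner n ?q ?p)"
    unfolding r_def vec_inner_diff vec_inner_scaleR using a(1)
    by (simp add: scaleR_diff_right power2_eq_square)
  then have r: "vec_inner n r r = (d / c) *\<^sub>R vec_inner n ?p ?p + (c / d) *\<^sub>R vec_inner n ?q ?q
      - (vec_inner n ?p ?q + vec_inner n ?q ?p)"
    by (simp add: a(2))
  have cd: "(c + d)\<^sup>2 = (1 + d / c) * c\<^sup>2 + (1 + c / d) * d\<^sup>2"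
    using assms(3,4) by (simp add: power2_eq_square field_simps)
  have "(c + d)\<^sup>2 *\<^sub>R ?v - vec_inner n (\<lambda>i. ?p i + ?q i) (\<lambda>i. ?p i + ?q i) =
      (1 + d / c) *\<^sub>R (c\<^sup>2 *\<^sub>R ?v - vec_inner n ?p ?p) +
      (1 + c / d) *\<^sub>R (d\<^sup>2 *\<^sub>R ?v - vec_inner n ?q ?q) + vec_inner n r r"
    unfolding cd vec_inner_add_self r
    by (simp add: scaleR_diff_right scaleR_add_left)
  also have "cpos \<dots>"
    using assms by (intro cpos_add cpos_scaleR cpos_vec_inner_self) (auto simp: mat_bound_def)
  finally show "cpos ((c + d)\<^sup>2 *\<^sub>R vec_inner n v v - vec_inner n
      (mat_vec n (\<lambda>i j. X i j + Y i j) v) (mat_vec n (\<lambda>i j. X i j + Y i j) v))"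
    by (simp add: mat_vec_add)
qed

text \<open>The weights \<open>d / c\<close> and \<open>c / d\<close> exclude zero bounds; both
  bounds are enlarged by \<open>1 / (m + 1)\<close> and the limit is taken in the closed
  cone.\<close>

lemma mat_bound_add:
  assumes "mat_bound n c X" "mat_bound n d Y" "0 \<le> c" "0 \<le> d"
  shows "mat_bound n (c + d) (\<lambda>i j. X i j + Y i j)"
  unfolding mat_bound_def
proof
  fix v
  let ?Z = "mat_vec n (\<lambda>i j. X i j + Y i j) v" and ?e = "\<lambda>m. inverse (real (Suc m))"
  show "cpos ((c + d)\<^sup>2 *\<^sub>R vec_inner n v v - vec_inner n ?Z ?Z)"
  proof (rule cpos_limit)
    have "(\<lambda>m. ((c + ?e m) + (d + ?e m))\<^sup>2 *\<^sub>R vec_inner n v v - vec_inner n ?Z ?Z)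
        \<longlonglongrightarrow> ((c + 0) + (d + 0))\<^sup>2 *\<^sub>R vec_inner n v v - vec_inner n ?Z ?Z"
      by (intro tendsto_intros LIMSEQ_inverse_real_of_nat)
    then show "(\<lambda>m. ((c + ?e m) + (d + ?e m))\<^sup>2 *\<^sub>R vec_inner n v v - vec_inner n ?Z ?Z)
        \<longlonglongrightarrow> (c + d)\<^sup>2 *\<^sub>R vec_inner n v v - vec_inner n ?Z ?Z" by simp
    fix m
    have "0 < ?e m" by simp
    have "mat_bound n ((c + ?e m) + (d + ?e m)) (\<lambda>i j. X i j + Y i j)"
      using assms \<open>0 < ?e m\<close>
      by (intro mat_bound_add_pos mat_bound_mono[OF assms(1)] mat_bound_mono[OF assms(2)]) linarith+
    then show "cpos (((c + ?e m) + (d + ?e m))\<^sup>2 *\<^sub>R vec_inner n v v - vec_inner n ?Z ?Z)"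
      by (simp add: mat_bound_def)
  qed
qed

lemma mat_bound_scaleR:
  assumes "mat_bound n c X"
  shows "mat_bound n (r * c) (\<lambda>i j. r *\<^sub>R X i j)"
  unfolding mat_bound_def
proof
  fix v
  let ?p = "mat_vec n X v"
  have "(r * c)\<^sup>2 *\<^sub>R vec_inner n v v - vec_inner n (\<lambda>i. r *\<^sub>R ?p i) (\<lambda>i. r *\<^sub>R ?p i) =
      r\<^sup>2 *\<^sub>R (c\<^sup>2 *\<^sub>R vec_inner n v v - vec_inner n ?p ?p)"
    unfolding vec_inner_scaleR by (simp add: scaleR_diff_right power_mult_distrib power2_eq_square)
  also have "cpos \<dots>"
    using assms by (intro cpos_scaleR) (auto simp: mat_bound_def)
  finally show "cpos ((r * c)\<^sup>2 *\<^sub>R vec_inner n v v -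
      vec_inner n (mat_vec n (\<lambda>i j. r *\<^sub>R X i j) v) (mat_vec n (\<lambda>i j. r *\<^sub>R X i j) v))"
    by (simp add: mat_vec_scaleR)
qed

lemma mat_bound_zero: "0 \<le> c \<Longrightarrow> mat_bound n c (\<lambda>i j. 0)"
  by (simp add: mat_bound_def mat_vec_def vec_inner_def cpos_vec_inner_self[unfolded vec_inner_def] cpos_scaleR)

lemma norm_entry_le_mat_bound:
  fixes X :: "nat \<Rightarrow> nat \<Rightarrow> 'a::cstar_algebra_1"
  assumes "mat_bound n c X" "0 \<le> c" "i < n" "j < n"
  shows "norm (X i j) \<le> c"
proof -
  define e where "e = (\<lambda>k. if k = j then 1 else 0 :: 'a)"
  have "mat_vec n X e = (\<lambda>i. X i j)"
    using assms(4) by (auto simp: mat_vec_def e_def if_distrib sum.delta cong: if_cong)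
  moreover have "vec_inner n e e = 1"
    using assms(4) by (auto simp: vec_inner_def e_def if_distrib sum.delta cong: if_cong)
  ultimately have "cpos (c\<^sup>2 *\<^sub>R 1 - (\<Sum>k<n. star (X k j) * X k j))"
    using assms(1) by (auto simp: mat_bound_def vec_inner_def dest!: spec[of _ e])
  moreover have "cpos (\<Sum>k\<in>{..<n} - {i}. star (X k j) * X k j)"
    by (intro cpos_sum cpos_star_mult_self)
  ultimately have "cpos (c\<^sup>2 *\<^sub>R 1 - star (X i j) * X i j)"
    using assms(3) by (subst (asm) sum.remove[of _ i]) (auto dest: cpos_add)
  then have "norm (star (X i j) * X i j) \<le> c\<^sup>2"
    by (intro norm_le_if_cpos_diff cpos_star_mult_self) auto
  then show ?thesis
    using assms(2) by (simp add: norm_star_mult abs_le_square_iff[symmetric])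
qed

text \<open>The iteration \<open>sqrt_iter\<close> again, written out because matrices are functions
  and not elements of an algebra type.\<close>

primrec mat_sqrt_iter :: "nat \<Rightarrow> (nat \<Rightarrow> nat \<Rightarrow> 'a::real_algebra) \<Rightarrow> nat \<Rightarrow> nat \<Rightarrow> nat \<Rightarrow> 'a" where
  "mat_sqrt_iter n S 0 = (\<lambda>i j. 0)"
| "mat_sqrt_iter n S (Suc m) =
    (\<lambda>i j. (1/2) *\<^sub>R (S i j + mat_mult n (mat_sqrt_iter n S m) (mat_sqrt_iter n S m) i j))"

lemma mat_sqrt_iter_commute:
  assumes "mat_mult n Z S = mat_mult n S Z"
  shows "mat_mult n Z (mat_sqrt_iter n S m) = mat_mult n (mat_sqrt_iter n S m) Z"
proof (induction m)
  case (Suc m)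
  let ?Y = "mat_sqrt_iter n S m"
  have "mat_mult n Z (mat_mult n ?Y ?Y) = mat_mult n (mat_mult n ?Y ?Y) Z"
    by (metis Suc mat_mult_assoc)
  then show ?case
    by (simp only: mat_sqrt_iter.simps mat_mult_left_iter mat_mult_right_iter assms)
qed (simp add: mat_mult_def)

lemma mat_sqrt_iter_bound:
  assumes "mat_bound n 1 S"
  shows "mat_bound n (sqrt_iter 1 m) (mat_sqrt_iter n S m)"
proof (induction m)
  case (Suc m)
  have "mat_bound n ((1/2) * (1 + sqrt_iter 1 m * sqrt_iter 1 m)) (mat_sqrt_iter n S (Suc m))"
    unfolding mat_sqrt_iter.simps
    by (intro mat_bound_scaleR mat_bound_add mat_bound_mult assms Suc) (auto simp: sqrt_iter_real)
  then show ?case by simp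
qed (simp add: mat_bound_zero)

lemma mat_sqrt_iter_diff_bound:
  assumes "mat_bound n 1 S"
  shows "mat_bound n (sqrt_iter 1 (Suc m) - sqrt_iter 1 m)
    (\<lambda>i j. mat_sqrt_iter n S (Suc m) i j - mat_sqrt_iter n S m i j)"
proof (induction m)
  case 0
  then show ?case
    using mat_bound_scaleR[OF assms, of "1/2"] by (simp add: mat_mult_def)
next
  case (Suc m)
  define A where "A = mat_sqrt_iter n S (Suc m)"
  define B where "B = mat_sqrt_iter n S m"
  let ?s = "sqrt_iter (1::real)"
  have "mat_mult n A B = mat_mult n B A"
    unfolding A_def B_def by (intro mat_sqrt_iter_commute mat_sqrt_iter_commute[symmetric] refl)
  then have comm: "(\<Sum>k<n. A i k * B k j) = (\<Sum>k<n. B i k * A k j)" for i j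
    by (simp add: mat_mult_def fun_eq_iff)
  have "mat_sqrt_iter n S (Suc (Suc m)) i j - A i j =
      (1/2) *\<^sub>R mat_mult n (\<lambda>i j. A i j - B i j) (\<lambda>i j. A i j + B i j) i j" for i j
  proof -
    have "A i j = (1/2) *\<^sub>R (S i j + mat_mult n B B i j)" by (simp add: A_def B_def)
    moreover have "mat_sqrt_iter n S (Suc (Suc m)) i j = (1/2) *\<^sub>R (S i j + mat_mult n A A i j)"
      by (simp add: A_def del: mat_sqrt_iter.simps(2)[of _ _ m])
    ultimately have "mat_sqrt_iter n S (Suc (Suc m)) i j - A i j =
        (1/2) *\<^sub>R (mat_mult n A A i j - mat_mult n B B i j)"
      by (simp add: scaleR_diff_right scaleR_add_right)
    also have "mat_mult n A A i j - mat_mult n B B i j =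
        mat_mult n (\<lambda>i j. A i j - B i j) (\<lambda>i j. A i j + B i j) i j"
      by (simp add: mat_mult_def left_diff_distrib distrib_left sum.distrib sum_subtractf comm)
    finally show ?thesis .
  qed
  moreover have "mat_bound n ((1/2) * ((?s (Suc m) - ?s m) * (?s (Suc m) + ?s m)))
      (\<lambda>i j. (1/2) *\<^sub>R mat_mult n (\<lambda>i j. A i j - B i j) (\<lambda>i j. A i j + B i j) i j)"
    using Suc mat_sqrt_iter_bound[OF assms, of m] mat_sqrt_iter_bound[OF assms, of "Suc m"]
      sqrt_iter_real(1)[of m] sqrt_iter_real(1)[of "Suc m"]
    unfolding A_def B_def by (intro mat_bound_scaleR mat_bound_mult mat_bound_add)
  ultimately show ?case
    unfolding sqrt_iter_real_Suc_diff by (simp only: A_def)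
qed

definition mat_one :: "nat \<Rightarrow> nat \<Rightarrow> 'a::zero_neq_one" where
  "mat_one = (\<lambda>i j. if i = j then 1 else 0)"

text \<open>The iterates converge entrywise. Their entries are polynomials without constant term in
  the entries of \<open>S\<close>, so they and their limits remain in the closed algebra
  \<open>B\<close>; the last conclusion is the fixed point equation.\<close>

lemma mat_one_minus_sqrt:
  fixes S :: "nat \<Rightarrow> nat \<Rightarrow> 'a::cstar_algebra_1"
  assumes bound: "mat_bound n 1 S" and herm: "\<And>i j. i < n \<Longrightarrow> j < n \<Longrightarrow> star (S i j) = S j i"
    and B: "closed B" "0 \<in> B" "\<And>x y. x \<in> B \<Longrightarrow> y \<in> B \<Longrightarrow> x + y \<in> B"
      "\<And>x y. x \<in> B \<Longrightarrow> y \<in> B \<Longrightarrow> x * y \<in> B" "\<And>r x. x \<in> B \<Longrightarrow> r *\<^sub>R x \<in> B"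
      "\<And>i j. i < n \<Longrightarrow> j < n \<Longrightarrow> S i j \<in> B"
  obtains Y where "\<And>i j. i < n \<Longrightarrow> j < n \<Longrightarrow> star (Y i j) = Y j i"
    "\<And>i j. i < n \<Longrightarrow> j < n \<Longrightarrow> Y i j \<in> B"
    "\<And>i j. i < n \<Longrightarrow> j < n \<Longrightarrow> 2 *\<^sub>R Y i j = S i j + mat_mult n Y Y i j"
proof -
  let ?Y = "mat_sqrt_iter n S"
  have "Cauchy (\<lambda>m. ?Y m i j)" if "i < n" "j < n" for i j
    using norm_entry_le_mat_bound[OF mat_sqrt_iter_diff_bound[OF bound] _ that] sqrt_iter_real_mono
    by (intro Cauchy_dominated[OF sqrt_iter_real_Cauchy]) (auto simp del: sqrt_iter.simps)
  then have "\<forall>i j. \<exists>y. i < n \<longrightarrow> j < n \<longrightarrow> (\<lambda>m. ?Y m i j) \<longlonglongrightarrow> y"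
    using Cauchy_convergent_iff convergent_def by metis
  then obtain Y where Y: "\<And>i j. i < n \<Longrightarrow> j < n \<Longrightarrow> (\<lambda>m. ?Y m i j) \<longlonglongrightarrow> Y i j"
    by metis
  have star_iter: "star (?Y m i j) = ?Y m j i" if "i < n" "j < n" for m i j
    using that
  proof (induction m arbitrary: i j)
    case (Suc m)
    then show ?case by (simp add: star_scaleR star_add star_sum star_mult herm mat_mult_def)
  qed simp
  have B_sum: "(\<Sum>i\<in>I. f i) \<in> B" if "\<And>i. i \<in> I \<Longrightarrow> f i \<in> B" for I :: "nat set" and f
    using that by (induction I rule: infinite_finite_induct) (auto intro: B)
  have B_iter: "?Y m i j \<in> B" if "i < n" "j < n" for m i j
    using that
    by (induction m arbitrary: i j) (auto simp: mat_mult_def intro!: B B_sum)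
  show ?thesis
  proof (rule that)
    fix i j assume ij: "i < n" "j < n"
    have "(\<lambda>m. ?Y m j i) \<longlonglongrightarrow> star (Y i j)"
      using tendsto_star[OF Y[OF ij]] by (simp add: star_iter ij)
    then show "star (Y i j) = Y j i" using Y[OF ij(2,1)] by (rule LIMSEQ_unique)
    show "Y i j \<in> B"
      using closed_sequentially[OF B(1) _ Y[OF ij]] B_iter[OF ij] by blast
    have "(\<lambda>m. ?Y (Suc m) i j) \<longlonglongrightarrow> (1/2) *\<^sub>R (S i j + mat_mult n Y Y i j)"
      unfolding mat_sqrt_iter.simps mat_mult_def by (intro tendsto_intros Y) (use ij in auto)
    then have "Y i j = (1/2) *\<^sub>R (S i j + mat_mult n Y Y i j)"
      using LIMSEQ_Suc[OF Y[OF ij]] LIMSEQ_unique by blast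
    from arg_cong[OF this, of "\<lambda>y. 2 *\<^sub>R y"] show "2 *\<^sub>R Y i j = S i j + mat_mult n Y Y i j"
      by simp
  qed
qed

text \<open>Positivity of the form on the module is the notion that survives averages and entrywise
  limits; \<open>mat_pos_sqrt\<close> turns it back into a factorization.\<close>

definition mat_pos :: "nat \<Rightarrow> (nat \<Rightarrow> nat \<Rightarrow> 'a::cstar_algebra_1) \<Rightarrow> bool" where
  "mat_pos n T \<longleftrightarrow> (\<forall>i<n. \<forall>j<n. star (T i j) = T j i) \<and>
    (\<forall>v. cpos (vec_inner n v (mat_vec n T v)))"

lemma vec_inner_mat_vec_adjoint:
  assumes "\<And>i j. i < n \<Longrightarrow> j < n \<Longrightarrow> star (T i j) = T j i"
  shows "vec_inner n (mat_vec n T u) v = vec_inner n u (mat_vec n T v)"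
proof -
  have "vec_inner n (mat_vec n T u) v = (\<Sum>i<n. \<Sum>j<n. star (u j) * T j i * v i)"
    by (simp add: vec_inner_def mat_vec_def star_sum star_mult sum_distrib_right assms mult.assoc)
  also have "\<dots> = vec_inner n u (mat_vec n T v)"
    by (subst sum.swap) (simp add: vec_inner_def mat_vec_def sum_distrib_left mult.assoc)
  finally show ?thesis .
qed

text \<open>For \<open>0 \<le> T \<le> 1\<close> one has
  \<open>1 - (1 - T)^2 = T + (T - T^2)\<close> and
  \<open>T - T^2 = T (1 - T) T + (1 - T) T (1 - T)\<close>, a sum of positive terms. The proof
  writes this out for forms, with \<open>w = T v\<close>.\<close>

lemma mat_bound_one_minus:
  fixes T :: "nat \<Rightarrow> nat \<Rightarrow> 'a::cstar_algebra_1"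
  assumes "mat_pos n T" and le: "\<And>v. cpos (vec_inner n v v - vec_inner n v (mat_vec n T v))"
  shows "mat_bound n 1 (\<lambda>i j. mat_one i j - T i j)"
  unfolding mat_bound_def
proof
  fix v
  let ?S = "\<lambda>i j. mat_one i j - T i j" and ?T = "mat_vec n T"
  define w where "w = ?T v"
  have adj: "vec_inner n (?T x) y = vec_inner n x (?T y)" for x y
    using assms(1) by (intro vec_inner_mat_vec_adjoint) (auto simp: mat_pos_def)
  have "mat_vec n ?S v i = v i - w i" if "i < n" for i
  proof -
    have "(\<Sum>j<n. mat_one i j * v j) = v i"
      using that by (simp add: mat_one_def if_distrib[of "\<lambda>x. x * _"] cong: if_cong)
    then show ?thesis by (simp add: mat_vec_def w_def left_diff_distrib sum_subtractf)
  qed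
  then have "vec_inner n (mat_vec n ?S v) (mat_vec n ?S v) =
      vec_inner n (\<lambda>i. v i - w i) (\<lambda>i. v i - w i)"
    by (intro vec_inner_cong)
  then have "1\<^sup>2 *\<^sub>R vec_inner n v v - vec_inner n (mat_vec n ?S v) (mat_vec n ?S v) =
      vec_inner n v w + (vec_inner n v w - vec_inner n w w)"
    by (simp add: vec_inner_diff) (simp add: w_def adj)
  also have "vec_inner n v w - vec_inner n w w =
      (vec_inner n w w - vec_inner n w (?T w)) + vec_inner n (\<lambda>i. v i - w i) (?T (\<lambda>i. v i - w i))"
  proof -
    have "vec_inner n v (?T w) = vec_inner n w w" by (simp add: w_def adj)
    then show ?thesis
      by (simp add: mat_vec_diff vec_inner_diff) (simp add: w_def)
  qed
  also have "cpos (vec_inner n v w + \<dots>)"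
    using assms(1) le by (intro cpos_add) (auto simp: mat_pos_def w_def)
  finally show "cpos (1\<^sup>2 *\<^sub>R vec_inner n v v - vec_inner n (mat_vec n ?S v) (mat_vec n ?S v))" .
qed

lemma cpos_conj: "cpos a \<Longrightarrow> cpos (star x * a * x)"
proof -
  assume "cpos a"
  then obtain h where h: "cpos h" "h * h = a" using cpos_sqrt by blast
  have "star x * a * x = star (h * x) * (h * x)"
    by (simp add: star_mult cpos_star[OF h(1)] mult.assoc flip: h(2))
  then show ?thesis using cpos_star_mult_self by metis
qed

text \<open>For each pair of indices the square of \<open>v i - T i j * v j\<close> bounds the mixed
  terms by the square of \<open>v i\<close> plus \<open>K^2\<close> times that of
  \<open>v j\<close>. Summation over all pairs counts every index \<open>n\<close> times.\<close>

lemma quadratic_form_le: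
  fixes T :: "nat \<Rightarrow> nat \<Rightarrow> 'a::cstar_algebra_1"
  assumes herm: "\<And>i j. i < n \<Longrightarrow> j < n \<Longrightarrow> star (T i j) = T j i"
    and K: "\<And>i j. i < n \<Longrightarrow> j < n \<Longrightarrow> norm (T i j) \<le> K"
  shows "cpos ((real n * (1 + K\<^sup>2)) *\<^sub>R vec_inner n v v - 2 *\<^sub>R vec_inner n v (mat_vec n T v))"
proof -
  define z where "z = (\<lambda>i j. T i j * v j)"
  have pos: "cpos (star (v i) * v i + K\<^sup>2 *\<^sub>R (star (v j) * v j) - (star (v i) * z i j + star (z i j) * v i))"
    if ij: "i < n" "j < n" for i j
  proof -
    have "norm (star (T i j) * T i j) \<le> K\<^sup>2"
      using K[OF ij] by (simp add: norm_star_mult power_mono)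
    then have "cpos (star (v j) * (K\<^sup>2 *\<^sub>R 1 - star (T i j) * T i j) * v j)"
      by (intro cpos_conj cpos_diff_if_norm_le cpos_star_mult_self)
    then have "cpos (star (v i - z i j) * (v i - z i j) +
        star (v j) * (K\<^sup>2 *\<^sub>R 1 - star (T i j) * T i j) * v j)"
      by (intro cpos_add cpos_star_mult_self)
    also have "star (v i - z i j) * (v i - z i j) +
        star (v j) * (K\<^sup>2 *\<^sub>R 1 - star (T i j) * T i j) * v j =
        star (v i) * v i + K\<^sup>2 *\<^sub>R (star (v j) * v j) - (star (v i) * z i j + star (z i j) * v i)"
      by (simp add: z_def star_diff star_mult algebra_simps)
    finally show ?thesis .
  qed
  have 1: "(\<Sum>i<n. \<Sum>j<n. star (v i) * v i) = real n *\<^sub>R vec_inner n v v"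
    by (simp add: vec_inner_def scaleR_sum_right sum_constant_scaleR del: sum_constant)
  have 2: "(\<Sum>i<n. \<Sum>j<n. K\<^sup>2 *\<^sub>R (star (v j) * v j)) = (real n * K\<^sup>2) *\<^sub>R vec_inner n v v"
    by (simp add: vec_inner_def scaleR_sum_right sum_constant_scaleR del: sum_constant)
  have 3: "(\<Sum>i<n. \<Sum>j<n. star (v i) * z i j) = vec_inner n v (mat_vec n T v)"
    by (simp add: vec_inner_def mat_vec_def z_def sum_distrib_left)
  have "(\<Sum>i<n. \<Sum>j<n. star (z i j) * v i) = vec_inner n (mat_vec n T v) v"
    by (simp add: vec_inner_def mat_vec_def z_def sum_distrib_right star_sum)
  then have 4: "(\<Sum>i<n. \<Sum>j<n. star (z i j) * v i) = vec_inner n v (mat_vec n T v)"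
    using vec_inner_mat_vec_adjoint[of n T v v, OF herm] by simp
  have "cpos (\<Sum>i<n. \<Sum>j<n. star (v i) * v i + K\<^sup>2 *\<^sub>R (star (v j) * v j)
      - (star (v i) * z i j + star (z i j) * v i))"
    by (intro cpos_sum pos) auto
  then show ?thesis
    unfolding sum_subtractf sum.distrib 1 2 3 4 by (simp add: scaleR_2 distrib_left scaleR_add_left)
qed

lemma mat_pos_sqrt:
  fixes T :: "nat \<Rightarrow> nat \<Rightarrow> 'a::cstar_algebra_1"
  assumes T: "mat_pos n T"
    and B: "closed B" "0 \<in> B" "1 \<in> B" "\<And>x y. x \<in> B \<Longrightarrow> y \<in> B \<Longrightarrow> x + y \<in> B"
      "\<And>x y. x \<in> B \<Longrightarrow> y \<in> B \<Longrightarrow> x * y \<in> B" "\<And>r x. x \<in> B \<Longrightarrow> r *\<^sub>R x \<in> B"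
      "\<And>i j. i < n \<Longrightarrow> j < n \<Longrightarrow> T i j \<in> B"
  obtains W where "\<And>i j. i < n \<Longrightarrow> j < n \<Longrightarrow> star (W i j) = W j i"
    "\<And>i j. i < n \<Longrightarrow> j < n \<Longrightarrow> W i j \<in> B"
    "\<And>i j. i < n \<Longrightarrow> j < n \<Longrightarrow> T i j = mat_mult n W W i j"
proof -
  have herm: "star (T i j) = T j i" if "i < n" "j < n" for i j
    using T that by (simp add: mat_pos_def)
  define K where "K = (\<Sum>i<n. \<Sum>j<n. norm (T i j))"
  have K: "norm (T i j) \<le> K" if "i < n" "j < n" for i j
  proof -
    have "norm (T i j) \<le> (\<Sum>j<n. norm (T i j))"
      using that by (intro member_le_sum) auto
    also have "\<dots> \<le> K"
      unfolding K_def using that by (intro member_le_sum[of i "{..<n}" "\<lambda>i. \<Sum>j<n. norm (T i j)"]) (auto intro: sum_nonneg)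
    finally show ?thesis .
  qed
  \<comment> \<open>Half the constant of \<open>quadratic_form_le\<close>, so that
    \<open>T \<le> c\<close>; the summand 1 keeps \<open>c\<close> positive when
    \<open>n = 0\<close>.\<close>
  define c where "c = real n * (1 + K\<^sup>2) / 2 + 1"
  have c: "c > 0" by (simp add: c_def add_nonneg_pos)
  have c2: "2 * c = real n * (1 + K\<^sup>2) + 2" by (simp add: c_def)
  define T' where "T' = (\<lambda>i j. (1 / c) *\<^sub>R T i j)"
  have "mat_pos n T'"
    unfolding mat_pos_def T'_def mat_vec_scaleR vec_inner_scaleR
    using T c by (auto simp: star_scaleR mat_pos_def intro!: cpos_scaleR)
  moreover have "cpos (vec_inner n v v - vec_inner n v (mat_vec n T' v))" for v
  proof -
    have "cpos ((1 / (2 * c)) *\<^sub>R (((real n * (1 + K\<^sup>2)) *\<^sub>R vec_inner n v v - 2 *\<^sub>R vec_inner n v (mat_vec n T v))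
        + 2 *\<^sub>R vec_inner n v v))"
      using c by (intro cpos_scaleR cpos_add quadratic_form_le herm K cpos_vec_inner_self) auto
    also have "((real n * (1 + K\<^sup>2)) *\<^sub>R vec_inner n v v - 2 *\<^sub>R vec_inner n v (mat_vec n T v))
        + 2 *\<^sub>R vec_inner n v v = (2 * c) *\<^sub>R vec_inner n v v - 2 *\<^sub>R vec_inner n v (mat_vec n T v)"
      unfolding c2 by (simp add: scaleR_add_left)
    also have "(1 / (2 * c)) *\<^sub>R \<dots> = vec_inner n v v - vec_inner n v (mat_vec n T' v)"
      using c unfolding T'_def mat_vec_scaleR vec_inner_scaleR by (simp add: scaleR_diff_right)
    finally show ?thesis .
  qed
  ultimately have bound: "mat_bound n 1 (\<lambda>i j. mat_one i j - T' i j)"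
    by (rule mat_bound_one_minus)
  have star: "star (mat_one i j - T' i j) = mat_one j i - T' j i" if "i < n" "j < n" for i j
    using herm that by (auto simp: T'_def mat_one_def star_diff star_scaleR)
  have BS: "mat_one i j - T' i j \<in> B" if "i < n" "j < n" for i j
  proof -
    have "mat_one i j + (- 1 / c) *\<^sub>R T i j \<in> B"
      using that by (intro B) (auto simp: mat_one_def B)
    then show ?thesis by (simp add: T'_def)
  qed
  obtain Y where Y: "\<And>i j. i < n \<Longrightarrow> j < n \<Longrightarrow> star (Y i j) = Y j i"
    "\<And>i j. i < n \<Longrightarrow> j < n \<Longrightarrow> Y i j \<in> B"
    "\<And>i j. i < n \<Longrightarrow> j < n \<Longrightarrow> 2 *\<^sub>R Y i j = (mat_one i j - T' i j) + mat_mult n Y Y i j"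
    by (rule mat_one_minus_sqrt[OF bound, of B]) (assumption | rule star BS B that)+
  \<comment> \<open>The equation for \<open>Y\<close> says that \<open>1 - Y\<close> is a square
    root of \<open>T' = T / c\<close>.\<close>
  define W where "W = (\<lambda>i j. sqrt c *\<^sub>R (mat_one i j - Y i j))"
  show ?thesis
  proof (rule that)
    fix i j assume ij: "i < n" "j < n"
    show "star (W i j) = W j i"
      using Y(1)[OF ij] by (auto simp: W_def star_scaleR star_diff mat_one_def)
    have "mat_one i j + (- 1) *\<^sub>R Y i j \<in> B"
      using ij Y(2) by (intro B) (auto simp: mat_one_def B)
    then show "W i j \<in> B"
      unfolding W_def by (intro B) simp
    have "(\<Sum>k<n. (mat_one i k - Y i k) * (mat_one k j - Y k j)) =
        (\<Sum>k<n. mat_one i k * mat_one k j) - (\<Sum>k<n. mat_one i k * Y k j)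
        - (\<Sum>k<n. Y i k * mat_one k j) + mat_mult n Y Y i j"
      by (simp add: algebra_simps sum.distrib sum_subtractf mat_mult_def)
    also have "\<dots> = mat_one i j - Y i j - Y i j + mat_mult n Y Y i j"
      using ij by (simp add: mat_one_def if_distrib[of "\<lambda>x. x * _"] if_distrib[of "\<lambda>x. _ * x"] cong: if_cong)
    also have "\<dots> = T' i j" using Y(3)[OF ij] by (simp add: scaleR_2 algebra_simps)
    finally have "c *\<^sub>R (\<Sum>k<n. (mat_one i k - Y i k) * (mat_one k j - Y k j)) = T i j"
      using c by (simp add: T'_def)
    moreover have "mat_mult n W W i j = c *\<^sub>R (\<Sum>k<n. (mat_one i k - Y i k) * (mat_one k j - Y k j))"
      using c by (simp add: mat_mult_def W_def scaleR_sum_right)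
    ultimately show "T i j = mat_mult n W W i j" by simp
  qed
qed

section \<open>Positive matrices over the given algebra\<close>

definition gram_pos :: "nat \<Rightarrow> (nat \<Rightarrow> nat \<Rightarrow> 'a::cstar_algebra) \<Rightarrow> bool" where
  "gram_pos n X \<longleftrightarrow> mat_pos n (\<lambda>i j. unitize (X i j))"

text \<open>The form of this matrix at \<open>v\<close> is the inner product of \<open>Y v\<close>
  with itself.\<close>

lemma gram_pos_gram: "gram_pos n (\<lambda>i j. \<Sum>k<n. star (Y k i) * Y k j)"
  unfolding gram_pos_def mat_pos_def
proof (intro conjI allI impI)
  let ?T = "\<lambda>i j. unitize (\<Sum>k<n. star (Y k i) * Y k j)" and ?Y = "\<lambda>i j. unitize (Y i j)"
  show "star (?T i j) = ?T j i" for i j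
    by (simp add: star_sum star_mult star_star flip: unitize_star)
  fix v
  have "vec_inner n v (mat_vec n ?T v) =
      (\<Sum>i<n. \<Sum>j<n. \<Sum>k<n. star (v i) * (star (?Y k i) * ?Y k j * v j))"
    by (simp add: vec_inner_def mat_vec_def unitize_sum unitize_mult unitize_star sum_distrib_left
        sum_distrib_right)
  also have "\<dots> = (\<Sum>i<n. \<Sum>k<n. \<Sum>j<n. star (v i) * (star (?Y k i) * ?Y k j * v j))"
    by (rule sum.cong[OF refl]) (rule sum.swap)
  also have "\<dots> = (\<Sum>k<n. \<Sum>i<n. \<Sum>j<n. star (v i) * (star (?Y k i) * ?Y k j * v j))"
    by (rule sum.swap)
  also have "\<dots> = vec_inner n (mat_vec n ?Y v) (mat_vec n ?Y v)"
    by (simp add: vec_inner_def mat_vec_def star_sum star_mult sum_product mult.assoc)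
  finally show "cpos (vec_inner n v (mat_vec n ?T v))"
    by (simp add: cpos_vec_inner_self)
qed

lemma gram_pos_add:
  assumes "gram_pos n X" "gram_pos n Y"
  shows "gram_pos n (\<lambda>i j. X i j + Y i j)"
proof -
  have "vec_inner n v (\<lambda>i. p i + q i) = vec_inner n v p + vec_inner n v q"
    for v p q :: "nat \<Rightarrow> 'a unitization"
    by (simp add: vec_inner_def distrib_left sum.distrib)
  then show ?thesis
    using assms by (simp add: gram_pos_def mat_pos_def unitize_add star_add mat_vec_add cpos_add)
qed

lemma gram_pos_zero: "gram_pos n (\<lambda>i j. 0)"
  by (simp add: gram_pos_def mat_pos_def mat_vec_def vec_inner_def)

lemma gram_pos_sum:
  "(\<And>k. k \<in> K \<Longrightarrow> gram_pos n (X k)) \<Longrightarrow> gram_pos n (\<lambda>i j. \<Sum>k\<in>K. X k i j)"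
  by (induction K rule: infinite_finite_induct) (auto simp: gram_pos_zero gram_pos_add)

lemma gram_pos_scaleR: "gram_pos n X \<Longrightarrow> 0 \<le> r \<Longrightarrow> gram_pos n (\<lambda>i j. r *\<^sub>R X i j)"
  by (simp add: gram_pos_def mat_pos_def unitize_scaleR star_scaleR mat_vec_scaleR vec_inner_scaleR cpos_scaleR)

lemma gram_pos_limit:
  assumes lim: "\<And>i j. i < n \<Longrightarrow> j < n \<Longrightarrow> (\<lambda>m. X m i j) \<longlonglongrightarrow> Y i j" and pos: "\<And>m. gram_pos n (X m)"
  shows "gram_pos n Y"
  unfolding gram_pos_def mat_pos_def
proof (intro conjI allI impI)
  fix i j assume ij: "i < n" "j < n"
  have "(\<lambda>m. unitize (X m j i)) \<longlonglongrightarrow> star (unitize (Y i j))"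
    using tendsto_star[OF tendsto_unitize[OF lim[OF ij]]] pos ij
    by (simp add: gram_pos_def mat_pos_def)
  moreover have "(\<lambda>m. unitize (X m j i)) \<longlonglongrightarrow> unitize (Y j i)"
    by (intro tendsto_intros lim ij)
  ultimately show "star (unitize (Y i j)) = unitize (Y j i)" by (rule LIMSEQ_unique)
next
  fix v
  show "cpos (vec_inner n v (mat_vec n (\<lambda>i j. unitize (Y i j)) v))"
  proof (rule cpos_limit)
    show "(\<lambda>m. vec_inner n v (mat_vec n (\<lambda>i j. unitize (X m i j)) v))
        \<longlonglongrightarrow> vec_inner n v (mat_vec n (\<lambda>i j. unitize (Y i j)) v)"
      unfolding vec_inner_def mat_vec_def by (intro tendsto_intros lim) auto
    show "cpos (vec_inner n v (mat_vec n (\<lambda>i j. unitize (X m i j)) v))" for m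
      using pos by (simp add: gram_pos_def mat_pos_def)
  qed
qed

text \<open>The square root computed in the matrices over the unitization has entries in the
  algebra itself: its scalar part is a self-adjoint complex matrix with square zero.\<close>

lemma gram_pos_factor:
  fixes X :: "nat \<Rightarrow> nat \<Rightarrow> 'a::cstar_algebra"
  assumes pos: "gram_pos n X"
    and B: "closed B" "0 \<in> B" "\<And>x y. x \<in> B \<Longrightarrow> y \<in> B \<Longrightarrow> x + y \<in> B"
      "\<And>x y. x \<in> B \<Longrightarrow> y \<in> B \<Longrightarrow> x * y \<in> B" "\<And>c x. x \<in> B \<Longrightarrow> c *\<^sub>C x \<in> B"
      "\<And>i j. i < n \<Longrightarrow> j < n \<Longrightarrow> X i j \<in> B"
  obtains Z where "\<And>i j. i < n \<Longrightarrow> j < n \<Longrightarrow> Z i j \<in> B"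
    "\<And>i j. i < n \<Longrightarrow> j < n \<Longrightarrow> X i j = (\<Sum>k<n. star (Z k i) * Z k j)"
proof -
  \<comment> \<open>The preimage consists of the elements of \<open>B\<close> with an arbitrary
    scalar added, so it contains the unit that \<open>mat_pos_sqrt\<close> asks for.\<close>
  let ?B = "upart -` B"
  have "closed ?B"
    by (intro continuous_closed_vimage B linear_continuous_at bounded_linear_upart)
  then obtain W where W: "\<And>i j. i < n \<Longrightarrow> j < n \<Longrightarrow> star (W i j) = W j i"
    "\<And>i j. i < n \<Longrightarrow> j < n \<Longrightarrow> W i j \<in> ?B"
    "\<And>i j. i < n \<Longrightarrow> j < n \<Longrightarrow> unitize (X i j) = mat_mult n W W i j"
    using mat_pos_sqrt[OF pos[unfolded gram_pos_def], of ?B] B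
    by (auto simp: scaleR_eq_scaleC)
  have W0: "uscal (W k i) = 0" if "i < n" "k < n" for i k
  proof -
    \<comment> \<open>The scalar part of a diagonal entry of \<open>W W\<close> is a sum of squared
      moduli, and \<open>unitize (X i i)\<close> has scalar part zero.\<close>
    have "0 = (\<Sum>k<n. uscal (W i k) * uscal (W k i))"
      using arg_cong[OF W(3)[OF \<open>i < n\<close> \<open>i < n\<close>], of uscal]
      by (simp add: mat_mult_def bounded_linear.linear[OF bounded_linear_uscal] linear_sum)
    also have "\<dots> = (\<Sum>k<n. of_real ((cmod (uscal (W k i)))\<^sup>2))"
    proof (intro sum.cong refl)
      fix k assume "k \<in> {..<n}"
      then have "uscal (W i k) = cnj (uscal (W k i))"
        using arg_cong[OF W(1)[of k i], of uscal] that by simp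
      then show "uscal (W i k) * uscal (W k i) = of_real ((cmod (uscal (W k i)))\<^sup>2)"
        by (simp add: complex_norm_square mult.commute del: of_real_power)
    qed
    finally have "(\<Sum>k<n. (cmod (uscal (W k i)))\<^sup>2) = 0"
      by (simp flip: of_real_sum of_real_power)
    then show ?thesis using that by (simp add: sum_nonneg_eq_0_iff)
  qed
  show ?thesis
  proof (rule that[of "\<lambda>i j. upart (W i j)"])
    fix i j assume ij: "i < n" "j < n"
    show "upart (W i j) \<in> B" using W(2)[OF ij] by simp
    have "X i j = upart (mat_mult n W W i j)" by (simp flip: W(3)[OF ij])
    also have "\<dots> = (\<Sum>k<n. upart (W i k * W k j))"
      by (simp only: mat_mult_def linear_sum[OF bounded_linear.linear[OF bounded_linear_upart]])
    also have "\<dots> = (\<Sum>k<n. star (upart (W k i)) * upart (W k j))"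
    proof (intro sum.cong refl)
      fix k assume "k \<in> {..<n}"
      then show "upart (W i k * W k j) = star (upart (W k i)) * upart (W k j)"
        using arg_cong[OF W(1)[of k i], of upart] ij W0 by simp
    qed
    finally show "X i j = (\<Sum>k<n. star (upart (W k i)) * upart (W k j))" .
  qed
qed


section \<open>Averages and the conditional expectation\<close>

text \<open>The step \<open>1/m\<close> tends to zero and the length \<open>m\<^sup>2 \<sqdot> (1/m)\<close> of the averaging
  interval to infinity, so that every nonzero frequency is averaged out.\<close>

definition char_mean :: "nat \<Rightarrow> real \<Rightarrow> complex" where
  "char_mean m \<omega> = (\<Sum>k<(Suc m)\<^sup>2. exp (\<i> * of_real (real k / real (Suc m) * \<omega>))) /
    of_nat ((Suc m)\<^sup>2)"

text \<open>For nonzero \<open>\<omega>\<close> the mean is a geometric sum, at most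
  \<open>2 / (cmod (z - 1) * N)\<close> with \<open>z = exp (h m)\<close> and
  \<open>N = (m + 1)^2\<close>. As \<open>z - 1\<close> is of the order \<open>1 / (m + 1)\<close>,
  so is the bound.\<close>

lemma char_mean_tendsto: "(\<lambda>m. char_mean m \<omega>) \<longlonglongrightarrow> (if \<omega> = 0 then 1 else 0)"
proof (cases "\<omega> = 0")
  case True
  then have "char_mean m \<omega> = 1" for m by (simp add: char_mean_def del: of_nat_Suc of_nat_power)
  with True show ?thesis by simp
next
  case False
  define h where "h = (\<lambda>m. \<i> * of_real (\<omega> * inverse (real (Suc m))))"
  \<comment> \<open>\<open>q m\<close> compares \<open>exp (h m) - 1\<close> with
    \<open>h m\<close>. It may vanish for small \<open>m\<close>, when the step is a multiple of the
    period, but it tends to 1.\<close>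
  define q where "q = (\<lambda>m. (exp (h m) - 1) / h m)"
  have h0: "h m \<noteq> 0" for m using False by (simp add: h_def del: of_nat_Suc)
  have "h \<longlonglongrightarrow> \<i> * of_real (\<omega> * 0)"
    unfolding h_def by (intro tendsto_intros LIMSEQ_inverse_real_of_nat)
  then have "filterlim h (at 0) sequentially"
    using h0 by (auto simp: filterlim_at)
  moreover have "((\<lambda>h. (exp h - 1) / h) \<longlongrightarrow> 1) (at (0::complex))"
    using DERIV_exp[of "0::complex"] by (simp add: DERIV_def)
  ultimately have q: "q \<longlonglongrightarrow> 1"
    unfolding q_def by (rule filterlim_compose[rotated])
  have bound: "cmod (char_mean m \<omega>) \<le> (2 / \<bar>\<omega>\<bar>) * inverse (real (Suc m)) * inverse (cmod (q m))"
    if qm: "q m \<noteq> 0" for m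
  proof -
    let ?z = "exp (h m)" and ?N = "(Suc m)\<^sup>2"
    have z1: "?z \<noteq> 1" using qm by (auto simp: q_def)
    have "char_mean m \<omega> = (\<Sum>k<?N. ?z ^ k) / of_nat ?N"
      unfolding char_mean_def
      by (intro arg_cong2[where f = "(/)"] sum.cong refl)
         (simp add: h_def flip: exp_of_nat_mult, simp add: field_simps)
    also have "\<dots> = (?z ^ ?N - 1) / ((?z - 1) * of_nat ?N)"
      using z1 by (simp add: geometric_sum)
    finally have "cmod (char_mean m \<omega>) = cmod (?z ^ ?N - 1) / (cmod (?z - 1) * real ?N)"
      by (simp add: norm_divide norm_mult del: of_nat_power)
    also have "\<dots> \<le> 2 / (cmod (?z - 1) * real ?N)"
    proof (intro divide_right_mono)
      have "cmod ?z = 1" by (simp add: h_def)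
      then show "cmod (?z ^ ?N - 1) \<le> 2"
        using norm_triangle_ineq4[of "?z ^ ?N" 1] by (simp add: norm_power)
    qed simp
    also have "cmod (?z - 1) = cmod (q m) * (\<bar>\<omega>\<bar> * inverse (real (Suc m)))"
      using h0[of m] by (simp add: q_def norm_divide h_def norm_mult norm_inverse abs_mult del: of_nat_Suc)
    also have "2 / (cmod (q m) * (\<bar>\<omega>\<bar> * inverse (real (Suc m))) * real ?N) =
        (2 / \<bar>\<omega>\<bar>) * inverse (real (Suc m)) * inverse (cmod (q m))"
    proof -
      have N: "real ?N = real (Suc m) * real (Suc m)" by (simp only: power2_eq_square of_nat_mult)
      show ?thesis unfolding N using qm False by (simp add: field_simps del: of_nat_Suc)
    qed
    finally show ?thesis .
  qed
  have "(\<lambda>m. (2 / \<bar>\<omega>\<bar>) * inverse (real (Suc m)) * inverse (cmod (q m))) \<longlonglongrightarrow>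
      (2 / \<bar>\<omega>\<bar>) * 0 * inverse (cmod 1)"
    by (intro tendsto_intros LIMSEQ_inverse_real_of_nat q) auto
  then have lim: "(\<lambda>m. (2 / \<bar>\<omega>\<bar>) * inverse (real (Suc m)) * inverse (cmod (q m))) \<longlonglongrightarrow> 0"
    by simp
  have "eventually (\<lambda>m. q m \<noteq> 0) sequentially"
    using tendsto_imp_eventually_ne[OF q] by simp
  then have "eventually (\<lambda>m. norm (char_mean m \<omega>) \<le>
      (2 / \<bar>\<omega>\<bar>) * inverse (real (Suc m)) * inverse (cmod (q m))) sequentially"
    by (rule eventually_mono) (rule bound)
  then show ?thesis
    using Lim_null_comparison[OF _ lim] False by simp
qed

lemma closure_cspan_induct [consumes 1, case_names zero scale add limit]:
  fixes G :: "'a::cstar_algebra set"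
  assumes "x \<in> closure (cspan G)" "P 0"
    and "\<And>c x. x \<in> G \<Longrightarrow> P (c *\<^sub>C x)" "\<And>x y. P x \<Longrightarrow> P y \<Longrightarrow> P (x + y)"
    and "\<And>f l. (\<And>n::nat. P (f n)) \<Longrightarrow> f \<longlonglongrightarrow> l \<Longrightarrow> P l"
  shows "P x"
proof -
  have span: "P y" if "y \<in> cspan G" for y
    using that by (induction rule: cstar.span_induct_alt) (auto intro: assms)
  obtain f where "\<And>n::nat. f n \<in> cspan G" "f \<longlonglongrightarrow> x"
    using assms(1) closure_sequential[of x "cspan G"] by blast
  with span show ?thesis using assms(5) by blast
qed

text \<open>Contractivity makes the limits at the \<open>f n\<close> a Cauchy sequence, and an
  \<open>e / 3\<close> argument carries convergence to \<open>x\<close>. The filter is general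
  because the averages use a sequence and the dual action uses neighbourhoods of a
  character.\<close>

lemma contractions_limit_exists:
  fixes T :: "'i \<Rightarrow> 'a::cstar_algebra \<Rightarrow> 'a" and f :: "nat \<Rightarrow> 'a"
  assumes F: "F \<noteq> bot" and add: "\<And>i x y. T i (x + y) = T i x + T i y"
    and le: "\<And>i x. norm (T i x) \<le> norm x"
    and ex: "\<And>n. \<exists>l. ((\<lambda>i. T i (f n)) \<longlongrightarrow> l) F" and f: "f \<longlonglongrightarrow> x"
  shows "\<exists>l. ((\<lambda>i. T i x) \<longlongrightarrow> l) F"
proof -
  obtain l where l: "\<And>n. ((\<lambda>i. T i (f n)) \<longlongrightarrow> l n) F" using ex by metis
  have diff: "T i x - T i y = T i (x - y)" for i x y
    using add[of i "x - y" y] by simp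
  have "norm (l n - l m) \<le> norm (f n - f m)" for n m
    by (rule Lim_norm_ubound[OF F tendsto_diff[OF l[of n] l[of m]]]) (simp add: diff le)
  then have "Cauchy l"
    using f unfolding Cauchy_altdef2
    by (metis (no_types, lifting) Cauchy_altdef2 LIMSEQ_imp_Cauchy dist_norm order_le_less_trans)
  then obtain L where L: "l \<longlonglongrightarrow> L"
    using Cauchy_convergent_iff convergent_def by blast
  have "((\<lambda>i. T i x) \<longlongrightarrow> L) F"
  proof (rule tendstoI)
    fix e :: real assume "e > 0"
    then have "e / 3 > 0" by simp
    have "eventually (\<lambda>n. dist (f n) x < e / 3 \<and> dist (l n) L < e / 3) sequentially"
      using tendstoD[OF f \<open>e / 3 > 0\<close>] tendstoD[OF L \<open>e / 3 > 0\<close>] by eventually_elim auto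
    then obtain n where n: "dist (f n) x < e / 3" "dist (l n) L < e / 3"
      using eventually_happens'[OF sequentially_bot] by blast
    show "eventually (\<lambda>i. dist (T i x) L < e) F"
      using tendstoD[OF l[of n] \<open>e / 3 > 0\<close>]
    proof eventually_elim
      case (elim i)
      have "dist (T i x) (T i (f n)) < e / 3"
        using n(1) le[of i "x - f n"] by (simp add: dist_norm diff norm_minus_commute)
      with elim n(2) show ?case
        using dist_triangle[of "T i x" L "T i (f n)"] dist_triangle[of "T i (f n)" L "l n"] by linarith
    qed
  qed
  then show ?thesis ..
qed

section \<open>The flow, its spectral spaces and the averages over it\<close>

locale almost_periodic_dynamics =
  fixes \<sigma> :: "real \<Rightarrow> 'a::cstar_algebra \<Rightarrow> 'a"
  assumes almost_periodic: "almost_periodic \<sigma>"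
begin

abbreviation "A \<equiv> spectral_space \<sigma>"

lemma automorphism: "star_automorphism (\<sigma> t)"
  using almost_periodic by (simp add: almost_periodic_def dynamics_def)

lemma sigma_add: "\<sigma> t (x + y) = \<sigma> t x + \<sigma> t y"
  and sigma_scaleC: "\<sigma> t (c *\<^sub>C x) = c *\<^sub>C \<sigma> t x"
  and sigma_mult: "\<sigma> t (x * y) = \<sigma> t x * \<sigma> t y"
  and sigma_star: "\<sigma> t (star x) = star (\<sigma> t x)"
  using automorphism[of t] by (auto simp: star_automorphism_def)

lemma norm_sigma [simp]: "norm (\<sigma> t x) = norm x"
  by (rule norm_star_automorphism[OF automorphism])

lemma sigma_zero_time [simp]: "\<sigma> 0 x = x"
  using almost_periodic by (simp add: almost_periodic_def dynamics_def)

lemma sigma_add_time: "\<sigma> (s + t) x = \<sigma> s (\<sigma> t x)"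
  using almost_periodic by (simp add: almost_periodic_def dynamics_def)

lemma sigma_scaleR: "\<sigma> t (r *\<^sub>R x) = r *\<^sub>R \<sigma> t x"
  by (simp add: scaleR_eq_scaleC sigma_scaleC)

lemma bounded_linear_sigma: "bounded_linear (\<sigma> t)"
  by (rule bounded_linear_intro[where K = 1]) (auto simp: sigma_add sigma_scaleR)

lemmas sigma_diff = linear_diff[OF bounded_linear.linear[OF bounded_linear_sigma]]
lemmas sigma_sum = linear_sum[OF bounded_linear.linear[OF bounded_linear_sigma]]
lemmas tendsto_sigma = bounded_linear.tendsto[OF bounded_linear_sigma]

lemma spectral_iff: "a \<in> A \<omega> \<longleftrightarrow> (\<forall>t. \<sigma> t a = exp (\<i> * of_real (t * \<omega>)) *\<^sub>C a)"
  by (simp add: spectral_space_def)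

lemma sigma_spectral: "a \<in> A \<omega> \<Longrightarrow> \<sigma> t a = exp (\<i> * of_real (t * \<omega>)) *\<^sub>C a"
  by (simp add: spectral_iff)

lemma spectral_zero [simp]: "0 \<in> A \<omega>"
  using sigma_scaleC[of _ 0 0] by (simp add: spectral_iff)

lemma spectral_scaleC: "a \<in> A \<omega> \<Longrightarrow> c *\<^sub>C a \<in> A \<omega>"
  by (simp add: spectral_iff sigma_scaleC scaleC_scaleC mult.commute)

lemma spectral_add: "a \<in> A \<omega> \<Longrightarrow> b \<in> A \<omega> \<Longrightarrow> a + b \<in> A \<omega>"
  by (simp add: spectral_iff sigma_add scaleC_add_right)

lemma spectral_mult:
  assumes "a \<in> A \<omega>" "b \<in> A \<omega>'"
  shows "a * b \<in> A (\<omega> + \<omega>')"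
  unfolding spectral_iff
proof
  fix t
  show "\<sigma> t (a * b) = exp (\<i> * of_real (t * (\<omega> + \<omega>'))) *\<^sub>C (a * b)"
    using assms
    by (simp add: sigma_mult sigma_spectral scaleC_mult_left scaleC_mult_right scaleC_scaleC
        distrib_left exp_add)
qed

lemma spectral_star: "a \<in> A \<omega> \<Longrightarrow> star a \<in> A (- \<omega>)"
  by (simp add: spectral_iff sigma_star star_scaleC exp_cnj)

lemma closed_spectral: "closed (A \<omega>)"
  unfolding closed_sequential_limits
proof (intro allI impI, elim conjE)
  fix f l assume f: "\<forall>n. f n \<in> A \<omega>" "f \<longlonglongrightarrow> l"
  show "l \<in> A \<omega>"
    unfolding spectral_iff
  proof
    fix t
    have "(\<lambda>n. \<sigma> t (f n)) \<longlonglongrightarrow> exp (\<i> * of_real (t * \<omega>)) *\<^sub>C l"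
      unfolding sigma_spectral[OF f(1)[rule_format]] by (intro tendsto_intros f)
    moreover have "(\<lambda>n. \<sigma> t (f n)) \<longlonglongrightarrow> \<sigma> t l" by (rule tendsto_sigma[OF f(2)])
    ultimately show "\<sigma> t l = exp (\<i> * of_real (t * \<omega>)) *\<^sub>C l" by (rule LIMSEQ_unique[symmetric])
  qed
qed

lemma spectral_induct [case_names spectral add limit]:
  assumes "\<And>\<omega> x. x \<in> A \<omega> \<Longrightarrow> P x" "\<And>x y. P x \<Longrightarrow> P y \<Longrightarrow> P (x + y)"
    "\<And>f l. (\<And>n::nat. P (f n)) \<Longrightarrow> f \<longlonglongrightarrow> l \<Longrightarrow> P l"
  shows "P x"
proof (rule closure_cspan_induct)
  show "x \<in> closure (cspan (\<Union>\<omega>. A \<omega>))"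
    using almost_periodic by (simp add: almost_periodic_def)
qed (use assms spectral_scaleC spectral_zero in blast)+

text \<open>A convex combination of automorphisms: contractive, and compatible with positive
  matrices before any limit is taken.\<close>

definition avg :: "nat \<Rightarrow> 'a \<Rightarrow> 'a" where
  "avg m a = (1 / real ((Suc m)\<^sup>2)) *\<^sub>R (\<Sum>k<(Suc m)\<^sup>2. \<sigma> (real k / real (Suc m)) a)"

lemma avg_add: "avg m (a + b) = avg m a + avg m b"
  by (simp add: avg_def sigma_add sum.distrib scaleR_add_right)

lemma avg_scaleC: "avg m (c *\<^sub>C a) = c *\<^sub>C avg m a"
  by (simp add: avg_def sigma_scaleC scaleR_eq_scaleC scaleC_scaleC mult.commute
      flip: scaleC_sum_right)

lemma norm_avg_le: "norm (avg m a) \<le> norm a"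
proof -
  have "norm (\<Sum>k<(Suc m)\<^sup>2. \<sigma> (real k / real (Suc m)) a) \<le> (\<Sum>k<(Suc m)\<^sup>2. norm a)"
    by (rule order_trans[OF norm_sum]) simp
  then show ?thesis
    by (simp add: avg_def field_simps del: of_nat_Suc of_nat_power)
qed

lemma avg_spectral: "a \<in> A \<omega> \<Longrightarrow> avg m a = char_mean m \<omega> *\<^sub>C a"
  by (simp add: avg_def char_mean_def sigma_spectral scaleR_eq_scaleC scaleC_scaleC
      divide_inverse mult.commute del: of_nat_Suc of_nat_power flip: scaleC_sum_left)

lemma avg_spectral_tendsto: "a \<in> A \<omega> \<Longrightarrow> (\<lambda>m. avg m a) \<longlonglongrightarrow> (if \<omega> = 0 then a else 0)"
  using tendsto_scaleC[OF char_mean_tendsto[of \<omega>] tendsto_const[of a]]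
  by (auto simp: avg_spectral scaleC_one split: if_splits)

definition cexp :: "'a \<Rightarrow> 'a" where
  "cexp a = lim (\<lambda>m. avg m a)"

lemma avg_tendsto: "(\<lambda>m. avg m a) \<longlonglongrightarrow> cexp a"
proof -
  have "\<exists>l. (\<lambda>m. avg m a) \<longlonglongrightarrow> l"
  proof (induction a rule: spectral_induct)
    case (spectral \<omega> x)
    then show ?case using avg_spectral_tendsto by blast
  next
    case (add x y)
    then show ?case unfolding avg_add using tendsto_add by blast
  next
    case (limit f l)
    then show ?case
      by (rule contractions_limit_exists[OF sequentially_bot avg_add norm_avg_le])
  qed
  then show ?thesis
    unfolding cexp_def using convergent_LIMSEQ_iff convergent_def by blast
qed

lemma cexp_unique: "(\<lambda>m. avg m a) \<longlonglongrightarrow> l \<Longrightarrow> cexp a = l"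
  using LIMSEQ_unique avg_tendsto by blast

lemma cexp_add: "cexp (a + b) = cexp a + cexp b"
  by (rule cexp_unique) (simp add: avg_add tendsto_add avg_tendsto)

lemma cexp_scaleC: "cexp (c *\<^sub>C a) = c *\<^sub>C cexp a"
  by (rule cexp_unique) (simp add: avg_scaleC tendsto_scaleC avg_tendsto)

lemma norm_cexp_le: "norm (cexp a) \<le> norm a"
  by (rule LIMSEQ_le_const2[OF tendsto_norm[OF avg_tendsto]]) (use norm_avg_le in blast)

lemma bounded_linear_cexp: "bounded_linear cexp"
  by (rule bounded_linear_intro[where K = 1])
     (auto simp: cexp_add cexp_scaleC scaleR_eq_scaleC norm_cexp_le)

lemmas tendsto_cexp = bounded_linear.tendsto[OF bounded_linear_cexp]

lemma cexp_spectral: "a \<in> A \<omega> \<Longrightarrow> cexp a = (if \<omega> = 0 then a else 0)"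
  by (rule cexp_unique) (rule avg_spectral_tendsto)

lemma cexp_in_spectral_0: "cexp a \<in> A 0"
proof (induction a rule: spectral_induct)
  case (spectral \<omega> x)
  then show ?case by (cases "\<omega> = 0") (auto simp: cexp_spectral)
next
  case (limit f l)
  then show ?case using closed_sequentially[OF closed_spectral _ tendsto_cexp] by blast
qed (simp add: cexp_add spectral_add)

text \<open>Only frequency zero survives \<open>cexp\<close>, and there the flow is trivial.
  Functionals that factor through \<open>cexp\<close> become invariant in this way.\<close>

lemma cexp_sigma: "cexp (\<sigma> t a) = cexp a"
proof (induction a rule: spectral_induct)
  case (spectral \<omega> x)
  then show ?case by (simp add: sigma_spectral cexp_scaleC cexp_spectral scaleC_one)
next
  case (limit f l)
  have "(\<lambda>n. cexp (f n)) \<longlonglongrightarrow> cexp (\<sigma> t l)"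
    using tendsto_cexp[OF tendsto_sigma[OF limit(2), of t]] limit(1) by simp
  then show ?case using tendsto_cexp[OF limit(2)] by (rule LIMSEQ_unique)
qed (simp add: cexp_add sigma_add)

text \<open>An automorphism takes a matrix of this form to another of the same form. Averages and
  limits visibly preserve only positivity of the quadratic form, which is why
  \<open>gram_pos\<close> and not a factorization is carried along.\<close>

lemma gram_pos_cexp: "gram_pos n (\<lambda>i j. cexp (\<Sum>k<n. star (Y k i) * Y k j))"
proof (rule gram_pos_limit)
  show "(\<lambda>m. avg m (\<Sum>k<n. star (Y k i) * Y k j)) \<longlonglongrightarrow> cexp (\<Sum>k<n. star (Y k i) * Y k j)" for i j
    by (rule avg_tendsto)
  have "gram_pos n (\<lambda>i j. \<sigma> t (\<Sum>k<n. star (Y k i) * Y k j))" for t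
    using gram_pos_gram[of n "\<lambda>i j. \<sigma> t (Y i j)"]
    by (simp add: sigma_sum sigma_mult sigma_star)
  then show "gram_pos n (\<lambda>i j. avg m (\<Sum>k<n. star (Y k i) * Y k j))" for m
    unfolding avg_def by (intro gram_pos_scaleR gram_pos_sum) auto
qed

end


section \<open>Density of the real line in the dual group\<close>

abbreviation expi :: "real \<Rightarrow> real \<Rightarrow> complex" where
  "expi t \<omega> \<equiv> exp (\<i> * of_real (t * \<omega>))"

text \<open>Parseval for trigonometric polynomials: the mean of \<open>(cmod (p t))^2\<close> over
  the sample points is at most \<open>B^2\<close>, and it tends to the sum of squares, since the
  products of distinct frequencies average out.\<close>

lemma mean_square_le:
  fixes c :: "real \<Rightarrow> complex"
  assumes "finite \<Xi>" and bound: "\<And>t. cmod (\<Sum>\<xi>\<in>\<Xi>. c \<xi> * expi t \<xi>) \<le> B"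
  shows "(\<Sum>\<xi>\<in>\<Xi>. (cmod (c \<xi>))\<^sup>2) \<le> B\<^sup>2"
proof -
  define p where "p = (\<lambda>t. \<Sum>\<xi>\<in>\<Xi>. c \<xi> * expi t \<xi>)"
  define M where "M = (\<lambda>m. \<Sum>\<xi>\<in>\<Xi>. \<Sum>\<eta>\<in>\<Xi>. c \<xi> * cnj (c \<eta>) * char_mean m (\<xi> - \<eta>))"
  have "M m = of_real ((\<Sum>k<(Suc m)\<^sup>2. (cmod (p (real k / real (Suc m))))\<^sup>2) / real ((Suc m)\<^sup>2))" for m
  proof -
    have sq: "of_real ((cmod (p t))\<^sup>2) = (\<Sum>\<xi>\<in>\<Xi>. \<Sum>\<eta>\<in>\<Xi>. c \<xi> * cnj (c \<eta>) * expi t (\<xi> - \<eta>))" for t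
    proof -
      have "of_real ((cmod (p t))\<^sup>2) = p t * cnj (p t)" by (rule complex_norm_square)
      also have "\<dots> = (\<Sum>\<xi>\<in>\<Xi>. \<Sum>\<eta>\<in>\<Xi>. (c \<xi> * expi t \<xi>) * cnj (c \<eta> * expi t \<eta>))"
        by (simp add: p_def sum_product)
      also have "\<dots> = (\<Sum>\<xi>\<in>\<Xi>. \<Sum>\<eta>\<in>\<Xi>. c \<xi> * cnj (c \<eta>) * expi t (\<xi> - \<eta>))"
        by (intro sum.cong refl)
           (simp add: exp_cnj right_diff_distrib exp_diff exp_minus field_simps)
      finally show ?thesis .
    qed
    have "of_real (\<Sum>k<(Suc m)\<^sup>2. (cmod (p (real k / real (Suc m))))\<^sup>2) =
        (\<Sum>k<(Suc m)\<^sup>2. \<Sum>\<xi>\<in>\<Xi>. \<Sum>\<eta>\<in>\<Xi>. c \<xi> * cnj (c \<eta>) * expi (real k / real (Suc m)) (\<xi> - \<eta>))"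
      unfolding of_real_sum sq ..
    also have "\<dots> = (\<Sum>\<xi>\<in>\<Xi>. \<Sum>k<(Suc m)\<^sup>2. \<Sum>\<eta>\<in>\<Xi>. c \<xi> * cnj (c \<eta>) * expi (real k / real (Suc m)) (\<xi> - \<eta>))"
      by (rule sum.swap)
    also have "\<dots> = (\<Sum>\<xi>\<in>\<Xi>. \<Sum>\<eta>\<in>\<Xi>. \<Sum>k<(Suc m)\<^sup>2. c \<xi> * cnj (c \<eta>) * expi (real k / real (Suc m)) (\<xi> - \<eta>))"
      by (rule sum.cong[OF refl]) (rule sum.swap)
    finally have sum_eq: "of_real (\<Sum>k<(Suc m)\<^sup>2. (cmod (p (real k / real (Suc m))))\<^sup>2) =
        (\<Sum>\<xi>\<in>\<Xi>. \<Sum>\<eta>\<in>\<Xi>. \<Sum>k<(Suc m)\<^sup>2. c \<xi> * cnj (c \<eta>) * expi (real k / real (Suc m)) (\<xi> - \<eta>))" .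
    show ?thesis
      unfolding of_real_divide sum_eq
      by (simp only: M_def char_mean_def of_real_of_nat_eq sum_divide_distrib
          sum_distrib_left times_divide_eq_right)
  qed note M = this
  have "M \<longlonglongrightarrow> (\<Sum>\<xi>\<in>\<Xi>. \<Sum>\<eta>\<in>\<Xi>. c \<xi> * cnj (c \<eta>) * (if \<xi> - \<eta> = 0 then 1 else 0))"
    unfolding M_def by (intro tendsto_intros char_mean_tendsto)
  also have "(\<Sum>\<xi>\<in>\<Xi>. \<Sum>\<eta>\<in>\<Xi>. c \<xi> * cnj (c \<eta>) * (if \<xi> - \<eta> = 0 then 1 else 0)) =
      of_real (\<Sum>\<xi>\<in>\<Xi>. (cmod (c \<xi>))\<^sup>2)"
    using assms(1) by (simp add: if_distrib[of "\<lambda>x. _ * x"] complex_norm_square del: of_real_power cong: if_cong)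
  finally have "(\<lambda>m. Re (M m)) \<longlonglongrightarrow> (\<Sum>\<xi>\<in>\<Xi>. (cmod (c \<xi>))\<^sup>2)"
    using tendsto_Re by fastforce
  moreover have "Re (M m) \<le> B\<^sup>2" for m
  proof -
    have "(\<Sum>k<(Suc m)\<^sup>2. (cmod (p (real k / real (Suc m))))\<^sup>2) \<le> (\<Sum>k<(Suc m)\<^sup>2. B\<^sup>2)"
      unfolding p_def by (intro sum_mono power_mono bound norm_ge_zero)
    then have "(\<Sum>k<(Suc m)\<^sup>2. (cmod (p (real k / real (Suc m))))\<^sup>2) \<le> B\<^sup>2 * real ((Suc m)\<^sup>2)"
      by (simp add: mult.commute del: of_nat_Suc of_nat_power)
    then show ?thesis
      unfolding M Re_complex_of_real by (simp add: divide_le_eq del: of_nat_Suc of_nat_power)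
  qed
  ultimately show ?thesis by (intro LIMSEQ_le_const2) auto
qed

text \<open>The frequencies occurring in the \<open>k\<close>-th power of a trigonometric polynomial with
  frequencies in \<open>X\<close>, and the number of ways in which each of them arises.\<close>

definition power_freqs :: "real set \<Rightarrow> nat \<Rightarrow> real set" where
  "power_freqs X k = (\<lambda>m. \<Sum>x\<in>X. real (m x) * x) ` (PiE X (\<lambda>_. {..k}))"

primrec power_count :: "real set \<Rightarrow> nat \<Rightarrow> real \<Rightarrow> real" where
  "power_count X 0 = (\<lambda>\<xi>. if \<xi> = 0 then 1 else 0)"
| "power_count X (Suc k) = (\<lambda>\<xi>. \<Sum>x\<in>X. power_count X k (\<xi> - x))"

lemma finite_power_freqs: "finite X \<Longrightarrow> finite (power_freqs X k)"
  by (simp add: power_freqs_def finite_PiE)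

text \<open>Every frequency of \<open>X\<close> has a multiplicity between 0 and \<open>k\<close>.
  That the multiplicities add up to \<open>k\<close> is not imposed in \<open>power_freqs\<close>;
  the bound is polynomial in \<open>k\<close> all the same.\<close>

lemma card_power_freqs: "finite X \<Longrightarrow> card (power_freqs X k) \<le> Suc k ^ card X"
  using card_image_le[of "PiE X (\<lambda>_. {..k})"] by (simp add: power_freqs_def finite_PiE card_PiE)

lemma power_freqs_0: "power_freqs X 0 = {0}"
proof -
  have "(\<Sum>x\<in>X. real (m x) * x) = 0" if "m \<in> PiE X (\<lambda>_. {..0})" for m
    using that by (intro sum.neutral) (auto simp: PiE_iff)
  moreover have "PiE X (\<lambda>_. {..0::nat}) \<noteq> {}" by (auto simp: PiE_eq_empty_iff)
  ultimately show ?thesis unfolding power_freqs_def by (intro image_eqI equalityI subsetI) (auto simp: image_iff)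
qed

lemma power_freqs_Suc:
  assumes "finite X" "\<xi> \<in> power_freqs X k" "x \<in> X"
  shows "\<xi> + x \<in> power_freqs X (Suc k)"
proof -
  from assms obtain m where m: "m \<in> PiE X (\<lambda>_. {..k})" "\<xi> = (\<Sum>y\<in>X. real (m y) * y)"
    by (auto simp: power_freqs_def)
  let ?m = "m(x := Suc (m x))"
  have mem: "?m \<in> PiE X (\<lambda>_. {..Suc k})"
    using m(1) assms(3) by (auto simp: PiE_iff extensional_def le_SucI)
  have sum: "(\<Sum>y\<in>X. real (?m y) * y) = \<xi> + x"
  proof -
    have "(\<Sum>y\<in>X. real (?m y) * y) = (\<Sum>y\<in>X. real (m y) * y + (if y = x then x else 0))"
      by (intro sum.cong) (auto simp: algebra_simps)
    then show ?thesis using assms by (simp add: sum.distrib m)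
  qed
  show ?thesis unfolding power_freqs_def 
    by (rule image_eqI[where x = ?m], rule sum[symmetric], rule mem)
qed

lemma power_count_eq_0: "finite X \<Longrightarrow> \<xi> \<notin> power_freqs X k \<Longrightarrow> power_count X k \<xi> = 0"
proof (induction k arbitrary: \<xi>)
  case (Suc k)
  have "power_count X k (\<xi> - x) = 0" if "x \<in> X" for x
    using Suc power_freqs_Suc[OF Suc(2) _ that, of "\<xi> - x"] by auto
  then show ?case by simp
qed (simp add: power_freqs_0)

text \<open>Substituting \<open>\<zeta> = \<xi> + x\<close> shifts the sum; frequencies not of this
  form contribute zero. The weight \<open>g\<close> is 1 when the ways are counted, and a conjugate
  character times an exponential when a power is expanded.\<close>

lemma sum_power_count_Suc:
  fixes g :: "real \<Rightarrow> 'b::real_algebra_1"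
  assumes X: "finite X"
  shows "(\<Sum>\<zeta>\<in>power_freqs X (Suc k). of_real (power_count X (Suc k) \<zeta>) * g \<zeta>) =
    (\<Sum>x\<in>X. \<Sum>\<xi>\<in>power_freqs X k. of_real (power_count X k \<xi>) * g (\<xi> + x))"
proof -
  have "(\<Sum>\<zeta>\<in>power_freqs X (Suc k). of_real (power_count X (Suc k) \<zeta>) * g \<zeta>) =
      (\<Sum>x\<in>X. \<Sum>\<zeta>\<in>power_freqs X (Suc k). of_real (power_count X k (\<zeta> - x)) * g \<zeta>)"
    by (simp add: sum_distrib_right) (rule sum.swap)
  also have "\<dots> = (\<Sum>x\<in>X. \<Sum>\<xi>\<in>power_freqs X k. of_real (power_count X k \<xi>) * g (\<xi> + x))"
  proof (rule sum.cong[OF refl])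
    fix x assume x: "x \<in> X"
    have "(\<Sum>\<zeta>\<in>power_freqs X (Suc k). of_real (power_count X k (\<zeta> - x)) * g \<zeta>) =
        (\<Sum>\<zeta>\<in>(\<lambda>\<xi>. \<xi> + x) ` power_freqs X k. of_real (power_count X k (\<zeta> - x)) * g \<zeta>)"
    proof (rule sum.mono_neutral_right)
      show "\<forall>\<zeta>\<in>power_freqs X (Suc k) - (\<lambda>\<xi>. \<xi> + x) ` power_freqs X k.
          of_real (power_count X k (\<zeta> - x)) * g \<zeta> = 0"
      proof
        fix \<zeta> assume "\<zeta> \<in> power_freqs X (Suc k) - (\<lambda>\<xi>. \<xi> + x) ` power_freqs X k"
        then have "\<zeta> - x \<notin> power_freqs X k" by (force simp: image_iff)
        then show "of_real (power_count X k (\<zeta> - x)) * g \<zeta> = 0"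
          by (simp add: power_count_eq_0[OF X])
      qed
    qed (use X x finite_power_freqs power_freqs_Suc in auto)
    also have "\<dots> = (\<Sum>\<xi>\<in>power_freqs X k. of_real (power_count X k \<xi>) * g (\<xi> + x))"
      by (subst sum.reindex) (auto simp: inj_on_def)
    finally show "(\<Sum>\<zeta>\<in>power_freqs X (Suc k). of_real (power_count X k (\<zeta> - x)) * g \<zeta>) =
        (\<Sum>\<xi>\<in>power_freqs X k. of_real (power_count X k \<xi>) * g (\<xi> + x))" .
  qed
  finally show ?thesis .
qed

lemma sum_power_count: "finite X \<Longrightarrow> (\<Sum>\<xi>\<in>power_freqs X k. power_count X k \<xi>) = real (card X) ^ k"
proof (induction k)
  case (Suc k)
  then show ?case using sum_power_count_Suc[of X k "\<lambda>_. 1 :: real"] by simp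
qed (simp add: power_freqs_0)

text \<open>If \<open>S < n\<close>, then \<open>r = (S / n)^2 < 1\<close>, and
  \<open>(k + 1)^d * r^k\<close> would stay at least 1 while tending to zero.\<close>

lemma power_le_poly_imp_le:
  fixes S n :: real
  assumes "\<And>k::nat. (n ^ k)\<^sup>2 \<le> real (Suc k) ^ d * (S ^ k)\<^sup>2" "0 \<le> S" "0 \<le> n"
  shows "n \<le> S"
proof (rule ccontr)
  assume "\<not> n \<le> S"
  then have n: "0 < n" "S < n" using assms by auto
  define r where "r = (S / n)\<^sup>2"
  have r: "0 \<le> r" "r < 1"
    using n assms by (auto simp: r_def power_divide power2_eq_square field_simps intro!: mult_strict_mono)
  \<comment> \<open>With a root of order \<open>d + 1\<close>, available also for
    \<open>d = 0\<close>, the quantity is dominated by a power of \<open>(k + 1) * q^k\<close>,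
    where only a linear factor competes with a geometric one.\<close>
  define q where "q = root (Suc d) r"
  have q: "0 \<le> q" "q < 1" "q ^ Suc d = r"
    using r by (auto simp: q_def real_root_pow_pos2 simp del: power_Suc)
  have "(\<lambda>k. real k * q ^ k + q ^ k) \<longlonglongrightarrow> 0 + 0"
    using q powser_times_n_limit_0[of q] by (intro tendsto_add LIMSEQ_realpow_zero) auto
  then have "(\<lambda>k. (real (Suc k) * q ^ k) ^ Suc d) \<longlonglongrightarrow> 0 ^ Suc d"
    by (intro tendsto_power) (simp add: algebra_simps)
  then have "(\<lambda>k. (real (Suc k) * q ^ k) ^ Suc d) \<longlonglongrightarrow> 0"
    by (simp only: power_Suc mult_zero_left)
  from order_tendstoD(2)[OF this, of 1]
  have "eventually (\<lambda>k. (real (Suc k) * q ^ k) ^ Suc d < 1) sequentially"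
    by (simp only: zero_less_one simp_thms)
  then obtain k where k: "(real (Suc k) * q ^ k) ^ Suc d < 1"
    using eventually_happens'[OF sequentially_bot] by blast
  have "(real (Suc k) * q ^ k) ^ Suc d = real (Suc k) ^ Suc d * r ^ k"
    by (simp only: power_mult_distrib q(3)[symmetric] flip: power_mult) (simp only: mult.commute)
  moreover have "real (Suc k) ^ d \<le> real (Suc k) ^ Suc d"
    by (intro power_increasing) auto
  then have "real (Suc k) ^ d * r ^ k \<le> real (Suc k) ^ Suc d * r ^ k"
    using r by (intro mult_right_mono) auto
  ultimately have "real (Suc k) ^ d * r ^ k < 1" using k by linarith
  moreover have "r ^ k = (S ^ k)\<^sup>2 / (n ^ k)\<^sup>2"
    by (simp add: r_def power_divide flip: power_mult) (simp add: mult.commute)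
  ultimately have "real (Suc k) ^ d * (S ^ k)\<^sup>2 < (n ^ k)\<^sup>2"
    using n by (simp add: field_simps)
  with assms(1)[of k] show False by simp
qed

section \<open>Kronecker approximation of characters\<close>

locale real_character =
  fixes \<Gamma> :: "real set" and \<gamma> :: "real \<Rightarrow> complex"
  assumes zero_mem: "0 \<in> \<Gamma>" and add_mem: "x \<in> \<Gamma> \<Longrightarrow> y \<in> \<Gamma> \<Longrightarrow> x + y \<in> \<Gamma>"
    and cmod_char: "x \<in> \<Gamma> \<Longrightarrow> cmod (\<gamma> x) = 1"
    and char_add: "x \<in> \<Gamma> \<Longrightarrow> y \<in> \<Gamma> \<Longrightarrow> \<gamma> (x + y) = \<gamma> x * \<gamma> y"
begin

lemma char_zero: "\<gamma> 0 = 1"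
  using char_add[OF zero_mem zero_mem] cmod_char[OF zero_mem] by auto

lemma power_freqs_subset:
  assumes "X \<subseteq> \<Gamma>"
  shows "power_freqs X k \<subseteq> \<Gamma>"
proof -
  have mult: "real n * x \<in> \<Gamma>" if "x \<in> \<Gamma>" for n x
    using that by (induction n) (auto simp: zero_mem distrib_right add_mem add.commute)
  have "(\<Sum>x\<in>Y. real (m x) * x) \<in> \<Gamma>" if "Y \<subseteq> X" for Y and m :: "real \<Rightarrow> nat"
    using that assms by (induction Y rule: infinite_finite_induct) (auto simp: zero_mem intro!: add_mem mult)
  then show ?thesis by (auto simp: power_freqs_def)
qed

text \<open>By multiplicativity of \<open>\<gamma>\<close>, all products of coefficients that land
  on one frequency \<open>\<xi>\<close> are equal to \<open>cnj (\<gamma> \<xi>)\<close>. They add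
  up without cancellation, to the number of ways.\<close>

lemma power_trig_poly:
  assumes X: "finite X" "X \<subseteq> \<Gamma>"
  shows "(\<Sum>x\<in>X. cnj (\<gamma> x) * expi t x) ^ k =
    (\<Sum>\<xi>\<in>power_freqs X k. of_real (power_count X k \<xi>) * cnj (\<gamma> \<xi>) * expi t \<xi>)"
proof (induction k)
  case 0
  then show ?case by (simp add: power_freqs_0 char_zero)
next
  case (Suc k)
  have "(\<Sum>\<xi>\<in>power_freqs X (Suc k). of_real (power_count X (Suc k) \<xi>) * (cnj (\<gamma> \<xi>) * expi t \<xi>)) =
    (\<Sum>x\<in>X. \<Sum>\<xi>\<in>power_freqs X k. of_real (power_count X k \<xi>) * (cnj (\<gamma> (\<xi> + x)) * expi t (\<xi> + x)))"
    by (rule sum_power_count_Suc[OF X(1)])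
  also have "\<dots> = (\<Sum>x\<in>X. \<Sum>\<xi>\<in>power_freqs X k. (cnj (\<gamma> x) * expi t x) *
      (of_real (power_count X k \<xi>) * cnj (\<gamma> \<xi>) * expi t \<xi>))"
  proof (intro sum.cong refl)
    fix x \<xi> assume "x \<in> X" "\<xi> \<in> power_freqs X k"
    then have "\<gamma> (\<xi> + x) = \<gamma> \<xi> * \<gamma> x"
      using X(2) power_freqs_subset[OF X(2)] by (intro char_add) auto
    then show "of_real (power_count X k \<xi>) * (cnj (\<gamma> (\<xi> + x)) * expi t (\<xi> + x)) =
        (cnj (\<gamma> x) * expi t x) * (of_real (power_count X k \<xi>) * cnj (\<gamma> \<xi>) * expi t \<xi>)"
      by (simp add: distrib_left exp_add)
  qed
  also have "\<dots> = (\<Sum>x\<in>X. cnj (\<gamma> x) * expi t x) *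
      (\<Sum>\<xi>\<in>power_freqs X k. of_real (power_count X k \<xi>) * cnj (\<gamma> \<xi>) * expi t \<xi>)"
    by (rule sum_product[symmetric])
  finally show ?case by (simp only: power_Suc Suc mult.assoc)
qed

text \<open>Bohr's proof of Kronecker's theorem: if a trigonometric polynomial with unimodular
  coefficients stayed away from the sum of their moduli, its powers would contradict the
  Cauchy-Schwarz inequality, the number of their frequencies growing only polynomially.\<close>

lemma card_le_trig_poly_bound:
  assumes X: "finite X" "X \<subseteq> \<Gamma>" and bound: "\<And>t. cmod (\<Sum>x\<in>X. cnj (\<gamma> x) * expi t x) \<le> S"
  shows "real (card X) \<le> S"
proof (rule power_le_poly_imp_le)
  show S: "0 \<le> S" using bound[of 0] norm_ge_zero order_trans by blast
  fix k
  let ?\<Xi> = "power_freqs X k" and ?N = "power_count X k"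
  have "(\<Sum>\<xi>\<in>?\<Xi>. (cmod (of_real (?N \<xi>) * cnj (\<gamma> \<xi>)))\<^sup>2) \<le> (S ^ k)\<^sup>2"
  proof (rule mean_square_le[OF finite_power_freqs[OF X(1)]])
    show "cmod (\<Sum>\<xi>\<in>?\<Xi>. of_real (?N \<xi>) * cnj (\<gamma> \<xi>) * expi t \<xi>) \<le> S ^ k" for t
      unfolding power_trig_poly[OF X, symmetric] norm_power
      by (intro power_mono bound) simp
  qed
  moreover have "(cmod (of_real (?N \<xi>) * cnj (\<gamma> \<xi>)))\<^sup>2 = (?N \<xi>)\<^sup>2" if "\<xi> \<in> ?\<Xi>" for \<xi>
    using cmod_char[of \<xi>] power_freqs_subset[OF X(2), of k] that by (auto simp: norm_mult)
  ultimately have sq: "(\<Sum>\<xi>\<in>?\<Xi>. (?N \<xi>)\<^sup>2) \<le> (S ^ k)\<^sup>2" by simp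
  have "(real (card X) ^ k)\<^sup>2 = (\<Sum>\<xi>\<in>?\<Xi>. ?N \<xi>)\<^sup>2" by (simp add: sum_power_count X)
  also have "\<dots> \<le> (\<Sum>\<xi>\<in>?\<Xi>. (?N \<xi>)\<^sup>2) * real (card ?\<Xi>)" by (rule sum_squared_le_sum_of_squares)
  also have "\<dots> \<le> (S ^ k)\<^sup>2 * real (Suc k ^ card X)"
    using sq card_power_freqs[OF X(1), of k]
    by (intro mult_mono sum_nonneg) (auto simp del: of_nat_power of_nat_Suc)
  finally show "(real (card X) ^ k)\<^sup>2 \<le> real (Suc k) ^ card X * (S ^ k)\<^sup>2"
    by (simp add: mult.commute)
qed simp

text \<open>By \<open>card_le_trig_poly_bound\<close> some \<open>t\<close> brings the modulus of
  the sum within \<open>d\<close> of its maximum \<open>card Y\<close>. Then all terms nearly point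
  in one direction, and the frequency 0 added to \<open>X\<close> fixes that direction, its term
  being 1.\<close>

lemma character_approx:
  assumes X: "finite X" "X \<subseteq> \<Gamma>" and e: "0 < e"
  shows "\<exists>t. \<forall>x\<in>X. cmod (expi t x - \<gamma> x) < e"
proof -
  define Y where "Y = insert 0 X"
  have Y: "finite Y" "Y \<subseteq> \<Gamma>" "0 \<in> Y" using X zero_mem by (auto simp: Y_def)
  \<comment> \<open>By the parallelogram law
    \<open>(cmod (u x - 1))^2 < 4 - (2 - d)^2 = 4 * d - d^2\<close>, so
    \<open>4 * d \<le> e^2\<close> is enough; \<open>d \<le> 1\<close> keeps \<open>2 - d\<close>
    positive for squaring.\<close>
  define d where "d = min 1 (e\<^sup>2 / 4)"
  have d: "0 < d" "d \<le> 1" "4 * d \<le> e\<^sup>2" using e by (auto simp: d_def)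
  have "\<exists>t. cmod (\<Sum>x\<in>Y. cnj (\<gamma> x) * expi t x) > real (card Y) - d"
  proof (rule ccontr)
    assume "\<not> ?thesis"
    then have "cmod (\<Sum>x\<in>Y. cnj (\<gamma> x) * expi t x) \<le> real (card Y) - d" for t
      by (meson not_le)
    from card_le_trig_poly_bound[OF Y(1,2) this] d(1) show False by simp
  qed
  then obtain t where t: "cmod (\<Sum>x\<in>Y. cnj (\<gamma> x) * expi t x) > real (card Y) - d" ..
  define u where "u = (\<lambda>x. cnj (\<gamma> x) * expi t x)"
  have u1: "cmod (u x) = 1" if "x \<in> Y" for x
    using that Y cmod_char[of x] by (auto simp: u_def norm_mult)
  have u0: "u 0 = 1" by (simp add: u_def char_zero)
  have "cmod (expi t x - \<gamma> x) < e" if x: "x \<in> Y" for x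
  proof (cases "x = 0")
    case True
    then show ?thesis using e char_zero by simp
  next
    case False
    have "(\<Sum>y\<in>Y. u y) = (\<Sum>y\<in>Y - {0, x}. u y) + (\<Sum>y\<in>{0, x}. u y)"
      using Y x by (intro sum.subset_diff) auto
    also have "(\<Sum>y\<in>{0, x}. u y) = 1 + u x" using False u0 by simp
    finally have "cmod (\<Sum>y\<in>Y. u y) \<le> cmod (\<Sum>y\<in>Y - {0, x}. u y) + cmod (1 + u x)"
      by (simp add: norm_triangle_ineq)
    also have "cmod (\<Sum>y\<in>Y - {0, x}. u y) \<le> (\<Sum>y\<in>Y - {0, x}. 1)"
      using u1 by (intro sum_norm_le) auto
    also have "\<dots> = real (card Y) - 2"
    proof -
      have "card {0, x} \<le> card Y" using Y x by (intro card_mono) auto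
      then show ?thesis using Y x False by (simp add: card_Diff_subset of_nat_diff)
    qed
    finally have "2 - d < cmod (1 + u x)" using t by (simp add: u_def)
    then have "(2 - d)\<^sup>2 < (cmod (1 + u x))\<^sup>2" using d by (intro power_strict_mono) auto
    moreover have "(cmod (1 + u x))\<^sup>2 + (cmod (u x - 1))\<^sup>2 = 2 + 2 * (cmod (u x))\<^sup>2"
      unfolding cmod_power2 by (simp add: power2_eq_square algebra_simps)
    ultimately have "(cmod (u x - 1))\<^sup>2 < 4 * d - d\<^sup>2"
      using u1[OF x] by (simp add: power2_eq_square algebra_simps)
    then have "(cmod (u x - 1))\<^sup>2 < e\<^sup>2" using d(3) zero_le_power2[of d] by linarith
    then have "cmod (u x - 1) < e" using e power2_less_imp_less by fastforce
    moreover have "expi t x - \<gamma> x = \<gamma> x * (u x - 1)"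
    proof -
      have "\<gamma> x * cnj (\<gamma> x) = 1"
        using cmod_char[of x] x Y by (simp flip: complex_norm_square add: subsetD)
      then have "\<gamma> x * u x = expi t x" by (simp add: u_def flip: mult.assoc)
      then show ?thesis by (simp add: right_diff_distrib)
    qed
    ultimately show ?thesis using cmod_char[of x] x Y by (simp add: norm_mult subsetD)
  qed
  then show ?thesis by (auto simp: Y_def)
qed

end

text \<open>A basic neighbourhood of \<open>\<gamma>\<close> restricts finitely many coordinates; on
  those in \<open>\<Gamma>\<close> Kronecker approximation applies, and elsewhere both functions are
  0. Without this density the limit in \<open>dual_action\<close> would be taken along a trivial
  filter.\<close>

lemma dual_embedding_filter_neq_bot:
  assumes \<Gamma>: "0 \<in> \<Gamma>" "\<And>x y. x \<in> \<Gamma> \<Longrightarrow> y \<in> \<Gamma> \<Longrightarrow> x + y \<in> \<Gamma>" and \<gamma>: "\<gamma> \<in> dual_group \<Gamma>"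
  shows "filtercomap (dual_embedding \<Gamma>) (nhds \<gamma>) \<noteq> bot"
proof (rule filtercomap_neq_bot)
  interpret real_character \<Gamma> \<gamma>
    using assms by unfold_locales (auto simp: dual_group_def)
  fix P assume "eventually P (nhds \<gamma>)"
  then obtain U where U: "open U" "\<gamma> \<in> U" "\<And>\<eta>. \<eta> \<in> U \<Longrightarrow> P \<eta>"
    by (auto simp: eventually_nhds)
  from U(1) have "openin (product_topology (\<lambda>i. euclidean) UNIV) U" by (simp add: open_fun_def)
  from product_topology_open_contains_basis[OF this U(2)]
  obtain V where V: "\<gamma> \<in> (\<Pi>\<^sub>E i\<in>UNIV. V i)" "\<And>i. open (V i)" "finite {i. V i \<noteq> UNIV}"
    "(\<Pi>\<^sub>E i\<in>UNIV. V i) \<subseteq> U" by auto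
  define X where "X = {i. V i \<noteq> UNIV} \<inter> \<Gamma>"
  have "\<forall>x. \<exists>e>0. ball (\<gamma> x) e \<subseteq> V x"
    using V(1,2) open_contains_ball by (metis PiE_E UNIV_I)
  then obtain e where e: "\<And>x. e x > 0" "\<And>x. ball (\<gamma> x) (e x) \<subseteq> V x" by metis
  define d where "d = Min (insert 1 (e ` X))"
  have "finite X" "X \<subseteq> \<Gamma>" using V(3) by (auto simp: X_def)
  have "0 < d" "\<And>x. x \<in> X \<Longrightarrow> d \<le> e x" using \<open>finite X\<close> e(1) by (auto simp: d_def)
  obtain t where t: "\<And>x. x \<in> X \<Longrightarrow> cmod (expi t x - \<gamma> x) < d"
    using character_approx[OF \<open>finite X\<close> \<open>X \<subseteq> \<Gamma>\<close> \<open>0 < d\<close>] by blast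
  have "dual_embedding \<Gamma> t x \<in> V x" for x
  proof (cases "x \<in> \<Gamma>")
    case False
    then have "dual_embedding \<Gamma> t x = \<gamma> x" using \<gamma> by (simp add: dual_embedding_def dual_group_def)
    then show ?thesis using V(1) by auto
  next
    case True
    show ?thesis
    proof (cases "x \<in> X")
      case True
      then have "dual_embedding \<Gamma> t x \<in> ball (\<gamma> x) (e x)"
        using t[of x] \<open>x \<in> X \<Longrightarrow> d \<le> e x\<close> \<open>x \<in> \<Gamma>\<close>
        by (simp add: dual_embedding_def dist_norm norm_minus_commute)
      then show ?thesis using e(2) by blast
    qed (use True in \<open>auto simp: X_def\<close>)
  qed
  then have "dual_embedding \<Gamma> t \<in> U" using V(4) by auto
  then show "\<exists>t. P (dual_embedding \<Gamma> t)" using U(3) by blast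
qed

section \<open>The action of the dual group and the continuity of its orbits\<close>

context almost_periodic_dynamics
begin

abbreviation "\<Gamma> \<equiv> frequency_group \<sigma>"

lemma Gamma_zero: "0 \<in> \<Gamma>" and Gamma_add: "x \<in> \<Gamma> \<Longrightarrow> y \<in> \<Gamma> \<Longrightarrow> x + y \<in> \<Gamma>"
  by (auto simp: frequency_group_def group_closure_add)

lemma spectral_nonzero_Gamma: "a \<in> A \<omega> \<Longrightarrow> a \<noteq> 0 \<Longrightarrow> \<omega> \<in> \<Gamma>"
  unfolding frequency_group_def by (rule group_closure.base) auto

lemma dual_embedding_in_dual_group: "dual_embedding \<Gamma> t \<in> dual_group \<Gamma>"
  by (auto simp: dual_group_def dual_embedding_def Gamma_add distrib_left exp_add)

abbreviation "dual_filter \<gamma> \<equiv> filtercomap (dual_embedding \<Gamma>) (nhds \<gamma>)"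

lemma dual_filter_neq_bot: "\<gamma> \<in> dual_group \<Gamma> \<Longrightarrow> dual_filter \<gamma> \<noteq> bot"
  by (rule dual_embedding_filter_neq_bot[OF Gamma_zero Gamma_add])

text \<open>Convergence to \<open>\<gamma>\<close> includes convergence of the coordinate at
  \<open>\<omega>\<close>, and for \<open>\<omega>\<close> in \<open>\<Gamma>\<close> that
  coordinate is the eigenvalue of \<open>\<sigma> t\<close>. A frequency outside
  \<open>\<Gamma>\<close> belongs to \<open>a = 0\<close> only.\<close>

lemma spectral_dual_tendsto:
  assumes "a \<in> A \<omega>"
  shows "((\<lambda>t. \<sigma> t a) \<longlongrightarrow> \<gamma> \<omega> *\<^sub>C a) (dual_filter \<gamma>)"
proof (cases "a = 0")
  case True
  then show ?thesis using sigma_scaleC[of _ 0 0] by simp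
next
  case False
  then have \<omega>: "\<omega> \<in> \<Gamma>" using assms spectral_nonzero_Gamma by blast
  have "((\<lambda>\<eta>. \<eta> \<omega>) \<longlongrightarrow> \<gamma> \<omega>) (nhds \<gamma>)"
    using continuous_on_product_coordinates[of \<omega>] tendsto_at_iff_tendsto_nhds
    by (auto simp: continuous_on_def)
  then have "((\<lambda>t. dual_embedding \<Gamma> t \<omega>) \<longlongrightarrow> \<gamma> \<omega>) (dual_filter \<gamma>)"
    by (rule filterlim_compose) (rule filterlim_filtercomap)
  then have "((\<lambda>t. expi t \<omega> *\<^sub>C a) \<longlongrightarrow> \<gamma> \<omega> *\<^sub>C a) (dual_filter \<gamma>)"
    using \<omega> by (intro tendsto_intros) (simp add: dual_embedding_def)
  then show ?thesis by (simp add: sigma_spectral[OF assms])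
qed

lemma dual_action_tendsto:
  assumes "\<gamma> \<in> dual_group \<Gamma>"
  shows "((\<lambda>t. \<sigma> t a) \<longlongrightarrow> dual_action \<sigma> \<gamma> a) (dual_filter \<gamma>)"
proof -
  note F = dual_filter_neq_bot[OF assms]
  have "\<exists>l. ((\<lambda>t. \<sigma> t a) \<longlongrightarrow> l) (dual_filter \<gamma>)"
  proof (induction a rule: spectral_induct)
    case (spectral \<omega> x)
    then show ?case using spectral_dual_tendsto by blast
  next
    case (add x y)
    then show ?case unfolding sigma_add using tendsto_add by blast
  next
    case (limit f l)
    show ?case
      by (rule contractions_limit_exists[OF F sigma_add _ limit]) simp
  qed
  then show ?thesis
    unfolding dual_action_def using tendsto_Lim[OF F] by metis
qed

lemma dual_action_unique:
  "\<gamma> \<in> dual_group \<Gamma> \<Longrightarrow> ((\<lambda>t. \<sigma> t a) \<longlongrightarrow> l) (dual_filter \<gamma>) \<Longrightarrow> dual_action \<sigma> \<gamma> a = l"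
  using tendsto_unique[OF dual_filter_neq_bot] dual_action_tendsto by blast

lemma dual_action_add:
  "\<gamma> \<in> dual_group \<Gamma> \<Longrightarrow> dual_action \<sigma> \<gamma> (a + b) = dual_action \<sigma> \<gamma> a + dual_action \<sigma> \<gamma> b"
  by (rule dual_action_unique) (auto simp: sigma_add intro!: tendsto_add dual_action_tendsto)

lemma dual_action_spectral:
  "\<gamma> \<in> dual_group \<Gamma> \<Longrightarrow> a \<in> A \<omega> \<Longrightarrow> dual_action \<sigma> \<gamma> a = \<gamma> \<omega> *\<^sub>C a"
  by (rule dual_action_unique) (auto intro: spectral_dual_tendsto)

lemma norm_dual_action_diff_le:
  assumes "\<gamma> \<in> dual_group \<Gamma>"
  shows "norm (dual_action \<sigma> \<gamma> a - dual_action \<sigma> \<gamma> b) \<le> norm (a - b)"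
  by (rule Lim_norm_ubound[OF dual_filter_neq_bot[OF assms]
        tendsto_diff[OF dual_action_tendsto[OF assms] dual_action_tendsto[OF assms]]])
     (simp flip: sigma_diff)

text \<open>The dual action is contractive for every character alike. Continuity and integrals of
  orbits can therefore be obtained from spectral elements.\<close>

lemma uniform_limit_dual_action:
  assumes "f \<longlonglongrightarrow> l"
  shows "uniform_limit (dual_group \<Gamma>) (\<lambda>n \<gamma>. dual_action \<sigma> \<gamma> (f n)) (\<lambda>\<gamma>. dual_action \<sigma> \<gamma> l) sequentially"
proof (rule uniform_limitI)
  fix e :: real assume "e > 0"
  from tendstoD[OF assms this]
  show "\<forall>\<^sub>F n in sequentially. \<forall>\<gamma>\<in>dual_group \<Gamma>. dist (dual_action \<sigma> \<gamma> (f n)) (dual_action \<sigma> \<gamma> l) < e"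
    by eventually_elim (auto simp: dist_norm intro: le_less_trans[OF norm_dual_action_diff_le])
qed

lemma continuous_dual_action: "continuous_on (dual_group \<Gamma>) (\<lambda>\<gamma>. dual_action \<sigma> \<gamma> a)"
proof (induction a rule: spectral_induct)
  case (spectral \<omega> x)
  have "continuous_on (dual_group \<Gamma>) (\<lambda>\<gamma>. \<gamma> \<omega> *\<^sub>C x)"
    by (intro continuous_intros continuous_on_subset[OF continuous_on_product_coordinates]) auto
  then show ?case
    using dual_action_spectral[OF _ spectral] by (simp cong: continuous_on_cong)
next
  case (add x y)
  then have "continuous_on (dual_group \<Gamma>) (\<lambda>\<gamma>. dual_action \<sigma> \<gamma> x + dual_action \<sigma> \<gamma> y)"
    by (intro continuous_intros)
  then show ?case by (simp add: dual_action_add cong: continuous_on_cong)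
next
  case (limit f l)
  show ?case
    by (rule uniform_limit_theorem[OF _ uniform_limit_dual_action[OF limit(2)]])
       (auto simp: limit(1))
qed

end


section \<open>The conditional expectation as an integral\<close>

abbreviation "sb_integrable \<equiv> Bochner_Integration.simple_bochner_integrable"
abbreviation "sb_integral \<equiv> Bochner_Integration.simple_bochner_integral"

text \<open>The condition of \<open>has_vector_integral\<close> with one simple function for each
  \<open>e\<close> in place of a sequence; sums and uniform limits are easier to treat in this
  form.\<close>

definition simple_approx :: "'m measure \<Rightarrow> ('m \<Rightarrow> 'a::banach) \<Rightarrow> 'a \<Rightarrow> bool" where
  "simple_approx M f v \<longleftrightarrow> (\<forall>e>0. \<exists>s. sb_integrable M s \<and>
    (\<integral>\<^sup>+x. norm (f x - s x) \<partial>M) < ennreal e \<and>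
    norm (sb_integral M s - v) < e)"

lemma has_vector_integral_iff_simple_approx:
  "has_vector_integral M f v \<longleftrightarrow> f \<in> borel_measurable M \<and> simple_approx M f v"
proof -
  have "simple_approx M f v"
    if s: "\<And>i::nat. sb_integrable M (s i)"
      "(\<lambda>i. \<integral>\<^sup>+x. norm (f x - s i x) \<partial>M) \<longlonglongrightarrow> 0"
      "(\<lambda>i. sb_integral M (s i)) \<longlonglongrightarrow> v" for s
    unfolding simple_approx_def
  proof (intro allI impI)
    fix e :: real assume "0 < e"
    then have "eventually (\<lambda>i. (\<integral>\<^sup>+x. norm (f x - s i x) \<partial>M) < ennreal e) sequentially"
      using order_tendstoD(2)[OF s(2)] by simp
    moreover have "eventually (\<lambda>i. norm (sb_integral M (s i) - v) < e) sequentially"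
      using tendstoD[OF s(3) \<open>0 < e\<close>] by (simp add: dist_norm)
    ultimately have "eventually (\<lambda>i. (\<integral>\<^sup>+x. norm (f x - s i x) \<partial>M) < ennreal e \<and>
        norm (sb_integral M (s i) - v) < e) sequentially"
      by (rule eventually_conj)
    then obtain i where "(\<integral>\<^sup>+x. norm (f x - s i x) \<partial>M) < ennreal e"
        "norm (sb_integral M (s i) - v) < e"
      using eventually_happens'[OF sequentially_bot] by blast
    with s(1) show "\<exists>s. sb_integrable M s \<and>
        (\<integral>\<^sup>+x. norm (f x - s x) \<partial>M) < ennreal e \<and>
        norm (sb_integral M s - v) < e" by blast
  qed
  moreover have "\<exists>s. (\<forall>i::nat. sb_integrable M (s i)) \<and>
      (\<lambda>i. \<integral>\<^sup>+x. norm (f x - s i x) \<partial>M) \<longlonglongrightarrow> 0 \<and>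
      (\<lambda>i. sb_integral M (s i)) \<longlonglongrightarrow> v"
    if approx: "simple_approx M f v"
  proof -
    let ?e = "\<lambda>i. inverse (real (Suc i))"
    have "\<forall>i. \<exists>s. sb_integrable M s \<and>
        (\<integral>\<^sup>+x. norm (f x - s x) \<partial>M) < ennreal (?e i) \<and>
        norm (sb_integral M s - v) < ?e i"
      using approx by (simp add: simple_approx_def del: of_nat_Suc)
    then obtain s where s: "\<And>i. sb_integrable M (s i)"
        "\<And>i. (\<integral>\<^sup>+x. norm (f x - s i x) \<partial>M) < ennreal (?e i)"
        "\<And>i. norm (sb_integral M (s i) - v) < ?e i"
      by metis
    have e: "?e \<longlonglongrightarrow> 0" by (rule LIMSEQ_inverse_real_of_nat)
    have "(\<lambda>i. \<integral>\<^sup>+x. norm (f x - s i x) \<partial>M) \<longlonglongrightarrow> 0"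
    proof (rule tendsto_sandwich[OF _ _ tendsto_const])
      show "(\<lambda>i. ennreal (?e i)) \<longlonglongrightarrow> 0" using tendsto_ennrealI[OF e] by simp
      show "\<forall>\<^sub>F i in sequentially. (\<integral>\<^sup>+x. norm (f x - s i x) \<partial>M) \<le> ennreal (?e i)"
        by (intro always_eventually allI less_imp_le s(2))
    qed simp
    moreover have "(\<lambda>i. sb_integral M (s i) - v) \<longlonglongrightarrow> 0"
      by (rule Lim_null_comparison[OF always_eventually[OF allI[OF less_imp_le[OF s(3)]]] e])
    then have "(\<lambda>i. sb_integral M (s i)) \<longlonglongrightarrow> v"
      by (rule LIM_zero_cancel)
    ultimately show ?thesis using s(1) by (intro exI[of _ s] conjI allI)
  qed
  ultimately show ?thesis unfolding has_vector_integral_def by blast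
qed

text \<open>In a nonseparable space a difference of measurable functions may fail to be measurable.
  Here \<open>s\<close> has finitely many values, so the function is a finite sum over level sets of
  \<open>s\<close>, on each of which it is a continuous function of \<open>f\<close>.\<close>

lemma measurable_norm_diff_simple:
  fixes f :: "'m \<Rightarrow> 'a::real_normed_vector"
  assumes f: "f \<in> borel_measurable M" and s: "simple_function M s"
  shows "(\<lambda>x. norm (f x - s x)) \<in> borel_measurable M"
proof -
  have cont: "(\<lambda>z. norm (z - y)) \<in> borel_measurable borel" for y :: 'a
    by (intro borel_measurable_continuous_onI continuous_intros)
  have "(\<lambda>x. \<Sum>y\<in>s ` space M. indicator (s -` {y} \<inter> space M) x * norm (f x - y)) \<in> borel_measurable M"
    by (intro borel_measurable_sum borel_measurable_times borel_measurable_indicator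
        simple_functionD(2)[OF s] measurable_compose[OF f cont])
  moreover have "(\<Sum>y\<in>s ` space M. indicator (s -` {y} \<inter> space M) x * norm (f x - y)) = norm (f x - s x)"
    if "x \<in> space M" for x
  proof -
    have "(\<Sum>y\<in>s ` space M. indicator (s -` {y} \<inter> space M) x * norm (f x - y)) =
        (\<Sum>y\<in>s ` space M. if y = s x then norm (f x - y) else 0)"
      using that by (intro sum.cong) (auto simp: indicator_def)
    also have "\<dots> = norm (f x - s x)"
      using that simple_functionD(1)[OF s] by simp
    finally show ?thesis .
  qed
  ultimately show ?thesis by (simp cong: measurable_cong)
qed

lemma measurable_norm_diff_simple_bochner:
  fixes f :: "'m \<Rightarrow> 'a::real_normed_vector"
  assumes "f \<in> borel_measurable M" "sb_integrable M s"
  shows "(\<lambda>x. ennreal (norm (f x - s x))) \<in> borel_measurable M"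
  using assms measurable_norm_diff_simple
  by (auto elim!: Bochner_Integration.simple_bochner_integrable.cases)

lemma simple_approx_cong:
  assumes "simple_approx M f v" "\<And>x. x \<in> space M \<Longrightarrow> f x = g x"
  shows "simple_approx M g v"
proof -
  have "(\<integral>\<^sup>+x. norm (f x - s x) \<partial>M) = (\<integral>\<^sup>+x. norm (g x - s x) \<partial>M)" for s
    by (intro nn_integral_cong) (simp add: assms(2))
  with assms(1) show ?thesis by (simp add: simple_approx_def)
qed

lemma simple_approx_add:
  fixes f g :: "'m \<Rightarrow> 'a::banach"
  assumes f: "f \<in> borel_measurable M" "simple_approx M f v"
    and g: "g \<in> borel_measurable M" "simple_approx M g w"
  shows "simple_approx M (\<lambda>x. f x + g x) (v + w)"
  unfolding simple_approx_def
proof (intro allI impI)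
  fix e :: real assume "0 < e"
  then have "0 < e / 2" by simp
  obtain s where s: "sb_integrable M s"
      "(\<integral>\<^sup>+x. norm (f x - s x) \<partial>M) < ennreal (e / 2)"
      "norm (sb_integral M s - v) < e / 2"
    using f(2) \<open>0 < e / 2\<close> unfolding simple_approx_def by blast
  obtain t where t: "sb_integrable M t"
      "(\<integral>\<^sup>+x. norm (g x - t x) \<partial>M) < ennreal (e / 2)"
      "norm (sb_integral M t - w) < e / 2"
    using g(2) \<open>0 < e / 2\<close> unfolding simple_approx_def by blast
  let ?u = "\<lambda>x. s x + t x"
  have "sb_integrable M ?u"
    using s(1) t(1) by (simp add: simple_bochner_integrable_compose2)
  moreover have "(\<integral>\<^sup>+x. norm (f x + g x - ?u x) \<partial>M) < ennreal e"
  proof -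
    have "(\<integral>\<^sup>+x. norm (f x + g x - ?u x) \<partial>M) \<le> (\<integral>\<^sup>+x. ennreal (norm (f x - s x)) + ennreal (norm (g x - t x)) \<partial>M)"
      by (intro nn_integral_mono) (simp add: norm_diff_triangle_ineq flip: ennreal_plus)
    also have "\<dots> = (\<integral>\<^sup>+x. norm (f x - s x) \<partial>M) + (\<integral>\<^sup>+x. norm (g x - t x) \<partial>M)"
      by (intro nn_integral_add measurable_norm_diff_simple_bochner f(1) g(1) s(1) t(1))
    also have "\<dots> < ennreal (e / 2) + ennreal (e / 2)"
      by (rule add_strict_mono[OF s(2) t(2)])
    also have "\<dots> = ennreal e" using \<open>0 < e\<close> by (simp flip: ennreal_plus)
    finally show ?thesis .
  qed
  moreover have "norm (sb_integral M ?u - (v + w)) < e"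
    unfolding simple_bochner_integral_add[OF s(1) t(1)]
    using norm_diff_triangle_ineq[of "sb_integral M s"
        "sb_integral M t" v w] s(3) t(3) by linarith
  ultimately show "\<exists>s. sb_integrable M s \<and>
      (\<integral>\<^sup>+x. norm (f x + g x - s x) \<partial>M) < ennreal e \<and>
      norm (sb_integral M s - (v + w)) < e"
    by blast
qed

text \<open>Since the total mass is 1, a uniform error \<open>e / 2\<close> costs at most
  \<open>e / 2\<close> in the integral.\<close>

lemma simple_approx_uniform_limit:
  fixes f :: "nat \<Rightarrow> 'm \<Rightarrow> 'a::banach"
  assumes M: "emeasure M (space M) = 1"
    and f: "\<And>n. f n \<in> borel_measurable M" "\<And>n. simple_approx M (f n) (v n)"
    and lim: "uniform_limit (space M) f g sequentially" "v \<longlonglongrightarrow> w"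
  shows "simple_approx M g w"
  unfolding simple_approx_def
proof (intro allI impI)
  fix e :: real assume "0 < e"
  then have e2: "0 < e / 2" by simp
  have "eventually (\<lambda>n. (\<forall>x\<in>space M. dist (f n x) (g x) < e / 2) \<and> dist (v n) w < e / 2) sequentially"
    using uniform_limitD[OF lim(1) e2] tendstoD[OF lim(2) e2] by (rule eventually_conj)
  then obtain n where n: "\<And>x. x \<in> space M \<Longrightarrow> dist (f n x) (g x) < e / 2" "dist (v n) w < e / 2"
    using eventually_happens'[OF sequentially_bot] by blast
  obtain s where s: "sb_integrable M s"
      "(\<integral>\<^sup>+x. norm (f n x - s x) \<partial>M) < ennreal (e / 2)"
      "norm (sb_integral M s - v n) < e / 2"
    using f(2)[of n] e2 unfolding simple_approx_def by blast
  have "(\<integral>\<^sup>+x. norm (g x - s x) \<partial>M) \<le> (\<integral>\<^sup>+x. ennreal (e / 2) + ennreal (norm (f n x - s x)) \<partial>M)"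
  proof (rule nn_integral_mono)
    fix x assume "x \<in> space M"
    then have "norm (g x - s x) \<le> e / 2 + norm (f n x - s x)"
      using n(1)[of x] norm_triangle_ineq[of "g x - f n x" "f n x - s x"]
      by (simp add: dist_norm norm_minus_commute)
    then show "ennreal (norm (g x - s x)) \<le> ennreal (e / 2) + ennreal (norm (f n x - s x))"
      using e2 by (simp add: ennreal_leI flip: ennreal_plus)
  qed
  also have "\<dots> = (\<integral>\<^sup>+x. ennreal (e / 2) \<partial>M) + (\<integral>\<^sup>+x. norm (f n x - s x) \<partial>M)"
    by (intro nn_integral_add measurable_norm_diff_simple_bochner f(1) s(1)) simp
  also have "(\<integral>\<^sup>+x. ennreal (e / 2) \<partial>M) = ennreal (e / 2)" using M by simp
  also have "ennreal (e / 2) + (\<integral>\<^sup>+x. norm (f n x - s x) \<partial>M) < ennreal (e / 2) + ennreal (e / 2)"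
    using s(2) by (simp add: ennreal_add_left_cancel_less)
  also have "\<dots> = ennreal e" using \<open>0 < e\<close> by (simp flip: ennreal_plus)
  finally have "(\<integral>\<^sup>+x. norm (g x - s x) \<partial>M) < ennreal e" .
  moreover have "norm (sb_integral M s - w) < e"
    using s(3) n(2) norm_triangle_ineq[of "sb_integral M s - v n" "v n - w"]
    by (simp add: dist_norm)
  ultimately show "\<exists>s. sb_integrable M s \<and>
      (\<integral>\<^sup>+x. norm (g x - s x) \<partial>M) < ennreal e \<and>
      norm (sb_integral M s - w) < e"
    using s(1) by blast
qed

lemma has_vector_integral_complex:
  fixes f :: "'m \<Rightarrow> complex"
  shows "has_bochner_integral M f v \<Longrightarrow> has_vector_integral M f v"
  unfolding has_vector_integral_def by (auto elim!: has_bochner_integral.cases)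

text \<open>For multiples of a fixed vector the simple functions can be taken from the scalar
  integral of \<open>f\<close> and multiplied by \<open>a\<close>.\<close>

lemma simple_approx_scaleC:
  fixes f :: "'m \<Rightarrow> complex" and a :: "'a::cstar_algebra"
  assumes "has_bochner_integral M f v"
  shows "simple_approx M (\<lambda>x. f x *\<^sub>C a) (v *\<^sub>C a)"
  unfolding simple_approx_def
proof (intro allI impI)
  fix e :: real assume "0 < e"
  define d where "d = e / (norm a + 1)"
  have pos: "0 < norm a + 1" by (simp add: add_nonneg_pos)
  then have d0: "0 < d" using \<open>0 < e\<close> by (simp add: d_def)
  then have "d * norm a < d * (norm a + 1)" by (intro mult_strict_left_mono) auto
  also have "\<dots> = e" using pos by (simp add: d_def)
  finally have d: "0 < d" "d * norm a < e" using d0 by auto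
  have f: "f \<in> borel_measurable M" and "simple_approx M f v"
    using has_vector_integral_complex[OF assms] by (auto simp: has_vector_integral_iff_simple_approx)
  then obtain s where s: "sb_integrable M s"
      "(\<integral>\<^sup>+x. norm (f x - s x) \<partial>M) < ennreal d"
      "norm (sb_integral M s - v) < d"
    using d unfolding simple_approx_def by blast
  have lin: "linear (\<lambda>z. z *\<^sub>C a)"
    by (rule bounded_linear.linear[OF bounded_bilinear.bounded_linear_left[OF bounded_bilinear_scaleC]])
  have "sb_integrable M (\<lambda>x. s x *\<^sub>C a)"
    using simple_bochner_integrable_compose2[of "\<lambda>x y. x *\<^sub>C a" M s s] s(1) by simp
  moreover have "(\<integral>\<^sup>+x. norm (f x *\<^sub>C a - s x *\<^sub>C a) \<partial>M) < ennreal e"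
  proof -
    have "(\<integral>\<^sup>+x. norm (f x *\<^sub>C a - s x *\<^sub>C a) \<partial>M) = (\<integral>\<^sup>+x. ennreal (norm a) * ennreal (norm (f x - s x)) \<partial>M)"
      by (intro nn_integral_cong) (simp add: norm_scaleC mult.commute flip: scaleC_diff_left ennreal_mult)
    also have "\<dots> = ennreal (norm a) * (\<integral>\<^sup>+x. norm (f x - s x) \<partial>M)"
      by (intro nn_integral_cmult measurable_norm_diff_simple_bochner f s(1))
    also have "\<dots> \<le> ennreal (norm a) * ennreal d"
      by (intro mult_left_mono less_imp_le[OF s(2)]) simp
    also have "\<dots> < ennreal e"
      using d \<open>0 < e\<close> by (simp add: ennreal_lessI mult.commute flip: ennreal_mult)
    finally show ?thesis .
  qed
  moreover have "norm (sb_integral M (\<lambda>x. s x *\<^sub>C a) - v *\<^sub>C a) < e"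
  proof -
    have "norm (sb_integral M (\<lambda>x. s x *\<^sub>C a) - v *\<^sub>C a) =
        norm (sb_integral M s - v) * norm a"
      unfolding simple_bochner_integral_linear[OF lin s(1)]
      by (simp add: norm_scaleC flip: scaleC_diff_left)
    also have "\<dots> \<le> d * norm a" using s(3) by (intro mult_right_mono) auto
    finally show ?thesis using d(2) by simp
  qed
  ultimately show "\<exists>s. sb_integrable M s \<and>
      (\<integral>\<^sup>+x. norm (f x *\<^sub>C a - s x) \<partial>M) < ennreal e \<and>
      norm (sb_integral M s - v *\<^sub>C a) < e"
    by blast
qed

lemma has_vector_integral_unique:
  assumes "has_vector_integral M f v" "has_vector_integral M f w"
  shows "v = w"
proof (rule ccontr)
  assume "v \<noteq> w"
  \<comment> \<open>Two simple functions with error \<open>e\<close> have integrals closer than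
    \<open>2 * e\<close>; the distances to \<open>v\<close> and \<open>w\<close> add less than
    another \<open>2 * e\<close>, against \<open>norm (v - w) = 4 * e\<close>.\<close>
  define e where "e = norm (v - w) / 4"
  have e: "0 < e" using \<open>v \<noteq> w\<close> by (simp add: e_def)
  have f: "f \<in> borel_measurable M" and approx: "simple_approx M f v" "simple_approx M f w"
    using assms by (auto simp: has_vector_integral_iff_simple_approx)
  obtain s where s: "sb_integrable M s"
      "(\<integral>\<^sup>+x. norm (f x - s x) \<partial>M) < ennreal e"
      "norm (sb_integral M s - v) < e"
    using approx(1) e unfolding simple_approx_def by blast
  obtain t where t: "sb_integrable M t"
      "(\<integral>\<^sup>+x. norm (f x - t x) \<partial>M) < ennreal e"
      "norm (sb_integral M t - w) < e"
    using approx(2) e unfolding simple_approx_def by blast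
  let ?I = "sb_integral M"
  have "ennreal (norm (?I s - ?I t)) = norm (?I (\<lambda>x. s x - t x))"
    using s t by (subst simple_bochner_integral_diff) auto
  also have "\<dots> \<le> ?I (\<lambda>x. norm (s x - t x))"
    using simple_bochner_integrable_compose2[of "(-)" M "s" "t"] s t
    by (auto intro!: simple_bochner_integral_norm_bound)
  also have "\<dots> = (\<integral>\<^sup>+x. norm (s x - t x) \<partial>M)"
    using simple_bochner_integrable_compose2[of "\<lambda>x y. norm (x - y)" M "s" "t"] s t
    by (auto intro!: simple_bochner_integral_eq_nn_integral)
  also have "\<dots> \<le> (\<integral>\<^sup>+x. ennreal (norm (f x - s x)) + ennreal (norm (f x - t x)) \<partial>M)"
  proof (rule nn_integral_mono)
    fix x
    have "norm (s x - t x) \<le> norm (f x - s x) + norm (f x - t x)"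
      using norm_triangle_ineq4[of "f x - t x" "f x - s x"] by (simp add: add.commute)
    then show "ennreal (norm (s x - t x)) \<le> ennreal (norm (f x - s x)) + ennreal (norm (f x - t x))"
      by (simp add: ennreal_leI flip: ennreal_plus)
  qed
  also have "\<dots> = (\<integral>\<^sup>+x. norm (f x - s x) \<partial>M) + (\<integral>\<^sup>+x. norm (f x - t x) \<partial>M)"
    by (intro nn_integral_add measurable_norm_diff_simple_bochner f s(1) t(1))
  also have "\<dots> < ennreal e + ennreal e" by (rule add_strict_mono[OF s(2) t(2)])
  also have "\<dots> = ennreal (2 * e)" using e by (simp flip: ennreal_plus)
  finally have "norm (?I s - ?I t) < 2 * e" using e by (simp add: ennreal_less_iff)
  moreover have "norm (v - w) \<le> norm (?I s - v) + norm (?I s - ?I t) + norm (?I t - w)"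
    using norm_triangle_ineq[of "v - ?I s" "?I s - w"] norm_triangle_ineq[of "?I s - ?I t" "?I t - w"]
    by (simp add: norm_minus_commute)
  ultimately show False using s(3) t(3) by (simp add: e_def)
qed

section \<open>Haar integrals of characters and of orbits\<close>

locale almost_periodic_dynamics_haar = almost_periodic_dynamics \<sigma>
  for \<sigma> :: "real \<Rightarrow> 'a::cstar_algebra \<Rightarrow> 'a" +
  fixes \<mu> :: "(real \<Rightarrow> complex) measure"
  assumes haar: "normalized_haar_measure (dual_group (frequency_group \<sigma>)) \<mu>"
begin

abbreviation "G \<equiv> dual_group \<Gamma>"

lemma sets_mu: "sets \<mu> = sets (restrict_space borel G)"
  and emeasure_G: "emeasure \<mu> G = 1"
  and invariant: "\<gamma> \<in> G \<Longrightarrow> B \<in> sets \<mu> \<Longrightarrow> emeasure \<mu> ((\<lambda>\<eta> x. \<gamma> x * \<eta> x) ` B) = emeasure \<mu> B"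
  using haar by (auto simp: normalized_haar_measure_def)

lemma space_mu [simp]: "space \<mu> = G"
  using sets_eq_imp_space_eq[OF sets_mu] by (simp add: space_restrict_space)

sublocale finite_measure \<mu>
  by (rule finite_measureI) (simp add: emeasure_G)

lemma measurable_mu_continuous:
  "continuous_on G f \<Longrightarrow> f \<in> borel_measurable \<mu>"
  using borel_measurable_continuous_on_restrict measurable_cong_sets[OF sets_mu refl] by blast

lemma measurable_translate:
  assumes "\<eta> \<in> G"
  shows "(\<lambda>\<gamma> x. \<eta> x * \<gamma> x) \<in> measurable \<mu> \<mu>"
proof -
  have "continuous_on G (\<lambda>\<gamma> x. \<eta> x * \<gamma> x)"
    by (intro continuous_on_coordinatewise_then_product continuous_intros
        continuous_on_subset[OF continuous_on_product_coordinates]) auto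
  then have "(\<lambda>\<gamma> x. \<eta> x * \<gamma> x) \<in> measurable \<mu> borel" by (rule measurable_mu_continuous)
  moreover have "(\<lambda>x. \<eta> x * \<gamma> x) \<in> G" if "\<gamma> \<in> G" for \<gamma>
    using assms that by (auto simp: dual_group_def norm_mult)
  ultimately have "(\<lambda>\<gamma> x. \<eta> x * \<gamma> x) \<in> measurable \<mu> (restrict_space borel G)"
    by (intro measurable_restrict_space2) auto
  then show ?thesis using measurable_cong_sets[OF refl sets_mu] by blast
qed

text \<open>\<open>normalized_haar_measure\<close> speaks of images, a distribution of preimages;
  the translations by \<open>t\<close> and \<open>- t\<close> are inverse to each other on
  \<open>G\<close> and exchange the two.\<close>

lemma distr_translate:
  fixes t :: real
  defines "T \<equiv> \<lambda>t \<gamma> x. dual_embedding \<Gamma> t x * \<gamma> x"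
  shows "distr \<mu> \<mu> (T t) = \<mu>"
proof (rule measure_eqI)
  fix B assume "B \<in> sets (distr \<mu> \<mu> (T t))"
  then have B: "B \<in> sets \<mu>" by simp
  then have "B \<subseteq> G" using sets.sets_into_space by fastforce
  have TT: "T s (T (- s) \<gamma>) = \<gamma>" if "\<gamma> \<in> G" for s \<gamma>
  proof
    fix x
    have "expi s x * expi (- s) x = 1" by (simp flip: exp_add)
    then show "T s (T (- s) \<gamma>) x = \<gamma> x"
      using that by (auto simp: T_def dual_embedding_def dual_group_def simp flip: mult.assoc)
  qed
  have TG: "T s \<gamma> \<in> G" if "\<gamma> \<in> G" for s \<gamma>
    using measurable_space[OF measurable_translate[OF dual_embedding_in_dual_group[of s]], of \<gamma>] that
    by (simp add: T_def)
  have "T t -` B \<inter> G = T (- t) ` B"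
  proof (intro equalityI subsetI)
    fix \<gamma> assume "\<gamma> \<in> T t -` B \<inter> G"
    then show "\<gamma> \<in> T (- t) ` B" using TT[of \<gamma> "- t"] by (force simp: image_iff)
  next
    fix \<gamma> assume "\<gamma> \<in> T (- t) ` B"
    then show "\<gamma> \<in> T t -` B \<inter> G" using TT[of _ t] TG \<open>B \<subseteq> G\<close> by auto
  qed
  then have "emeasure (distr \<mu> \<mu> (T t)) B = emeasure \<mu> (T (- t) ` B)"
    using emeasure_distr[OF measurable_translate[OF dual_embedding_in_dual_group[of t]] B]
    by (simp add: T_def)
  also have "\<dots> = emeasure \<mu> B"
    unfolding T_def by (rule invariant[OF dual_embedding_in_dual_group B])
  finally show "emeasure (distr \<mu> \<mu> (T t)) B = emeasure \<mu> B" .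
qed simp

lemma measurable_coordinate: "(\<lambda>\<gamma>. \<gamma> \<omega>) \<in> borel_measurable \<mu>"
  by (intro measurable_mu_continuous continuous_on_subset[OF continuous_on_product_coordinates]) auto

lemma integral_character:
  assumes "\<omega> \<in> \<Gamma>"
  shows "has_bochner_integral \<mu> (\<lambda>\<gamma>. \<gamma> \<omega>) (if \<omega> = 0 then 1 else 0)"
proof -
  have "AE \<gamma> in \<mu>. cmod (\<gamma> \<omega>) \<le> 1"
    using assms by (intro AE_I2) (auto simp: dual_group_def)
  then have int: "integrable \<mu> (\<lambda>\<gamma>. \<gamma> \<omega>)"
    by (rule integrable_const_bound) (rule measurable_coordinate)
  have "integral\<^sup>L \<mu> (\<lambda>\<gamma>. \<gamma> \<omega>) = (if \<omega> = 0 then 1 else 0)"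
  proof (cases "\<omega> = 0")
    case True
    have "\<gamma> 0 = 1" if "\<gamma> \<in> G" for \<gamma>
    proof -
      interpret real_character \<Gamma> \<gamma>
        using that by unfold_locales (auto simp: dual_group_def Gamma_zero Gamma_add)
      show ?thesis by (rule char_zero)
    qed
    then have "integral\<^sup>L \<mu> (\<lambda>\<gamma>. \<gamma> \<omega>) = integral\<^sup>L \<mu> (\<lambda>\<gamma>. 1 :: complex)"
      using True by (intro Bochner_Integration.integral_cong) auto
    also have "\<dots> = 1" using emeasure_G by (simp add: measure_def)
    finally show ?thesis using True by simp
  next
    case False
    \<comment> \<open>Translation by this \<open>t\<close> multiplies the character by
      \<open>exp (\<i> * pi) = -1\<close>, so its integral equals its own negative.\<close>
    define t where "t = pi / \<omega>"
    have emb: "dual_embedding \<Gamma> t \<omega> = -1"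
      using False assms by (simp add: dual_embedding_def t_def)
    have "integral\<^sup>L \<mu> (\<lambda>\<gamma>. \<gamma> \<omega>) = integral\<^sup>L (distr \<mu> \<mu> (\<lambda>\<gamma> x. dual_embedding \<Gamma> t x * \<gamma> x)) (\<lambda>\<gamma>. \<gamma> \<omega>)"
      by (simp only: distr_translate)
    also have "\<dots> = integral\<^sup>L \<mu> (\<lambda>\<gamma>. dual_embedding \<Gamma> t \<omega> * \<gamma> \<omega>)"
      by (rule integral_distr[OF measurable_translate[OF dual_embedding_in_dual_group] measurable_coordinate])
    also have "\<dots> = - integral\<^sup>L \<mu> (\<lambda>\<gamma>. \<gamma> \<omega>)" by (simp add: emb)
    finally show ?thesis using False by simp
  qed
  with int show ?thesis by (simp add: has_bochner_integral_iff)
qed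

lemma has_vector_integral_dual_action:
  "has_vector_integral \<mu> (\<lambda>\<gamma>. dual_action \<sigma> \<gamma> a) (cexp a)"
proof -
  have meas: "(\<lambda>\<gamma>. dual_action \<sigma> \<gamma> a) \<in> borel_measurable \<mu>" for a
    by (rule measurable_mu_continuous[OF continuous_dual_action])
  have "simple_approx \<mu> (\<lambda>\<gamma>. dual_action \<sigma> \<gamma> a) (cexp a)"
  proof (induction a rule: spectral_induct)
    case (spectral \<omega> x)
    show ?case
    proof (rule simple_approx_cong)
      show "simple_approx \<mu> (\<lambda>\<gamma>. \<gamma> \<omega> *\<^sub>C x) (cexp x)"
      proof (cases "x = 0")
        case True
        have "has_bochner_integral \<mu> (\<lambda>_. 0 :: complex) 0" by (rule has_bochner_integral_zero)
        from simple_approx_scaleC[OF this, of x] show ?thesis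
          using True cexp_spectral[OF spectral_zero] by simp
      next
        case False
        from simple_approx_scaleC[OF integral_character[OF spectral_nonzero_Gamma[OF spectral False]], of x]
        show ?thesis using cexp_spectral[OF spectral] by (simp add: scaleC_one split: if_splits)
      qed
    qed (simp add: dual_action_spectral[OF _ spectral])
  next
    case (add x y)
    show ?case
      by (rule simple_approx_cong, unfold cexp_add, rule simple_approx_add[OF meas add(1) meas add(2)])
         (simp add: dual_action_add)
  next
    case (limit f l)
    show ?case
      by (rule simple_approx_uniform_limit[OF _ meas limit(1) _ tendsto_cexp[OF limit(2)]])
         (use uniform_limit_dual_action[OF limit(2)] emeasure_G in auto)
  qed
  with meas show ?thesis by (simp add: has_vector_integral_iff_simple_approx)
qed

lemma cond_expectation_eq: "cond_expectation \<sigma> \<mu> a = cexp a"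
  unfolding cond_expectation_def
  by (rule the_equality, rule has_vector_integral_dual_action)
     (erule has_vector_integral_unique[OF _ has_vector_integral_dual_action])

end


section \<open>The crystal\<close>

lemma base_in_closure_cspan: "x \<in> S \<Longrightarrow> x \<in> closure (cspan (S :: 'a::cstar_algebra set))"
  by (rule subsetD[OF closure_subset cstar.span_base])

lemma zero_in_closure_cspan: "0 \<in> closure (cspan (S :: 'a::cstar_algebra set))"
  using closure_subset cstar.span_zero by blast

lemma scaleC_in_closure_cspan:
  fixes S :: "'a::cstar_algebra set"
  assumes "x \<in> closure (cspan S)"
  shows "c *\<^sub>C x \<in> closure (cspan S)"
proof -
  obtain f where f: "\<And>n::nat. f n \<in> cspan S" "f \<longlonglongrightarrow> x"
    using assms closure_sequential by blast
  have "(\<lambda>n. c *\<^sub>C f n) \<longlonglongrightarrow> c *\<^sub>C x" by (intro tendsto_intros f(2))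
  then show ?thesis
    unfolding closure_sequential using cstar.span_scale[OF f(1)]
    by (intro exI[of _ "\<lambda>n. c *\<^sub>C f n"]) simp
qed

lemma add_in_closure_cspan:
  fixes S :: "'a::cstar_algebra set"
  assumes "x \<in> closure (cspan S)" "y \<in> closure (cspan S)"
  shows "x + y \<in> closure (cspan S)"
proof -
  obtain f where f: "\<And>n::nat. f n \<in> cspan S" "f \<longlonglongrightarrow> x"
    using assms closure_sequential by blast
  obtain g where g: "\<And>n::nat. g n \<in> cspan S" "g \<longlonglongrightarrow> y"
    using assms closure_sequential by blast
  have "(\<lambda>n. f n + g n) \<longlonglongrightarrow> x + y" by (intro tendsto_intros f(2) g(2))
  then show ?thesis
    unfolding closure_sequential using cstar.span_add[OF f(1) g(1)]
    by (intro exI[of _ "\<lambda>n. f n + g n"]) simp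
qed

text \<open>A continuous additive map that is linear or conjugate-linear; conjugation is the reason
  for the function \<open>k\<close> on scalars.\<close>

lemma closure_cspan_map:
  fixes f :: "'a::cstar_algebra \<Rightarrow> 'b::cstar_algebra"
  assumes x: "x \<in> closure (cspan S)" and f: "bounded_linear f" "\<And>c x. f (c *\<^sub>C x) = k c *\<^sub>C f x"
    and S: "\<And>x. x \<in> S \<Longrightarrow> f x \<in> closure (cspan T)"
  shows "f x \<in> closure (cspan T)"
  using x
proof (induction rule: closure_cspan_induct)
  case zero
  then show ?case using zero_in_closure_cspan linear_0[OF bounded_linear.linear[OF f(1)]] by simp
next
  case (scale c x)
  then show ?case by (simp add: f(2) S scaleC_in_closure_cspan)
next
  case (add x y)
  then show ?case
    using add_in_closure_cspan linear_add[OF bounded_linear.linear[OF f(1)]] by simp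
next
  case (limit g l)
  then show ?case
    using closed_sequentially[OF closed_closure _ bounded_linear.tendsto[OF f(1)]] by blast
qed

lemma sumA_whole: "sumA whole f n = (\<Sum>k<n. f k)"
  by (induction n) (auto simp: whole_def)

context almost_periodic_dynamics
begin

abbreviation "J \<equiv> crystal_ideal \<sigma>"

lemma spectral_0_mult: "a \<in> A 0 \<Longrightarrow> b \<in> A 0 \<Longrightarrow> a * b \<in> A 0"
  using spectral_mult[of a 0 b 0] by simp

lemma spectral_0_star: "a \<in> A 0 \<Longrightarrow> star a \<in> A 0"
  using spectral_star[of a 0] by simp

lemma J_zero: "0 \<in> J"
  and J_add: "x \<in> J \<Longrightarrow> y \<in> J \<Longrightarrow> x + y \<in> J"
  and J_scaleC: "x \<in> J \<Longrightarrow> c *\<^sub>C x \<in> J"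
  unfolding crystal_ideal_def
  by (rule zero_in_closure_cspan add_in_closure_cspan scaleC_in_closure_cspan; assumption)+

lemma J_minus: "x \<in> J \<Longrightarrow> - x \<in> J"
  using J_scaleC[of x "-1"] by (simp add: scaleC_one)

lemma J_diff: "x \<in> J \<Longrightarrow> y \<in> J \<Longrightarrow> x - y \<in> J"
  using J_add[OF _ J_minus, of x y] by simp

text \<open>\<open>J\<close> is a closed span of closed spans, so \<open>closure_cspan_map\<close>
  is applied at both levels and only products \<open>x * star y\<close> of one frequency have to be
  examined. One-sided multiplication by \<open>A 0\<close> and the involution preserve their
  form.\<close>

lemma J_map:
  assumes f: "bounded_linear f" "\<And>c x. f (c *\<^sub>C x) = k c *\<^sub>C f x"
    and gen: "\<And>x y \<omega>. x \<in> A \<omega> \<Longrightarrow> y \<in> A \<omega> \<Longrightarrow> \<exists>x'\<in>A \<omega>. \<exists>y'\<in>A \<omega>. f (x * star y) = x' * star y'"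
    and x: "x \<in> J"
  shows "f x \<in> J"
  using x unfolding crystal_ideal_def
proof (rule closure_cspan_map[OF _ f])
  fix y assume "y \<in> (\<Union>\<omega>\<in>{0<..}. spectral_ideal \<sigma> \<omega>)"
  then obtain \<omega> where \<omega>: "\<omega> > 0" "y \<in> spectral_ideal \<sigma> \<omega>" by auto
  have "f y \<in> spectral_ideal \<sigma> \<omega>"
    using \<omega>(2) unfolding spectral_ideal_def
  proof (rule closure_cspan_map[OF _ f])
    fix z assume "z \<in> {x * star y |x y. x \<in> A \<omega> \<and> y \<in> A \<omega>}"
    then obtain x y where "x \<in> A \<omega>" "y \<in> A \<omega>" "z = x * star y" by auto
    then have "f z \<in> {x * star y |x y. x \<in> A \<omega> \<and> y \<in> A \<omega>}"
      using gen[of x \<omega> y] by auto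
    then show "f z \<in> closure (cspan {x * star y |x y. x \<in> A \<omega> \<and> y \<in> A \<omega>})"
      by (rule base_in_closure_cspan)
  qed
  then have "f y \<in> (\<Union>\<omega>\<in>{0<..}. spectral_ideal \<sigma> \<omega>)" using \<omega>(1) by auto
  then show "f y \<in> closure (cspan (\<Union>\<omega>\<in>{0<..}. spectral_ideal \<sigma> \<omega>))"
    by (rule base_in_closure_cspan)
qed

lemma J_mult_left:
  assumes "a \<in> A 0" "x \<in> J"
  shows "a * x \<in> J"
proof (rule J_map[OF bounded_linear_mult_right _ _ assms(2)])
  show "a * (c *\<^sub>C x) = c *\<^sub>C (a * x)" for c x by (rule scaleC_mult_right)
  fix x y \<omega> assume "x \<in> A \<omega>" "y \<in> A \<omega>"
  moreover have "a * x \<in> A \<omega>" using spectral_mult[OF assms(1) \<open>x \<in> A \<omega>\<close>] by simp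
  ultimately show "\<exists>x'\<in>A \<omega>. \<exists>y'\<in>A \<omega>. a * (x * star y) = x' * star y'"
    by (metis mult.assoc)
qed

lemma J_mult_right:
  assumes "a \<in> A 0" "x \<in> J"
  shows "x * a \<in> J"
proof (rule J_map[OF bounded_linear_mult_left _ _ assms(2)])
  show "(c *\<^sub>C x) * a = c *\<^sub>C (x * a)" for c x by (rule scaleC_mult_left)
  fix x y \<omega> assume "x \<in> A \<omega>" "y \<in> A \<omega>"
  moreover have "star a * y \<in> A \<omega>"
    using spectral_mult[OF spectral_0_star[OF assms(1)] \<open>y \<in> A \<omega>\<close>] by simp
  moreover have "x * star y * a = x * star (star a * y)" by (simp add: star_mult star_star mult.assoc)
  ultimately show "\<exists>x'\<in>A \<omega>. \<exists>y'\<in>A \<omega>. x * star y * a = x' * star y'" by blast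
qed

lemma J_star:
  assumes "x \<in> J"
  shows "star x \<in> J"
proof (rule J_map[OF bounded_linear_star star_scaleC _ assms])
  show "\<exists>x'\<in>A \<omega>. \<exists>y'\<in>A \<omega>. star (x * star y) = x' * star y'" if "x \<in> A \<omega>" "y \<in> A \<omega>" for x y \<omega>
    using that by (auto simp: star_mult star_star)
qed

lemma closure_cspan_subset_spectral_0:
  assumes "S \<subseteq> A 0"
  shows "closure (cspan S) \<subseteq> A 0"
proof
  fix x assume "x \<in> closure (cspan S)"
  then show "x \<in> A 0"
  proof (induction rule: closure_cspan_induct)
    case (limit f l)
    then show ?case using closed_sequentially[OF closed_spectral] by blast
  qed (use assms spectral_scaleC spectral_add in auto)
qed

lemma J_subset: "J \<subseteq> A 0"
proof -
  have "x * star y \<in> A 0" if "x \<in> A \<omega>" "y \<in> A \<omega>" for x y \<omega>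
    using spectral_mult[OF that(1) spectral_star[OF that(2)]] by simp
  then have "spectral_ideal \<sigma> \<omega> \<subseteq> A 0" for \<omega>
    unfolding spectral_ideal_def by (intro closure_cspan_subset_spectral_0) auto
  then show ?thesis
    unfolding crystal_ideal_def by (intro closure_cspan_subset_spectral_0) auto
qed

abbreviation "coset a \<equiv> a +o J"

lemma mem_coset_iff: "x \<in> coset a \<longleftrightarrow> x - a \<in> J"
  by (auto simp: elt_set_plus_def algebra_simps intro: bexI[of _ "x - a"])

lemma coset_eq_iff: "coset a = coset b \<longleftrightarrow> a - b \<in> J"
proof
  assume "coset a = coset b"
  moreover have "a \<in> coset a" by (simp add: mem_coset_iff J_zero)
  ultimately show "a - b \<in> J" by (simp add: mem_coset_iff)
next
  assume ab: "a - b \<in> J"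
  have "x - a \<in> J \<longleftrightarrow> x - b \<in> J" for x
    using J_add[OF _ ab, of "x - a"] J_diff[OF _ ab, of "x - b"] by (auto simp: algebra_simps)
  then show "coset a = coset b" by (auto simp: mem_coset_iff)
qed

lemma coset_eq_if_mem: "x \<in> coset a \<Longrightarrow> coset x = coset a"
  by (simp add: mem_coset_iff coset_eq_iff)

lemma carr_crystal: "carr (crystal \<sigma>) = (\<lambda>a. coset a) ` A 0"
  and zeroA_crystal: "zeroA (crystal \<sigma>) = J"
  by (simp_all add: crystal_def quotient_alg_def)

lemma addA_crystal: "addA (crystal \<sigma>) (coset a) (coset b) = coset (a + b)"
proof -
  have "coset a + coset b = coset (a + b)"
  proof (intro equalityI subsetI)
    fix x assume "x \<in> coset a + coset b"
    then obtain y z where "x = y + z" "y - a \<in> J" "z - b \<in> J"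
      by (auto simp: set_plus_def mem_coset_iff)
    then show "x \<in> coset (a + b)"
      using J_add[of "y - a" "z - b"] by (simp add: mem_coset_iff algebra_simps)
  next
    fix x assume "x \<in> coset (a + b)"
    then have "x = a + (x - a)" "a \<in> coset a" "x - a \<in> coset b"
      by (auto simp: mem_coset_iff J_zero algebra_simps)
    then show "x \<in> coset a + coset b" unfolding set_plus_def by blast
  qed
  then show ?thesis by (simp add: crystal_def quotient_alg_def)
qed

lemma scaleA_crystal: "scaleA (crystal \<sigma>) c (coset a) = coset (c *\<^sub>C a)"
proof -
  have "coset (c *\<^sub>C x) = coset (c *\<^sub>C a)" if "x \<in> coset a" for x
    using J_scaleC[of "x - a" c] that by (simp add: mem_coset_iff coset_eq_iff scaleC_diff_right)
  moreover have "a \<in> coset a" by (simp add: mem_coset_iff J_zero)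
  ultimately have "(\<Union>x\<in>coset a. coset (c *\<^sub>C x)) = coset (c *\<^sub>C a)" by blast
  then show ?thesis by (simp add: crystal_def quotient_alg_def)
qed

lemma multA_crystal:
  assumes "a \<in> A 0" "b \<in> A 0"
  shows "multA (crystal \<sigma>) (coset a) (coset b) = coset (a * b)"
proof -
  have "coset (x * y) = coset (a * b)" if "x \<in> coset a" "y \<in> coset b" for x y
  proof -
    have xy: "x - a \<in> J" "y - b \<in> J" using that by (auto simp: mem_coset_iff)
    \<comment> \<open>This sum expands to \<open>x * y - a * b\<close>. Its first term is in
      \<open>J\<close> because \<open>J\<close> is contained in \<open>A 0\<close>.\<close>
    then have "(x - a) * (y - b) + a * (y - b) + (x - a) * b \<in> J"
      using assms J_subset by (intro J_add J_mult_left J_mult_right) auto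
    then have "x * y - a * b \<in> J" by (simp add: algebra_simps)
    then show ?thesis by (simp add: coset_eq_iff)
  qed
  moreover have "a \<in> coset a" "b \<in> coset b" by (auto simp: mem_coset_iff J_zero)
  ultimately have "(\<Union>x\<in>coset a. \<Union>y\<in>coset b. coset (x * y)) = coset (a * b)" by blast
  then show ?thesis by (simp add: crystal_def quotient_alg_def)
qed

lemma starA_crystal: "starA (crystal \<sigma>) (coset a) = coset (star a)"
proof -
  have "star ` coset a = coset (star a)"
  proof (intro equalityI subsetI)
    fix x assume "x \<in> star ` coset a"
    then obtain y where "x = star y" "y - a \<in> J" by (auto simp: mem_coset_iff)
    then show "x \<in> coset (star a)" using J_star by (fastforce simp: mem_coset_iff star_diff)
  next
    fix x assume "x \<in> coset (star a)"
    then have "star x - a \<in> J"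
      using J_star[of "x - star a"] by (simp add: mem_coset_iff star_diff star_star)
    then show "x \<in> star ` coset a"
      by (intro image_eqI[of _ _ "star x"]) (auto simp: mem_coset_iff star_star)
  qed
  then show ?thesis by (simp add: crystal_def quotient_alg_def)
qed

lemma normA_crystal: "normA (crystal \<sigma>) X = Inf (norm ` X)"
  by (simp add: crystal_def quotient_alg_def)

lemma normA_crystal_le: "normA (crystal \<sigma>) (coset a) \<le> norm a"
  unfolding normA_crystal
  by (intro cInf_lower bdd_belowI[of _ 0] imageI) (auto simp: mem_coset_iff J_zero)

lemma sumA_crystal:
  "(\<And>k. k < n \<Longrightarrow> f k = coset (g k)) \<Longrightarrow> sumA (crystal \<sigma>) f n = coset (\<Sum>k<n. g k)"
  by (induction n) (auto simp: zeroA_crystal addA_crystal)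

text \<open>Taking \<open>B = A 0\<close> in \<open>gram_pos_factor\<close> yields a factor over the
  fixed point algebra and not merely over the whole algebra, as is needed for the cosets of its
  entries to lie in the crystal.\<close>

lemma cexp_factor:
  fixes Y :: "nat \<Rightarrow> nat \<Rightarrow> 'a"
  obtains Z where "\<And>i j. i < n \<Longrightarrow> j < n \<Longrightarrow> Z i j \<in> A 0"
    "\<And>i j. i < n \<Longrightarrow> j < n \<Longrightarrow>
      cexp (\<Sum>k<n. star (Y k i) * Y k j) = (\<Sum>k<n. star (Z k i) * Z k j)"
proof (rule gram_pos_factor[OF gram_pos_cexp[of n Y] closed_spectral[of 0]])
  show "cexp (\<Sum>k<n. star (Y k i) * Y k j) \<in> A 0" for i j by (rule cexp_in_spectral_0)
qed (use spectral_add spectral_scaleC spectral_0_mult in auto)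

lemma cexp_star_mult_self:
  obtains z where "z \<in> A 0" "cexp (star x * x) = star z * z"
proof (rule cexp_factor[of 1 "\<lambda>_ _. x"])
  fix Z assume "\<And>i j :: nat. i < 1 \<Longrightarrow> j < 1 \<Longrightarrow> Z i j \<in> A 0"
    "\<And>i j :: nat. i < 1 \<Longrightarrow> j < 1 \<Longrightarrow> cexp (\<Sum>k<(1::nat). star x * x) = (\<Sum>k<(1::nat). star (Z k i) * Z k j)"
  from this(1)[of 0 0] this(2)[of 0 0] show ?thesis by (intro that[of "Z 0 0"]) auto
qed

end

section \<open>The map onto the crystal\<close>

context almost_periodic_dynamics_haar
begin

lemma crystal_map_eq: "crystal_map \<sigma> \<mu> a = coset (cexp a)"
  by (simp add: crystal_map_def cond_expectation_eq)

lemma linear_crystal_map: "linear_between whole (crystal \<sigma>) (crystal_map \<sigma> \<mu>)"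
  by (simp add: linear_between_def crystal_map_eq whole_def carr_crystal cexp_in_spectral_0
      cexp_add cexp_scaleC addA_crystal scaleA_crystal)

lemma completely_positive_crystal_map:
  "completely_positive whole (crystal \<sigma>) (crystal_map \<sigma> \<mu>)"
  unfolding completely_positive_def
proof (intro conjI allI impI linear_crystal_map)
  fix n and X :: "nat \<Rightarrow> nat \<Rightarrow> 'a"
  assume "positive_matrix whole n X"
  then obtain Y where Y: "\<And>i j. i < n \<Longrightarrow> j < n \<Longrightarrow> X i j = (\<Sum>k<n. star (Y k i) * Y k j)"
    unfolding positive_matrix_def sumA_whole by (auto simp: whole_def)
  obtain Z where Z: "\<And>i j. i < n \<Longrightarrow> j < n \<Longrightarrow> Z i j \<in> A 0"
    "\<And>i j. i < n \<Longrightarrow> j < n \<Longrightarrow>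
      cexp (\<Sum>k<n. star (Y k i) * Y k j) = (\<Sum>k<n. star (Z k i) * Z k j)"
    using cexp_factor[of n Y] by metis
  show "positive_matrix (crystal \<sigma>) n (\<lambda>i j. crystal_map \<sigma> \<mu> (X i j))"
    unfolding positive_matrix_def
  proof (intro exI[of _ "\<lambda>i j. coset (Z i j)"] conjI allI impI)
    fix i j assume ij: "i < n" "j < n"
    show "coset (Z i j) \<in> carr (crystal \<sigma>)" using Z(1)[OF ij] by (simp add: carr_crystal)
    have "sumA (crystal \<sigma>) (\<lambda>k. multA (crystal \<sigma>) (starA (crystal \<sigma>) (coset (Z k i))) (coset (Z k j))) n
        = coset (\<Sum>k<n. star (Z k i) * Z k j)"
      using ij Z(1) by (intro sumA_crystal) (simp add: starA_crystal multA_crystal spectral_0_star)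
    then show "crystal_map \<sigma> \<mu> (X i j) =
        sumA (crystal \<sigma>) (\<lambda>k. multA (crystal \<sigma>) (starA (crystal \<sigma>) (coset (Z k i))) (coset (Z k j))) n"
      by (simp add: crystal_map_eq Y ij Z(2))
  qed
qed

lemma contraction_crystal_map: "contraction whole (crystal \<sigma>) (crystal_map \<sigma> \<mu>)"
  unfolding contraction_def crystal_map_eq
  using order_trans[OF normA_crystal_le norm_cexp_le] by (simp add: whole_def)

lemma crystal_map_onto: "crystal_map \<sigma> \<mu> ` UNIV = carr (crystal \<sigma>)"
proof -
  have "coset a \<in> range (crystal_map \<sigma> \<mu>)" if "a \<in> A 0" for a
    using cexp_spectral[OF that] crystal_map_eq[of a] by (metis rangeI)
  then show ?thesis by (auto simp: carr_crystal crystal_map_eq cexp_in_spectral_0)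
qed

end


section \<open>Ground states\<close>

text \<open>With \<open>r = (1 + p)\<inverse>\<close> for \<open>p = n b b\<^sup>*\<close>, the squared norm of \<open>r b\<close> is
  \<open>\<parallel>r (1 - r)\<parallel> / n\<close>, and \<open>1 - r\<close> lies in the algebra.\<close>

lemma ex_left_local_unit:
  fixes b :: "'a::cstar_algebra"
  obtains e where "(\<lambda>m::nat. e m * b) \<longlonglongrightarrow> b"
proof -
  have "\<exists>e. norm (b - e * b) \<le> inverse (sqrt (real (Suc m)))" for m
  proof -
    define n where "n = real (Suc m)"
    have n: "n > 0" by (simp add: n_def)
    let ?b = "unitize b"
    define p where "p = n *\<^sub>R (?b * star ?b)"
    have "cpos p"
      unfolding p_def using cpos_star_mult_self[of "star ?b"] n by (intro cpos_scaleR) (auto simp: star_star)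
    obtain r where r: "(p + 1) * r = 1" "r * (p + 1) = 1"
      using cpos_add_scaleR_inverse[OF \<open>cpos p\<close>, of 1] by auto
    have "star r * (p + 1) = 1"
      using arg_cong[OF r(1), of star] by (simp add: star_mult star_add cpos_star[OF \<open>cpos p\<close>])
    then have sr: "star r = r" using r(1) by (rule left_right_inverse_eq)
    have "star r * (p + 1) * r = r" using r by (simp add: sr mult.assoc)
    then have "cpos r"
      using cpos_conj[OF cpos_add[OF \<open>cpos p\<close> cpos_one], of r] by simp
    have pr: "p * r = 1 - r" using r(1) by (simp add: distrib_right eq_diff_eq)
    have rp: "r * p = 1 - r" using r(2) by (simp add: distrib_left eq_diff_eq)
    have "cpos (star r * (p + p * p) * r)"
      using cpos_square[OF cpos_star[OF \<open>cpos p\<close>]] \<open>cpos p\<close> by (intro cpos_conj cpos_add)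
    moreover have "star r * (p + p * p) * r = r * p * ((p + 1) * r)"
      by (simp add: sr algebra_simps)
    ultimately have "cpos (1 - r)" by (simp add: r rp)
    have "norm r \<le> 1"
      using \<open>cpos (1 - r)\<close> \<open>cpos r\<close> by (intro norm_le_if_cpos_diff) auto
    have "norm (1 - r) \<le> 1"
      using \<open>cpos (1 - r)\<close> \<open>cpos r\<close> by (intro norm_le_if_cpos_diff) auto
    have "n *\<^sub>R ((r * ?b) * star (r * ?b)) = r * p * r"
      by (simp add: p_def star_mult sr mult.assoc)
    also have "\<dots> = (1 - r) * r" by (simp only: rp)
    finally have "n * (norm (r * ?b))\<^sup>2 = norm ((1 - r) * r)"
      using n by (metis abs_of_pos norm_mult_star norm_scaleR)
    also have "\<dots> \<le> 1 * 1"
      by (intro order_trans[OF norm_mult_ineq] mult_mono \<open>norm r \<le> 1\<close> \<open>norm (1 - r) \<le> 1\<close>) auto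
    finally have "(norm (r * ?b))\<^sup>2 \<le> inverse n" using n by (simp add: field_simps)
    then have nb: "norm (r * ?b) \<le> inverse (sqrt n)"
      using real_le_rsqrt by (fastforce simp: real_sqrt_inverse)
    \<comment> \<open>\<open>p\<close> comes from the algebra and has scalar part 0, so
      \<open>1 - r\<close> has scalar part 0 as well and its algebra part serves as
      \<open>e\<close>.\<close>
    have "uscal r = 1" using arg_cong[OF r(1), of uscal] by (simp add: p_def)
    then have "unitize (b - upart (1 - r) * b) = r * ?b"
      by (intro unitization_eqI) (auto simp: scaleC_one)
    then have "norm (b - upart (1 - r) * b) \<le> inverse (sqrt n)"
      using nb norm_unitize by metis
    then show ?thesis unfolding n_def by blast
  qed
  then obtain e where e: "\<And>m. norm (b - e m * b) \<le> inverse (sqrt (real (Suc m)))" by metis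
  have "(\<lambda>m. inverse (sqrt (real (Suc m)))) \<longlonglongrightarrow> 0"
    using tendsto_real_sqrt[OF LIMSEQ_inverse_real_of_nat] by (simp add: real_sqrt_inverse)
  then have "(\<lambda>m. b - e m * b) \<longlonglongrightarrow> 0"
    by (rule Lim_null_comparison[OF always_eventually[OF allI[OF e]]])
  then have "(\<lambda>m. b - (b - e m * b)) \<longlonglongrightarrow> b - 0" by (intro tendsto_intros)
  then show ?thesis by (intro that) simp
qed

section \<open>Contractive positive functionals\<close>

locale positive_functional =
  fixes \<phi> :: "'a::cstar_algebra \<Rightarrow> complex"
  assumes phi_add: "\<phi> (x + y) = \<phi> x + \<phi> y"
    and phi_scaleC: "\<phi> (c *\<^sub>C x) = c * \<phi> x"
    and phi_pos: "\<phi> (star x * x) \<in> \<real>\<^sub>\<ge>\<^sub>0"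
    and cmod_phi_le: "cmod (\<phi> x) \<le> norm x"
begin

lemma bounded_linear_phi: "bounded_linear \<phi>"
  by (rule bounded_linear_intro[where K = 1])
     (auto simp: phi_add phi_scaleC scaleR_eq_scaleC cmod_phi_le scaleR_conv_of_real)

lemmas tendsto_phi = bounded_linear.tendsto[OF bounded_linear_phi]
lemmas phi_zero [simp] = linear_0[OF bounded_linear.linear[OF bounded_linear_phi]]
lemmas phi_diff = linear_diff[OF bounded_linear.linear[OF bounded_linear_phi]]
lemmas phi_sum = linear_sum[OF bounded_linear.linear[OF bounded_linear_phi]]

lemma phi_star_mult_self_nonneg: "0 \<le> Re (\<phi> (star x * x))"
  using phi_pos[of x] by (simp add: complex_nonneg_Reals_iff)

lemma phi_combination:
  "\<phi> (star (x + c *\<^sub>C y) * (x + c *\<^sub>C y)) =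
    \<phi> (star x * x) + c * \<phi> (star x * y) + cnj c * \<phi> (star y * x) + cnj c * c * \<phi> (star y * y)"
  by (simp add: star_add star_scaleC algebra_simps scaleC_mult_left scaleC_mult_right scaleC_scaleC
      phi_add phi_scaleC)

text \<open>Polarization: \<open>phi_combination\<close> at \<open>c = 1\<close> and
  \<open>c = \<i>\<close>, compared in the imaginary parts, all squares having real values.\<close>

lemma phi_hermitian: "\<phi> (star y * x) = cnj (\<phi> (star x * y))"
proof -
  have Im0: "Im (\<phi> (star z * z)) = 0" for z
    using phi_pos[of z] by (simp add: complex_nonneg_Reals_iff)
  have "Im (\<phi> (star x * y)) + Im (\<phi> (star y * x)) = 0"
    using arg_cong[OF phi_combination[of x 1 y], of Im] by (simp add: Im0)
  moreover have "Re (\<phi> (star x * y)) - Re (\<phi> (star y * x)) = 0"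
    using arg_cong[OF phi_combination[of x \<i> y], of Im] by (simp add: Im0)
  ultimately show ?thesis by (simp add: complex_eq_iff)
qed

text \<open>The quadratic argument in a real parameter \<open>s\<close>, with the phase of
  \<open>?g\<close> absorbed in \<open>c\<close>; the value \<open>s = 1 / ?b\<close> gives the
  inequality.\<close>

lemma phi_cauchy_schwarz:
  "(cmod (\<phi> (star x * y)))\<^sup>2 \<le> Re (\<phi> (star x * x)) * Re (\<phi> (star y * y))"
proof -
  let ?a = "Re (\<phi> (star x * x))" and ?b = "Re (\<phi> (star y * y))" and ?g = "\<phi> (star x * y)"
  have quad: "0 \<le> ?a - 2 * s * (cmod ?g)\<^sup>2 + s\<^sup>2 * (cmod ?g)\<^sup>2 * ?b" for s :: real
  proof -
    define c where "c = - of_real s * cnj ?g"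
    have "c * ?g = of_real (- s * (cmod ?g)\<^sup>2)" "cnj c * cnj ?g = of_real (- s * (cmod ?g)\<^sup>2)"
      "cnj c * c = of_real (s\<^sup>2 * (cmod ?g)\<^sup>2)"
      unfolding of_real_mult complex_norm_square
      by (simp_all add: c_def power2_eq_square mult.commute mult.left_commute del: of_real_power)
    then have "\<phi> (star (x + c *\<^sub>C y) * (x + c *\<^sub>C y)) =
        \<phi> (star x * x) + of_real (- s * (cmod ?g)\<^sup>2) + of_real (- s * (cmod ?g)\<^sup>2)
        + of_real (s\<^sup>2 * (cmod ?g)\<^sup>2) * \<phi> (star y * y)"
      unfolding phi_combination phi_hermitian[of y x] by simp
    from arg_cong[OF this, of Re] show ?thesis
      using phi_star_mult_self_nonneg[of "x + c *\<^sub>C y"] by simp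
  qed
  show ?thesis
  proof (cases "?b = 0")
    case True
    have "(cmod ?g)\<^sup>2 = 0"
    proof (rule ccontr)
      assume g: "(cmod ?g)\<^sup>2 \<noteq> 0"
      \<comment> \<open>For \<open>?b = 0\<close> the expression is linear in \<open>s\<close> and
        takes the value \<open>-1\<close> at this point.\<close>
      show False
        using quad[of "(?a + 1) / (2 * (cmod ?g)\<^sup>2)"] g phi_star_mult_self_nonneg[of x]
        by (simp add: True)
    qed
    then show ?thesis using True by simp
  next
    case False
    then have b: "?b > 0" using phi_star_mult_self_nonneg[of y] by simp
    have "0 \<le> ?a - (cmod ?g)\<^sup>2 / ?b"
      using quad[of "1 / ?b"] b by (simp add: power2_eq_square)
    then show ?thesis using b by (simp add: field_simps)
  qed
qed

text \<open>The elements \<open>e m\<close> replace the unit: \<open>\<phi> (e m * b)\<close>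
  vanishes and tends to \<open>\<phi> b\<close>.\<close>

lemma phi_mult_left_eq_0:
  assumes "\<And>a. \<phi> (a * b) = 0"
  shows "\<phi> b = 0"
proof -
  obtain e where "(\<lambda>m::nat. e m * b) \<longlonglongrightarrow> b" by (rule ex_left_local_unit)
  from tendsto_phi[OF this] show ?thesis by (simp add: assms LIMSEQ_const_iff)
qed

text \<open>Local units of \<open>star b\<close>, transported by the involution and
  \<open>phi_hermitian\<close>. This is how vanishing for negative frequencies reaches the positive
  ones.\<close>

lemma phi_star_eq_0:
  assumes "\<And>a. \<phi> (a * star b) = 0"
  shows "\<phi> b = 0"
proof -
  obtain e where "(\<lambda>m::nat. e m * star b) \<longlonglongrightarrow> star b" by (rule ex_left_local_unit)
  from tendsto_star[OF this] have "(\<lambda>m. b * star (e m)) \<longlonglongrightarrow> b"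
    by (simp add: star_mult star_star)
  moreover have "\<phi> (b * star (e m)) = 0" for m
    using phi_hermitian[of "star b" "star (e m)"] assms[of "e m"] by (simp add: star_star)
  ultimately show ?thesis
    using tendsto_phi[of "\<lambda>m. b * star (e m)" b sequentially] by (simp add: LIMSEQ_const_iff)
qed

end

lemma state_space_wholeD:
  assumes "\<phi> \<in> state_space whole"
  shows "positive_functional \<phi>"
    and "(SUP x\<in>{x. norm x \<le> 1}. cmod (\<phi> x)) = 1"
proof -
  have *: "\<And>x y. \<phi> (x + y) = \<phi> x + \<phi> y" "\<And>c x. \<phi> (c *\<^sub>C x) = c * \<phi> x"
    "\<And>x. \<phi> (star x * x) \<in> \<real>\<^sub>\<ge>\<^sub>0" "bdd_above ((\<lambda>x. cmod (\<phi> x)) ` {x. norm x \<le> 1})"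
    "(SUP x\<in>{x. norm x \<le> 1}. cmod (\<phi> x)) = 1"
    using assms by (auto simp: state_space_def whole_def)
  have ball: "cmod (\<phi> x) \<le> 1" if "norm x \<le> 1" for x
    using cSUP_upper[of x "{x. norm x \<le> 1}" "\<lambda>x. cmod (\<phi> x)"] that *(4,5) by simp
  have "cmod (\<phi> x) \<le> norm x" for x
  proof (cases "x = 0")
    case True
    then show ?thesis using *(2)[of 0 0] by simp
  next
    case False
    have "cmod (\<phi> (of_real (1 / norm x) *\<^sub>C x)) \<le> 1"
      using False by (intro ball) (simp add: norm_scaleC norm_divide)
    then show ?thesis using False by (simp add: *(2) norm_mult norm_divide divide_le_eq)
  qed
  with * show "positive_functional \<phi>" by unfold_locales
  show "(SUP x\<in>{x. norm x \<le> 1}. cmod (\<phi> x)) = 1" by (rule *(5))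
qed

lemma state_space_wholeI:
  assumes "positive_functional \<phi>" "(SUP x\<in>{x. norm x \<le> 1}. cmod (\<phi> x)) = 1"
  shows "\<phi> \<in> state_space whole"
proof -
  interpret positive_functional \<phi> by fact
  have "bdd_above ((\<lambda>x. cmod (\<phi> x)) ` {x. norm x \<le> 1})"
    using cmod_phi_le order_trans by (intro bdd_aboveI[of _ 1]) fastforce
  then show ?thesis
    using assms(2) by (simp add: state_space_def whole_def phi_add phi_scaleC phi_pos)
qed

lemma entire_eq_if_eq_on_reals:
  assumes "f holomorphic_on UNIV" "g holomorphic_on UNIV" "\<And>t. f (complex_of_real t) = g (of_real t)"
  shows "f z = g z"
proof -
  have "(0::complex) islimpt range of_real"
    unfolding islimpt_approachable
  proof (intro allI impI)
    fix e :: real assume "e > 0"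
    then show "\<exists>x'\<in>range complex_of_real. x' \<noteq> 0 \<and> dist x' 0 < e"
      by (intro bexI[of _ "of_real (e / 2)"] rangeI) auto
  qed
  then have "f z - g z = 0"
    using assms
    by (intro analytic_continuation[of "\<lambda>z. f z - g z" UNIV "range of_real" 0 z])
       (auto intro!: holomorphic_intros)
  then show ?thesis by simp
qed

section \<open>Functionals on spectral spaces: boundedness and vanishing\<close>

context almost_periodic_dynamics
begin

lemma cspan_spectral_decomposition:
  assumes "x \<in> cspan (\<Union>\<omega>. A \<omega>)"
  obtains W c where "finite W" "\<And>\<omega>. c \<omega> \<in> A \<omega>" "x = (\<Sum>\<omega>\<in>W. c \<omega>)"
proof -
  have "\<exists>W c. finite W \<and> (\<forall>\<omega>. c \<omega> \<in> A \<omega>) \<and> x = (\<Sum>\<omega>\<in>W. c \<omega>)"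
    using assms
  proof (induction rule: cstar.span_induct_alt)
    case base
    show ?case by (intro exI[of _ "{}"] exI[of _ "\<lambda>_. 0"]) auto
  next
    case (step k x y)
    then obtain \<omega> W c where *: "x \<in> A \<omega>" "finite W" "\<And>\<omega>. c \<omega> \<in> A \<omega>" "y = (\<Sum>\<omega>\<in>W. c \<omega>)" by auto
    \<comment> \<open>Components of equal frequency are merged, so that the frequencies in the sum
      are distinct and orthogonality of the spectral spaces can be used.\<close>
    define c' where "c' = (\<lambda>\<omega>'. (if \<omega>' = \<omega> then k *\<^sub>C x else 0) + (if \<omega>' \<in> W then c \<omega>' else 0))"
    have "(\<Sum>\<omega>'\<in>insert \<omega> W. c' \<omega>') = k *\<^sub>C x + y"
    proof -
      have "(\<Sum>\<omega>'\<in>insert \<omega> W. if \<omega>' \<in> W then c \<omega>' else 0) = y"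
        unfolding *(4) by (rule sum.mono_neutral_cong_right) (use *(2) in auto)
      then show ?thesis using *(2) by (simp add: c'_def sum.distrib)
    qed
    moreover have "c' \<omega>' \<in> A \<omega>'" for \<omega>'
      using * by (auto simp: c'_def intro!: spectral_add spectral_scaleC)
    ultimately show ?case using *(2) by (intro exI[of _ "insert \<omega> W"] exI[of _ c']) auto
  qed
  with that show ?thesis by blast
qed

text \<open>On the spectral spaces the function extends explicitly by the
  identity theorem, negative frequencies are null vectors, and the others are damped in the upper
  half-plane. No Fourier decomposition of \<open>F z\<close> is needed.\<close>

lemma cmod_phi_entire_extension_le:
  assumes "positive_functional \<phi>" and inv: "\<And>t x. \<phi> (\<sigma> t x) = \<phi> x"
    and orth: "\<And>x y \<omega> \<omega>'. x \<in> A \<omega> \<Longrightarrow> y \<in> A \<omega>' \<Longrightarrow> \<omega> \<noteq> \<omega>' \<Longrightarrow> \<phi> (star x * y) = 0"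
    and neg: "\<And>x \<omega>. x \<in> A \<omega> \<Longrightarrow> \<omega> < 0 \<Longrightarrow> \<phi> (star x * x) = 0"
    and F: "entire_extension \<sigma> b F" and z: "0 \<le> Im z"
  shows "cmod (\<phi> (star c * F z)) \<le> norm c * norm b"
proof -
  interpret positive_functional \<phi> by fact
  have ext: "\<phi> (star x * F z) = exp (\<i> * z * of_real \<omega>) * \<phi> (star x * b)" if x: "x \<in> A \<omega>" for x \<omega>
  proof (rule entire_eq_if_eq_on_reals[of "\<lambda>z. \<phi> (star x * F z)"])
    show "(\<lambda>z. exp (\<i> * z * of_real \<omega>) * \<phi> (star x * b)) holomorphic_on UNIV"
      by (intro holomorphic_intros)
    show "(\<lambda>z. \<phi> (star x * F z)) holomorphic_on UNIV"
      unfolding holomorphic_on_def field_differentiable_def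
    proof (intro ballI)
      fix z
      obtain D where D: "((\<lambda>h. inverse h *\<^sub>C (F (z + h) - F z)) \<longlongrightarrow> D) (at 0)"
        using F by (auto simp: entire_extension_def)
      have "((\<lambda>h. \<phi> (star x * (inverse h *\<^sub>C (F (z + h) - F z)))) \<longlongrightarrow> \<phi> (star x * D)) (at 0)"
        by (intro tendsto_phi tendsto_mult tendsto_const D)
      then have "((\<lambda>h. (\<phi> (star x * F (z + h)) - \<phi> (star x * F z)) / h) \<longlongrightarrow> \<phi> (star x * D)) (at 0)"
        by (simp add: scaleC_mult_right phi_scaleC right_diff_distrib phi_diff divide_inverse mult.commute)
      then show "\<exists>f'. ((\<lambda>z. \<phi> (star x * F z)) has_field_derivative f') (at z within UNIV)"
        by (auto simp: DERIV_def)
    qed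
    show "\<phi> (star x * F (of_real t)) = exp (\<i> * of_real t * of_real \<omega>) * \<phi> (star x * b)" for t
    proof -
      have "\<phi> (star x * F (of_real t)) = \<phi> (star x * \<sigma> t b)"
        using F by (simp add: entire_extension_def)
      \<comment> \<open>Invariance moves the flow from \<open>b\<close> to the eigenvector
        \<open>x\<close>, where it is a scalar.\<close>
      also have "\<dots> = \<phi> (\<sigma> (- t) (star x * \<sigma> t b))" by (rule inv[symmetric])
      also have "\<sigma> (- t) (star x * \<sigma> t b) = star (\<sigma> (- t) x) * b"
        by (simp add: sigma_mult sigma_star flip: sigma_add_time)
      also have "\<dots> = exp (\<i> * of_real t * of_real \<omega>) *\<^sub>C (star x * b)"
        by (simp add: sigma_spectral[OF x] star_scaleC scaleC_mult_left exp_cnj mult.assoc)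
      finally show ?thesis by (simp add: phi_scaleC)
    qed
  qed
  have span: "cmod (\<phi> (star c * F z)) \<le> norm c * norm b" if "c \<in> cspan (\<Union>\<omega>. A \<omega>)" for c
  proof -
    obtain W x where x: "finite W" "\<And>\<omega>. x \<omega> \<in> A \<omega>" "c = (\<Sum>\<omega>\<in>W. x \<omega>)"
      using cspan_spectral_decomposition[OF \<open>c \<in> cspan (\<Union>\<omega>. A \<omega>)\<close>] by metis
    \<comment> \<open>\<open>exp (\<i> * z * \<omega>)\<close> has modulus
      \<open>exp (- \<omega> * Im z)\<close>, at most 1 for \<open>\<omega> \<ge> 0\<close>.
      Negative frequencies may be given the coefficient 0, since Cauchy-Schwarz removes them from
      the pairing with \<open>b\<close>.\<close>
    define k where "k = (\<lambda>\<omega>. if 0 \<le> \<omega> then cnj (exp (\<i> * z * of_real \<omega>)) else 0)"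
    define c' where "c' = (\<Sum>\<omega>\<in>W. k \<omega> *\<^sub>C x \<omega>)"
    have k1: "cmod (k \<omega>) \<le> 1" for \<omega>
      using z by (simp add: k_def)
    have sq: "Re (\<phi> (star (\<Sum>\<omega>\<in>W. y \<omega>) * (\<Sum>\<omega>\<in>W. y \<omega>))) = (\<Sum>\<omega>\<in>W. Re (\<phi> (star (y \<omega>) * y \<omega>)))"
      if "\<And>\<omega>. y \<omega> \<in> A \<omega>" for y
    proof -
      have "\<phi> (star (\<Sum>\<omega>\<in>W. y \<omega>) * (\<Sum>\<omega>\<in>W. y \<omega>)) = (\<Sum>\<omega>\<in>W. \<Sum>\<omega>'\<in>W. \<phi> (star (y \<omega>) * y \<omega>'))"
        by (simp add: star_sum sum_product phi_sum)
      also have "\<dots> = (\<Sum>\<omega>\<in>W. \<Sum>\<omega>'\<in>W. if \<omega>' = \<omega> then \<phi> (star (y \<omega>) * y \<omega>') else 0)"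
        by (intro sum.cong refl) (auto intro: orth that)
      finally show ?thesis using x(1) by simp
    qed
    have "\<phi> (star c * F z) = (\<Sum>\<omega>\<in>W. exp (\<i> * z * of_real \<omega>) * \<phi> (star (x \<omega>) * b))"
      by (simp add: x(3) star_sum sum_distrib_right phi_sum ext[OF x(2)])
    also have "\<dots> = (\<Sum>\<omega>\<in>W. cnj (k \<omega>) * \<phi> (star (x \<omega>) * b))"
    proof (intro sum.cong refl)
      fix \<omega>
      have "\<phi> (star (x \<omega>) * b) = 0" if "\<omega> < 0"
        using phi_cauchy_schwarz[of "x \<omega>" b] neg[OF x(2) that] by simp
      then show "exp (\<i> * z * of_real \<omega>) * \<phi> (star (x \<omega>) * b) = cnj (k \<omega>) * \<phi> (star (x \<omega>) * b)"
        by (cases "0 \<le> \<omega>") (auto simp: k_def)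
    qed
    also have "\<dots> = \<phi> (star c' * b)"
      by (simp add: c'_def star_sum star_scaleC sum_distrib_right phi_sum scaleC_mult_left phi_scaleC)
    finally have eq: "\<phi> (star c * F z) = \<phi> (star c' * b)" .
    \<comment> \<open>By orthogonality the coefficients \<open>k\<close> act diagonally, so the
      seminorm of \<open>c'\<close> with respect to \<open>\<phi>\<close> is at most that of
      \<open>c\<close>; no dependence on \<open>z\<close> remains.\<close>
    have "Re (\<phi> (star c' * c')) = (\<Sum>\<omega>\<in>W. Re (\<phi> (star (k \<omega> *\<^sub>C x \<omega>) * (k \<omega> *\<^sub>C x \<omega>))))"
      unfolding c'_def by (rule sq) (intro spectral_scaleC x(2))
    also have "\<dots> = (\<Sum>\<omega>\<in>W. (cmod (k \<omega>))\<^sup>2 * Re (\<phi> (star (x \<omega>) * x \<omega>)))"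
    proof (intro sum.cong refl)
      fix \<omega>
      have "\<phi> (star (k \<omega> *\<^sub>C x \<omega>) * (k \<omega> *\<^sub>C x \<omega>)) = of_real ((cmod (k \<omega>))\<^sup>2) * \<phi> (star (x \<omega>) * x \<omega>)"
        unfolding complex_norm_square
        by (simp add: star_scaleC scaleC_mult_left scaleC_mult_right scaleC_scaleC phi_scaleC mult.commute)
      then show "Re (\<phi> (star (k \<omega> *\<^sub>C x \<omega>) * (k \<omega> *\<^sub>C x \<omega>))) = (cmod (k \<omega>))\<^sup>2 * Re (\<phi> (star (x \<omega>) * x \<omega>))"
        by (simp del: of_real_power)
    qed
    also have "\<dots> \<le> (\<Sum>\<omega>\<in>W. 1 * Re (\<phi> (star (x \<omega>) * x \<omega>)))"
      using k1 by (intro sum_mono mult_right_mono phi_star_mult_self_nonneg) (simp add: power_le_one)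
    also have "\<dots> = Re (\<phi> (star c * c))" unfolding x(3) by (simp add: sq x(2))
    also have "\<dots> \<le> (norm c)\<^sup>2"
      using order_trans[OF complex_Re_le_cmod cmod_phi_le[of "star c * c"]] by (simp add: norm_star_mult)
    finally have c': "Re (\<phi> (star c' * c')) \<le> (norm c)\<^sup>2" .
    have b: "Re (\<phi> (star b * b)) \<le> (norm b)\<^sup>2"
      using order_trans[OF complex_Re_le_cmod cmod_phi_le[of "star b * b"]] by (simp add: norm_star_mult)
    have "(cmod (\<phi> (star c' * b)))\<^sup>2 \<le> (norm c)\<^sup>2 * (norm b)\<^sup>2"
      by (rule order_trans[OF phi_cauchy_schwarz])
         (intro mult_mono c' b phi_star_mult_self_nonneg zero_le_power2)
    then have "(cmod (\<phi> (star c' * b)))\<^sup>2 \<le> (norm c * norm b)\<^sup>2" by (simp add: power_mult_distrib)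
    then show ?thesis unfolding eq by (rule power2_le_imp_le) simp
  qed
  have "c \<in> closure (cspan (\<Union>\<omega>. A \<omega>))"
    using almost_periodic by (simp add: almost_periodic_def)
  then obtain f where f: "\<And>n::nat. f n \<in> cspan (\<Union>\<omega>. A \<omega>)" "f \<longlonglongrightarrow> c"
    using closure_sequential by blast
  have "(\<lambda>n. cmod (\<phi> (star (f n) * F z))) \<longlonglongrightarrow> cmod (\<phi> (star c * F z))"
    by (intro tendsto_norm tendsto_phi tendsto_mult tendsto_star tendsto_const f(2))
  moreover have "(\<lambda>n. norm (f n) * norm b) \<longlonglongrightarrow> norm c * norm b"
    by (intro tendsto_intros f(2))
  ultimately show ?thesis by (rule LIMSEQ_le) (use span[OF f(1)] in auto)
qed

lemma entire_extension_spectral: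
  assumes "b \<in> A \<omega>"
  shows "entire_extension \<sigma> b (\<lambda>z. exp (\<i> * z * of_real \<omega>) *\<^sub>C b)"
  unfolding entire_extension_def
proof (intro conjI allI)
  show "exp (\<i> * of_real t * of_real \<omega>) *\<^sub>C b = \<sigma> t b" for t
    by (simp add: sigma_spectral[OF assms] mult.assoc)
  fix z :: complex
  have "((\<lambda>z. exp (\<i> * z * of_real \<omega>)) has_field_derivative
      exp (\<i> * z * of_real \<omega>) * (\<i> * of_real \<omega>)) (at z)"
    by (auto intro!: derivative_eq_intros)
  then have "((\<lambda>h. (exp (\<i> * (z + h) * of_real \<omega>) - exp (\<i> * z * of_real \<omega>)) / h) \<longlongrightarrow>
      exp (\<i> * z * of_real \<omega>) * (\<i> * of_real \<omega>)) (at 0)"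
    by (simp add: DERIV_def)
  from tendsto_scaleC[OF this tendsto_const[of b]]
  show "\<exists>D. ((\<lambda>h. inverse h *\<^sub>C (exp (\<i> * (z + h) * of_real \<omega>) *\<^sub>C b - exp (\<i> * z * of_real \<omega>) *\<^sub>C b))
      \<longlongrightarrow> D) (at 0)"
    by (auto simp: scaleC_scaleC divide_inverse mult.commute simp flip: scaleC_diff_left)
qed

lemma ground_state_mult_negative:
  assumes \<phi>: "\<phi> \<in> ground_states \<sigma>" and b: "b \<in> A \<omega>" "\<omega> < 0"
  shows "\<phi> (a * b) = 0"
proof (rule ccontr)
  assume nz: "\<phi> (a * b) \<noteq> 0"
  interpret positive_functional \<phi>
    using \<phi> state_space_wholeD by (auto simp: ground_states_def)
  have "bounded ((\<lambda>z. \<phi> (a * (exp (\<i> * z * of_real \<omega>) *\<^sub>C b))) ` {z. 0 \<le> Im z})"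
    using \<phi> entire_extension_spectral[OF b(1)] by (simp add: ground_states_def)
  then obtain B where B: "\<And>z. 0 \<le> Im z \<Longrightarrow> cmod (\<phi> (a * (exp (\<i> * z * of_real \<omega>) *\<^sub>C b))) \<le> B"
    unfolding bounded_iff by auto
  have "exp (y * - \<omega>) * cmod (\<phi> (a * b)) \<le> B" if "0 \<le> y" for y :: real
  proof -
    have "\<i> * (\<i> * of_real y) * of_real \<omega> = of_real (y * - \<omega>)" by simp
    then show ?thesis
      using B[of "\<i> * of_real y"] that
      by (simp add: scaleC_mult_right phi_scaleC norm_mult)
  qed
  note bound = this
  \<comment> \<open>With this \<open>y\<close> the exponent times
    \<open>cmod (\<phi> (a * b))\<close> is \<open>\<bar>B\<bar>\<close>, and
    \<open>exp s \<ge> 1 + s\<close> turns the bound into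
    \<open>\<bar>B\<bar> + cmod (\<phi> (a * b)) \<le> B\<close>.\<close>
  define y where "y = \<bar>B\<bar> / (cmod (\<phi> (a * b)) * - \<omega>)"
  have pos: "cmod (\<phi> (a * b)) * - \<omega> > 0" using nz b(2) by (simp add: mult_pos_neg)
  then have y: "0 \<le> y" unfolding y_def by (intro divide_nonneg_pos) auto
  have "y * (cmod (\<phi> (a * b)) * - \<omega>) = \<bar>B\<bar>"
    by (rule iffD1[OF nonzero_eq_divide_eq[OF not_sym[OF less_imp_neq[OF pos]]] y_def])
  then have "\<bar>B\<bar> + cmod (\<phi> (a * b)) = (1 + y * - \<omega>) * cmod (\<phi> (a * b))"
    by (simp add: algebra_simps)
  also have "\<dots> \<le> exp (y * - \<omega>) * cmod (\<phi> (a * b))"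
    by (intro mult_right_mono exp_ge_add_one_self) simp
  also have "\<dots> \<le> B" by (rule bound[OF y])
  finally have "cmod (\<phi> (a * b)) \<le> 0" by linarith
  with nz show False by simp
qed

lemma ground_state_crystal_ideal:
  assumes \<phi>: "\<phi> \<in> ground_states \<sigma>" and x: "x \<in> J"
  shows "\<phi> x = 0"
proof -
  interpret positive_functional \<phi>
    using \<phi> state_space_wholeD by (auto simp: ground_states_def)
  have limit: "\<phi> l = 0" if "\<And>n::nat. \<phi> (f n) = 0" "f \<longlonglongrightarrow> l" for f l
    using tendsto_phi[OF that(2)] by (simp add: that(1) LIMSEQ_const_iff)
  show ?thesis
    using x unfolding crystal_ideal_def
  proof (induction rule: closure_cspan_induct)
    case (scale c x)
    then obtain \<omega> where \<omega>: "0 < \<omega>" "x \<in> spectral_ideal \<sigma> \<omega>" by auto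
    have "\<phi> x = 0"
      using \<omega>(2) unfolding spectral_ideal_def
    proof (induction rule: closure_cspan_induct)
      case (scale c x)
      then obtain y z where "x = y * star z" "z \<in> A \<omega>" by auto
      then show ?case
        using ground_state_mult_negative[OF \<phi> spectral_star, of z \<omega> y] \<omega>(1) by (simp add: phi_scaleC)
    qed (use limit in \<open>auto simp: phi_add\<close>)
    then show ?case by (simp add: phi_scaleC)
  qed (use limit in \<open>auto simp: phi_add\<close>)
qed

text \<open>Frequency 0 is fixed by \<open>cexp\<close> and all others are killed, so
  \<open>\<phi>\<close> has to kill them as well: negative ones by
  \<open>ground_state_mult_negative\<close> and local units, positive ones after passing to the
  adjoint.\<close>

lemma ground_state_cexp:
  assumes \<phi>: "\<phi> \<in> ground_states \<sigma>"
  shows "\<phi> (cexp x) = \<phi> x"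
proof -
  interpret positive_functional \<phi>
    using \<phi> state_space_wholeD by (auto simp: ground_states_def)
  show ?thesis
  proof (induction x rule: spectral_induct)
    case (spectral \<omega> x)
    consider "\<omega> = 0" | "\<omega> < 0" | "\<omega> > 0" by linarith
    then show ?case
    proof cases
      case 2
      then have "\<phi> x = 0"
        using ground_state_mult_negative[OF \<phi> spectral] phi_mult_left_eq_0[of x] by simp
      then show ?thesis using 2 by (simp add: cexp_spectral[OF spectral])
    next
      case 3
      then have "\<phi> x = 0"
        using ground_state_mult_negative[OF \<phi> spectral_star[OF spectral]] phi_star_eq_0[of x] by simp
      then show ?thesis using 3 by (simp add: cexp_spectral[OF spectral])
    qed (simp add: cexp_spectral[OF spectral])
  next
    case (limit f l)
    have "(\<lambda>n. \<phi> (f n)) \<longlonglongrightarrow> \<phi> (cexp l)"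
      using tendsto_phi[OF tendsto_cexp[OF limit(2)]] by (simp add: limit(1))
    then show ?case using tendsto_phi[OF limit(2)] by (rule LIMSEQ_unique)
  qed (simp add: cexp_add phi_add)
qed

end

section \<open>The correspondence between states of the crystal and ground states\<close>

context almost_periodic_dynamics_haar
begin

abbreviation "\<theta> \<equiv> crystal_map \<sigma> \<mu>"

lemma crystal_map_in_carr: "\<theta> x \<in> carr (crystal \<sigma>)"
  by (simp add: crystal_map_eq carr_crystal cexp_in_spectral_0)

lemma crystal_map_spectral_0: "b \<in> A 0 \<Longrightarrow> \<theta> b = coset b"
  using cexp_spectral[of b 0] by (simp add: crystal_map_eq)

lemma crystal_map_ball:
  "norm x \<le> 1 \<Longrightarrow> \<theta> x \<in> {X \<in> carr (crystal \<sigma>). normA (crystal \<sigma>) X \<le> 1}"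
  using contraction_crystal_map crystal_map_in_carr[of x]
  by (auto simp: contraction_def whole_def intro: order_trans)

lemma state_crystal_map_ground:
  assumes \<psi>: "\<psi> \<in> state_space (crystal \<sigma>)"
  shows "\<psi> \<circ> \<theta> \<in> ground_states \<sigma>"
proof -
  let ?C = "crystal \<sigma>" and ?\<phi> = "\<psi> \<circ> \<theta>"
  let ?ball = "{X \<in> carr ?C. normA ?C X \<le> 1}"
  have psi_add: "\<psi> (coset (a + b)) = \<psi> (coset a) + \<psi> (coset b)" if "a \<in> A 0" "b \<in> A 0" for a b
    using \<psi> that by (auto simp: state_space_def carr_crystal simp flip: addA_crystal)
  have psi_scale: "\<psi> (coset (c *\<^sub>C a)) = c * \<psi> (coset a)" if "a \<in> A 0" for c a
    using \<psi> that by (auto simp: state_space_def carr_crystal simp flip: scaleA_crystal)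
  have psi_pos: "\<psi> (coset (star a * a)) \<in> \<real>\<^sub>\<ge>\<^sub>0" if "a \<in> A 0" for a
    using \<psi> that spectral_0_star[OF that]
    by (auto simp: state_space_def carr_crystal starA_crystal multA_crystal)
  have bdd: "bdd_above ((\<lambda>X. cmod (\<psi> X)) ` ?ball)" and SUP: "(SUP X\<in>?ball. cmod (\<psi> X)) = 1"
    using \<psi> by (auto simp: state_space_def)
  have ball: "cmod (?\<phi> x) \<le> 1" if "norm x \<le> 1" for x
    using cSUP_upper[OF crystal_map_ball[OF that] bdd] SUP by simp
  have phi_add: "?\<phi> (x + y) = ?\<phi> x + ?\<phi> y" for x y
    by (simp add: crystal_map_eq cexp_add psi_add cexp_in_spectral_0)
  have phi_scale: "?\<phi> (c *\<^sub>C x) = c * ?\<phi> x" for c x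
    by (simp add: crystal_map_eq cexp_scaleC psi_scale cexp_in_spectral_0)
  have phi_pos: "?\<phi> (star x * x) \<in> \<real>\<^sub>\<ge>\<^sub>0" for x
  proof -
    obtain z where "z \<in> A 0" "cexp (star x * x) = star z * z" by (rule cexp_star_mult_self)
    then show ?thesis using psi_pos[of z] by (simp add: crystal_map_eq)
  qed
  have phi_le: "cmod (?\<phi> x) \<le> norm x" for x
  proof (cases "x = 0")
    case True
    then show ?thesis using phi_scale[of 0 0] by simp
  next
    case False
    have "cmod (?\<phi> (of_real (1 / norm x) *\<^sub>C x)) \<le> 1"
      using False by (intro ball) (simp add: norm_scaleC norm_divide)
    then show ?thesis
      unfolding phi_scale using False by (simp add: norm_mult norm_divide divide_le_eq)
  qed
  have pf: "positive_functional ?\<phi>"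
    by unfold_locales (rule phi_add phi_scale phi_pos phi_le)+
  interpret positive_functional ?\<phi> by (rule pf)
  let ?S = "SUP x\<in>{x. norm x \<le> 1}. cmod (?\<phi> x)"
  have bdd\<phi>: "bdd_above ((\<lambda>x. cmod (?\<phi> x)) ` {x. norm x \<le> 1})"
    using ball by (intro bdd_aboveI[of _ 1]) blast
  have "?S = 1"
  proof (rule antisym)
    show "?S \<le> 1" by (intro cSUP_least) (auto intro!: exI[of _ 0] ball[unfolded o_def])
    \<comment> \<open>The quotient norm is an infimum, so a coset of norm at most 1 has a
      representative \<open>b\<close> with \<open>norm b < 1 + e\<close>; rescaling it and letting
      \<open>e\<close> tend to 0 recovers the norm of \<open>\<psi>\<close>.\<close>
    have "cmod (\<psi> X) \<le> ?S" if X: "X \<in> ?ball" for X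
    proof -
      obtain a where a: "a \<in> A 0" "X = coset a" using X by (auto simp: carr_crystal)
      have le: "cmod (\<psi> X) \<le> (1 + e) * ?S" if e: "0 < e" for e
      proof -
        have "Inf (norm ` X) < 1 + e" using X e by (simp add: normA_crystal)
        moreover have "norm ` X \<noteq> {}" using J_zero by (auto simp: a elt_set_plus_def)
        ultimately obtain b where b: "b \<in> X" "norm b < 1 + e"
          using cInf_lessD[of "norm ` X" "1 + e"] by auto
        have "b \<in> A 0"
        proof -
          have "b - a \<in> A 0" using b(1) J_subset by (auto simp: a mem_coset_iff)
          then show ?thesis using spectral_add[OF a(1), of "b - a"] by simp
        qed
        have "X = \<theta> b"
          using coset_eq_if_mem[of b a] b(1) by (simp add: a crystal_map_spectral_0[OF \<open>b \<in> A 0\<close>])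
        have "norm (of_real (1 / (1 + e)) *\<^sub>C b) \<le> 1"
          using b(2) e by (simp add: norm_scaleC norm_divide del: of_real_add)
        then have "cmod (?\<phi> (of_real (1 / (1 + e)) *\<^sub>C b)) \<le> ?S"
          by (intro cSUP_upper bdd\<phi>) simp
        then have "cmod (\<psi> X) / (1 + e) \<le> ?S"
          unfolding phi_scale using e \<open>X = \<theta> b\<close> by (simp add: norm_mult norm_divide del: of_real_add)
        then show ?thesis using e by (simp add: divide_le_eq mult.commute)
      qed
      have "((\<lambda>n. (1 + inverse (real (Suc n))) * ?S) \<longlonglongrightarrow> (1 + 0) * ?S)"
        by (intro tendsto_intros LIMSEQ_inverse_real_of_nat)
      then have "cmod (\<psi> X) \<le> (1 + 0) * ?S"
        by (rule LIMSEQ_le_const) (intro exI[of _ 0] allI impI le, simp)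
      then show ?thesis by simp
    qed
    moreover have "?ball \<noteq> {}" using crystal_map_ball[of 0] by auto
    ultimately have "(SUP X\<in>?ball. cmod (\<psi> X)) \<le> ?S" by (intro cSUP_least)
    then show "1 \<le> ?S" unfolding SUP .
  qed
  then have state: "?\<phi> \<in> state_space whole" by (rule state_space_wholeI[OF pf])
  have "bounded ((\<lambda>z. ?\<phi> (a * F z)) ` {z. 0 \<le> Im z})" if F: "entire_extension \<sigma> b F" for a b F
  proof -
    have "?\<phi> x = 0" if "x \<in> A \<omega>" "\<omega> \<noteq> 0" for x \<omega>
      using that phi_zero by (simp add: crystal_map_eq cexp_spectral cexp_spectral[OF spectral_zero])
    \<comment> \<open>\<open>star x * y\<close> has the nonzero frequency
      \<open>\<omega>' - \<omega>\<close>, which \<open>cexp\<close> annihilates.\<close>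
    then have orth: "?\<phi> (star x * y) = 0" if "x \<in> A \<omega>" "y \<in> A \<omega>'" "\<omega> \<noteq> \<omega>'" for x y \<omega> \<omega>'
      using spectral_mult[OF spectral_star[OF that(1)] that(2)] that(3) by simp
    have neg: "?\<phi> (star x * x) = 0" if x: "x \<in> A \<omega>" "\<omega> < 0" for x \<omega>
    proof -
      \<comment> \<open>\<open>star x\<close> has the positive frequency \<open>- \<omega>\<close>,
        so \<open>star x * x\<close> lies in one of the ideals that generate
        \<open>J\<close>.\<close>
      have sx: "star x \<in> A (- \<omega>)" by (rule spectral_star[OF x(1)])
      have "star x * star (star x) \<in> spectral_ideal \<sigma> (- \<omega>)"
        unfolding spectral_ideal_def using sx by (intro base_in_closure_cspan) blast
      then have "star x * x \<in> J"
        unfolding crystal_ideal_def using x(2) by (intro base_in_closure_cspan) (auto simp: star_star)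
      moreover from this have "coset (star x * x) = coset 0"
        by (simp only: coset_eq_iff diff_zero)
      ultimately have "\<theta> (star x * x) = \<theta> 0"
        using J_subset crystal_map_spectral_0[of 0] crystal_map_spectral_0[of "star x * x"]
        by (simp add: subsetD)
      then show ?thesis using phi_zero by simp
    qed
    have inv: "?\<phi> (\<sigma> t x) = ?\<phi> x" for t x by (simp add: crystal_map_eq cexp_sigma)
    have "cmod (?\<phi> (star (star a) * F z)) \<le> norm (star a) * norm b" if "0 \<le> Im z" for z
      by (rule cmod_phi_entire_extension_le[OF pf _ _ _ F that]) (assumption | rule inv neg orth)+
    then show ?thesis
      unfolding bounded_iff by (intro exI[of _ "norm a * norm b"]) (auto simp: star_star)
  qed
  with state show ?thesis by (auto simp: ground_states_def)
qed

lemma inj_state_crystal_map: "inj_on (\<lambda>\<psi>. \<psi> \<circ> \<theta>) (state_space (crystal \<sigma>))"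
proof (rule inj_onI)
  fix \<psi> \<psi>' assume \<psi>: "\<psi> \<in> state_space (crystal \<sigma>)" "\<psi>' \<in> state_space (crystal \<sigma>)"
    and eq: "\<psi> \<circ> \<theta> = \<psi>' \<circ> \<theta>"
  show "\<psi> = \<psi>'"
  proof (rule extensionalityI)
    show "\<psi> \<in> extensional (carr (crystal \<sigma>))" "\<psi>' \<in> extensional (carr (crystal \<sigma>))"
      using \<psi> by (auto simp: state_space_def)
    fix X assume "X \<in> carr (crystal \<sigma>)"
    then obtain x where "X = \<theta> x" using crystal_map_onto by (metis imageE)
    then show "\<psi> X = \<psi>' X" using fun_cong[OF eq, of x] by simp
  qed
qed

lemma ground_state_factors:
  assumes \<phi>: "\<phi> \<in> ground_states \<sigma>"
  obtains \<psi> where "\<psi> \<in> state_space (crystal \<sigma>)" "\<phi> = \<psi> \<circ> \<theta>"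
proof -
  let ?C = "crystal \<sigma>"
  have state: "\<phi> \<in> state_space whole" using \<phi> by (simp add: ground_states_def)
  interpret positive_functional \<phi> by (rule state_space_wholeD(1)[OF state])
  \<comment> \<open>Any representative will do, as \<open>\<phi>\<close> vanishes on
    \<open>J\<close>; \<open>restrict\<close> supplies the extensionality that
    \<open>state_space\<close> demands.\<close>
  define \<psi> where "\<psi> = restrict (\<lambda>X. \<phi> (SOME b. b \<in> X)) (carr ?C)"
  have mem: "\<phi> b = \<phi> a" if "b \<in> coset a" for a b
    using ground_state_crystal_ideal[OF \<phi>, of "b - a"] that by (simp add: mem_coset_iff phi_diff)
  have psi: "\<psi> (coset a) = \<phi> a" if "a \<in> A 0" for a
  proof -
    have "(SOME b. b \<in> coset a) \<in> coset a"
      by (rule someI[of _ a]) (simp add: mem_coset_iff J_zero)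
    then show ?thesis using that by (simp add: \<psi>_def carr_crystal mem)
  qed
  have factor: "\<phi> = \<psi> \<circ> \<theta>"
    by (rule ext) (simp add: crystal_map_eq psi cexp_in_spectral_0 ground_state_cexp[OF \<phi>])
  let ?ball = "{X \<in> carr ?C. normA ?C X \<le> 1}"
  have le: "cmod (\<psi> X) \<le> 1" if X: "X \<in> ?ball" for X
  proof -
    obtain a where a: "a \<in> A 0" "X = coset a" using X by (auto simp: carr_crystal)
    \<comment> \<open>Every representative \<open>b\<close> of \<open>X\<close> satisfies
      \<open>\<psi> X = \<phi> b\<close>, so \<open>cmod (\<psi> X)\<close> is below all the norms
      whose infimum is the quotient norm.\<close>
    have "cmod (\<psi> X) \<le> Inf (norm ` X)"
    proof (rule cInf_greatest)
      show "norm ` X \<noteq> {}" using J_zero by (auto simp: a elt_set_plus_def)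
      fix y assume "y \<in> norm ` X"
      then obtain b where "y = norm b" "b \<in> coset a" using a by auto
      then show "cmod (\<psi> X) \<le> y" using cmod_phi_le[of b] mem[of b a] by (simp add: a psi)
    qed
    then show ?thesis using X by (simp add: normA_crystal)
  qed
  have bdd: "bdd_above ((\<lambda>X. cmod (\<psi> X)) ` ?ball)" using le by (intro bdd_aboveI[of _ 1]) auto
  have "(SUP X\<in>?ball. cmod (\<psi> X)) = 1"
  proof (rule antisym)
    show "(SUP X\<in>?ball. cmod (\<psi> X)) \<le> 1"
      using crystal_map_ball[of 0] by (intro cSUP_least le) auto
    \<comment> \<open>\<open>\<theta>\<close> maps the unit ball of the algebra into that of the
      crystal, so the norm of \<open>\<psi>\<close> is at least that of
      \<open>\<phi>\<close>.\<close>
    have "(SUP x\<in>{x. norm x \<le> 1}. cmod (\<phi> x)) \<le> (SUP X\<in>?ball. cmod (\<psi> X))"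
    proof (rule cSUP_least)
      show "{x :: 'a. norm x \<le> 1} \<noteq> {}" by (auto intro!: exI[of _ 0])
      fix x :: 'a assume "x \<in> {x. norm x \<le> 1}"
      then have "\<theta> x \<in> ?ball" by (intro crystal_map_ball) simp
      from cSUP_upper[OF this bdd] show "cmod (\<phi> x) \<le> (SUP X\<in>?ball. cmod (\<psi> X))"
        by (simp add: factor)
    qed
    then show "1 \<le> (SUP X\<in>?ball. cmod (\<psi> X))" using state_space_wholeD(2)[OF state] by simp
  qed
  moreover have "\<psi> (addA ?C X Y) = \<psi> X + \<psi> Y" if "X \<in> carr ?C" "Y \<in> carr ?C" for X Y
    using that by (auto simp: carr_crystal addA_crystal psi spectral_add phi_add)
  moreover have "\<psi> (scaleA ?C c X) = c * \<psi> X" if "X \<in> carr ?C" for c X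
    using that by (auto simp: carr_crystal scaleA_crystal psi spectral_scaleC phi_scaleC)
  moreover have "\<psi> (multA ?C (starA ?C X) X) \<in> \<real>\<^sub>\<ge>\<^sub>0" if "X \<in> carr ?C" for X
    using that
    by (auto simp: carr_crystal starA_crystal multA_crystal spectral_0_star spectral_0_mult psi phi_pos)
  moreover have "\<psi> \<in> extensional (carr ?C)" by (simp add: \<psi>_def)
  ultimately have "\<psi> \<in> state_space ?C" using bdd by (simp add: state_space_def)
  then show ?thesis using factor by (rule that)
qed

lemma bij_state_crystal_map:
  "bij_betw (\<lambda>\<psi>. \<psi> \<circ> \<theta>) (state_space (crystal \<sigma>)) (ground_states \<sigma>)"
  unfolding bij_betw_def
proof (intro conjI inj_state_crystal_map equalityI subsetI)
  fix \<phi> assume "\<phi> \<in> ground_states \<sigma>"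
  then obtain \<psi> where "\<psi> \<in> state_space (crystal \<sigma>)" "\<phi> = \<psi> \<circ> \<theta>" by (rule ground_state_factors)
  then show "\<phi> \<in> (\<lambda>\<psi>. \<psi> \<circ> \<theta>) ` state_space (crystal \<sigma>)" by blast
qed (auto intro: state_crystal_map_ground)

text \<open>For a zero crystal \<open>J\<close> is all of \<open>A 0\<close>; a ground state then
  vanishes identically, against its norm being 1.\<close>

lemma no_ground_states:
  assumes trivial: "carr (crystal \<sigma>) = {zeroA (crystal \<sigma>)}"
  shows "ground_states \<sigma> = {}"
proof (rule ccontr)
  assume "ground_states \<sigma> \<noteq> {}"
  then obtain \<phi> where \<phi>: "\<phi> \<in> ground_states \<sigma>" by blast
  have "\<phi> x = 0" for x
  proof -
    have "coset (cexp x) = J"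
      using trivial crystal_map_in_carr[of x] by (simp add: crystal_map_eq zeroA_crystal)
    then have "cexp x \<in> J" using coset_eq_iff[of "cexp x" 0] by simp
    then show ?thesis
      using ground_state_crystal_ideal[OF \<phi>] ground_state_cexp[OF \<phi>, of x] by simp
  qed
  moreover have "(SUP x\<in>{x. norm x \<le> 1}. cmod (\<phi> x)) = 1"
    using state_space_wholeD(2) \<phi> by (auto simp: ground_states_def)
  moreover have "{x :: 'a. norm x \<le> 1} \<noteq> {}" by (auto intro!: exI[of _ 0])
  ultimately show False by simp
qed

end

theorem proposition2p2:
  fixes \<sigma> :: "real \<Rightarrow> 'a::cstar_algebra \<Rightarrow> 'a"
    and \<mu> :: "(real \<Rightarrow> complex) measure"
  assumes "almost_periodic \<sigma>"
    and "normalized_haar_measure (dual_group (frequency_group \<sigma>)) \<mu>"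
  shows "completely_positive whole (crystal \<sigma>) (crystal_map \<sigma> \<mu>) \<and>
    contraction whole (crystal \<sigma>) (crystal_map \<sigma> \<mu>) \<and>
    crystal_map \<sigma> \<mu> ` UNIV = carr (crystal \<sigma>) \<and>
    (carr (crystal \<sigma>) \<noteq> {zeroA (crystal \<sigma>)} \<longrightarrow>
      bij_betw (\<lambda>\<psi>. \<psi> \<circ> crystal_map \<sigma> \<mu>) (state_space (crystal \<sigma>)) (ground_states \<sigma>)) \<and>
    (carr (crystal \<sigma>) = {zeroA (crystal \<sigma>)} \<longrightarrow> ground_states \<sigma> = {})"
proof -
  interpret almost_periodic_dynamics_haar \<sigma> \<mu>
    using assms by unfold_locales
  show ?thesis
    using completely_positive_crystal_map contraction_crystal_map crystal_map_onto
      bij_state_crystal_map no_ground_states by blast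
qed

end
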